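(* Let $N\in\mathbb{N}$, $N\ge2$, $T>0$. Let $\psi:(0,\infty)\to[0,\infty)$ satisfy $$\forall r>0,\qquad K_3\inf(1,r^{\gamma_1+2})\le\psi(r)\le K_1r^{2-\delta}+K_2r^{\gamma_2+2}$$ for some $K_1,K_2,K_3>0$, $\delta\in(0,2]$, $\gamma_1\le0$, $\gamma_2\in(-4,-\delta]$, and assume that $$(\gamma_2+2)\,\bigl(1-\inf(\gamma_1/2,-1)\bigr)>-4.$$ Let $f=f(t,v)\ge0$ be a weak solution on $[0,T]\times\mathbb{R}^N$ of the Landau equation associated to $\psi$ and to an initial datum $f_{in}\in L^1_2\cap L\ln L(\mathbb{R}^N)$, in the following sense: (1) $f\in C([0,T];\mathcal{D}'(\mathbb{R}^N))\cap L^\infty([0,T];L^1_2\cap L\ln L(\mathbb{R}^N))$ and $f(0,\cdot)=f_{in}$; (2) for all $t\in[0,T]$ and $\phi\in\{1,v_1,\dots,v_N,|v|^2/2\}$, $\int f(t,v)\phi(v)dv=\int f_{in}(v)\phi(v)dv$; (3) $\sup_{t\in[0,T]}\int f(t,v)|\ln f(t,v)|\,dv<+\infty$; (4) if $N\ge3$, $$\mathcal{Q}_{T,N,\gamma_1}(f):=\int_0^T\Bigl(\int_{\mathbb{R}^N}|f(t,v)|^{\frac{N}{N-2}}(1+|v|^2)^{\frac{N}{N-2}\inf(\frac{\gamma_1}{2},-1)}dv\Bigr)^{\frac{N-2}{N}}dt<+\infty,$$ and if $N=2$ the same holds with $\frac{N}{N-2}$ replaced by every $q\in[1,+\infty)$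 (and $\frac{N-2}{N}$ by $\frac1q$); (5) for all $\varphi\in C^2_c(\mathbb{R}^N)$ and all $t_1\le t_2$ in $[0,T]$, $$\int f(t_2,v)\varphi(v)dv-\int f(t_1,v)\varphi(v)dv=\frac12\sum_{i,j=1}^N\int_{t_1}^{t_2}\!\!\iint f(s,v)f(s,w)a_{ij}(v-w)\bigl(\partial_{ij}\varphi(v)+\partial_{ij}\varphi(w)\bigr)dv\,dw\,ds$$ $$+\sum_{i=1}^N\int_{t_1}^{t_2}\!\!\iint f(s,v)f(s,w)b_i(v-w)\bigl(\partial_i\varphi(v)-\partial_i\varphi(w)\bigr)dv\,dw\,ds.$$ Then for all $k\in\mathbb{R}$ such that $\int_{\mathbb{R}^N}f_{in}(v)(1+|v|^2)^kdv<+\infty$, $$\sup_{t\in[0,T]}\int_{\mathbb{R}^N}f(t,v)(1+|v|^2)^kdv<+\infty.$$ More precisely, this last quantity is bounded by a constant depending only on $T$, $N$, $k$, the parameters $K_1,K_2,K_3,\delta,\gamma_1,\gamma_2$ of $\psi$, the initial mass, momentum and energy, (an upper bound of) the entropy, the quantity $\mathcal{Q}_{T,N,\gamma_1}(f)$ (resp. its analogues for $q\in[1,\infty)$ if $N=2$), and the initial moment $\int f_{in}(v)(1+|v|^2)^kdv$.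
   Context: $\inf(a,b)$ denotes the minimum. For $l\in\mathbb{R}$, $p\in[1,\infty]$: $\|f\|_{L^p_l(\mathbb{R}^N)}:=\|(1+|v|^2)^{l/2}f\|_{L^p(\mathbb{R}^N)}$; a nonnegative $f\in L^1$ belongs to $L\ln L$ if $\int f|\ln f|dv<\infty$. For $z\in\mathbb{R}^N\setminus\{0\}$: $$a_{ij}(z)=\Bigl(\delta_{ij}-\frac{z_iz_j}{|z|^2}\Bigr)\psi(|z|),\qquad b_i(z)=\sum_j\partial_ja_{ij}(z)=-(N-1)\frac{z_i}{|z|^2}\psi(|z|).$$ The Landau equation is $\partial_tf=Q(f,f)$ with $Q(f,f)(v)=\sum_i\partial_{v_i}\int\sum_ja_{ij}(v-w)\bigl(f(w)\partial_jf(v)-f(v)\partial_jf(w)\bigr)dw$; (5) is its weak form, and each term in it is well defined as a consequence of the other assumptions on $f$. *)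

theory Defs
  imports "HOL-Analysis.Analysis"
begin

text \<open>
  Functions on \<open>R^N\<close> are taken to be Lebesgue measurable and stand for their almost-everywhere
  classes, so all integrals are with respect to the completed measure \<open>lebesgue\<close>
  (the Bochner integral with respect to \<open>lborel\<close> is 0 on functions that are not Borel).
\<close>

subsection \<open>Test functions\<close>

definition partial :: "'n::finite \<Rightarrow> (real^'n \<Rightarrow> real) \<Rightarrow> real^'n \<Rightarrow> real" where
  "partial i \<phi> v = frechet_derivative \<phi> (at v) (axis i 1)"

primrec Ck :: "nat \<Rightarrow> (real^'n::finite \<Rightarrow> real) \<Rightarrow> bool" where
  "Ck 0 \<phi> \<longleftrightarrow> continuous_on UNIV \<phi>"
| "Ck (Suc k) \<phi> \<longleftrightarrow> \<phi> differentiable_on UNIV \<and> (\<forall>i. Ck k (partial i \<phi>))"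

definition compact_support :: "(real^'n::finite \<Rightarrow> real) \<Rightarrow> bool" where
  "compact_support \<phi> \<longleftrightarrow> compact (closure (support_on UNIV \<phi>))"

definition C2c :: "(real^'n::finite \<Rightarrow> real) set" where
  "C2c = {\<phi>. Ck 2 \<phi> \<and> compact_support \<phi>}"

definition Cinfc :: "(real^'n::finite \<Rightarrow> real) set" where
  "Cinfc = {\<phi>. (\<forall>k. Ck k \<phi>) \<and> compact_support \<phi>}"

subsection \<open>Function spaces\<close>

definition weighted_L1 :: "real \<Rightarrow> (real^'n::finite \<Rightarrow> real) set" where
  "weighted_L1 l = {g. g \<in> borel_measurable lebesgue \<and>
     integrable lebesgue (\<lambda>v. (1 + (norm v)\<^sup>2) powr (l / 2) * g v)}"

definition weighted_L1_norm :: "real \<Rightarrow> (real^'n::finite \<Rightarrow> real) \<Rightarrow> real" where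
  "weighted_L1_norm l g = (\<integral>v. \<bar>(1 + (norm v)\<^sup>2) powr (l / 2) * g v\<bar> \<partial>lebesgue)"

text \<open>The library convention \<open>ln 0 = 0\<close> gives the usual value \<open>0\<close> to \<open>x * ln x\<close> at \<open>x = 0\<close>.\<close>

definition LlnL :: "(real^'n::finite \<Rightarrow> real) set" where
  "LlnL = {g. (AE v in lebesgue. 0 \<le> g v) \<and> integrable lebesgue g \<and>
     integrable lebesgue (\<lambda>v. g v * \<bar>ln (g v)\<bar>)}"

definition abs_entropy :: "(real^'n::finite \<Rightarrow> real) \<Rightarrow> real" where
  "abs_entropy g = (\<integral>v. g v * \<bar>ln (g v)\<bar> \<partial>lebesgue)"

definition entropy :: "(real^'n::finite \<Rightarrow> real) \<Rightarrow> real" where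
  "entropy g = (\<integral>v. g v * ln (g v) \<partial>lebesgue)"

definition mass :: "(real^'n::finite \<Rightarrow> real) \<Rightarrow> real" where
  "mass g = (\<integral>v. g v \<partial>lebesgue)"

definition momentum :: "(real^'n::finite \<Rightarrow> real) \<Rightarrow> real^'n" where
  "momentum g = (\<chi> i. \<integral>v. g v * v $ i \<partial>lebesgue)"

definition energy :: "(real^'n::finite \<Rightarrow> real) \<Rightarrow> real" where
  "energy g = (\<integral>v. g v * ((norm v)\<^sup>2 / 2) \<partial>lebesgue)"

definition moment :: "real \<Rightarrow> (real^'n::finite \<Rightarrow> real) \<Rightarrow> ennreal" where
  "moment k g = (\<integral>\<^sup>+v. ennreal (g v * (1 + (norm v)\<^sup>2) powr k) \<partial>lebesgue)"

subsection \<open>The Landau kernel\<close>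

definition kernel_bounds ::
  "real \<Rightarrow> real \<Rightarrow> real \<Rightarrow> real \<Rightarrow> real \<Rightarrow> real \<Rightarrow> (real \<Rightarrow> real) \<Rightarrow> bool" where
  "kernel_bounds K1 K2 K3 \<delta> \<gamma>1 \<gamma>2 \<psi> \<longleftrightarrow>
     \<psi> \<in> borel_measurable (lebesgue_on {0<..}) \<and>
     (\<forall>r>0. 0 \<le> \<psi> r \<and>
        K3 * min 1 (r powr (\<gamma>1 + 2)) \<le> \<psi> r \<and>
        \<psi> r \<le> K1 * r powr (2 - \<delta>) + K2 * r powr (\<gamma>2 + 2))"

text \<open>
  The values at \<open>z = 0\<close>, i.e. on the diagonal \<open>v = w\<close>, are irrelevant: the diagonal is a null set
  of \<open>R^N x R^N\<close>. No derivative of \<open>\<psi>\<close> occurs in \<open>b_i = sum_j d_j a_ij\<close>, because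
  \<open>sum_j (\<delta>_ij - z_i z_j / |z|^2) z_j = 0\<close>.
\<close>

definition landau_a :: "(real \<Rightarrow> real) \<Rightarrow> 'n::finite \<Rightarrow> 'n \<Rightarrow> real^'n \<Rightarrow> real" where
  "landau_a \<psi> i j z = ((if i = j then 1 else 0) - z $ i * z $ j / (norm z)\<^sup>2) * \<psi> (norm z)"

definition landau_b :: "(real \<Rightarrow> real) \<Rightarrow> 'n::finite \<Rightarrow> real^'n \<Rightarrow> real" where
  "landau_b \<psi> i z = - (real CARD('n) - 1) * (z $ i / (norm z)\<^sup>2) * \<psi> (norm z)"

subsection \<open>Weak solutions\<close>

text \<open>The power of an extended nonnegative real, for exponents \<open>p > 0\<close>.\<close>

definition ennpowr :: "ennreal \<Rightarrow> real \<Rightarrow> ennreal" where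
  "ennpowr x p = (if x = \<infinity> then \<infinity> else ennreal (enn2real x powr p))"

definition landau_Q :: "real \<Rightarrow> real \<Rightarrow> (real \<Rightarrow> real^'n::finite \<Rightarrow> real) \<Rightarrow> real \<Rightarrow> ennreal" where
  "landau_Q T \<gamma>1 f q =
     (\<integral>\<^sup>+t\<in>{0..T}. ennpowr
        (\<integral>\<^sup>+v. ennreal (\<bar>f t v\<bar> powr q * (1 + (norm v)\<^sup>2) powr (q * min (\<gamma>1 / 2) (-1))) \<partial>lebesgue)
        (1 / q) \<partial>lebesgue)"

text \<open>The exponents \<open>q\<close> for which \<open>landau_Q\<close> is required to be finite, in dimension \<open>N >= 2\<close>.\<close>

definition Q_exponents :: "'n::finite itself \<Rightarrow> real set" where
  "Q_exponents _ =
     (if CARD('n) = 2 then {1..} else {real CARD('n) / (real CARD('n) - 2)})"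

definition landau_weak_form :: "real \<Rightarrow> (real \<Rightarrow> real) \<Rightarrow> (real \<Rightarrow> real^'n::finite \<Rightarrow> real) \<Rightarrow> bool" where
  "landau_weak_form T \<psi> f \<longleftrightarrow>
     (\<forall>\<phi>\<in>C2c. \<forall>t1 t2. 0 \<le> t1 \<and> t1 \<le> t2 \<and> t2 \<le> T \<longrightarrow>
        (\<integral>v. f t2 v * \<phi> v \<partial>lebesgue) - (\<integral>v. f t1 v * \<phi> v \<partial>lebesgue) =
          1 / 2 * (\<Sum>i\<in>UNIV. \<Sum>j\<in>UNIV. LINT s:{t1..t2}|lebesgue.
             (\<integral>(v, w). f s v * f s w * landau_a \<psi> i j (v - w) *
                (partial i (partial j \<phi>) v + partial i (partial j \<phi>) w) \<partial>lebesgue))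
          + (\<Sum>i\<in>UNIV. LINT s:{t1..t2}|lebesgue.
             (\<integral>(v, w). f s v * f s w * landau_b \<psi> i (v - w) *
                (partial i \<phi> v - partial i \<phi> w) \<partial>lebesgue)))"

text \<open>
  Membership of \<open>f t\<close> in the spaces is required for every \<open>t\<close>, so that the integrals in the
  conservation laws and in the entropy bound below exist for every \<open>t\<close>. Continuity into
  distributions is tested against each smooth compactly supported function.
\<close>

definition landau_weak_solution ::
  "real \<Rightarrow> real \<Rightarrow> (real \<Rightarrow> real) \<Rightarrow> (real^'n::finite \<Rightarrow> real) \<Rightarrow> (real \<Rightarrow> real^'n \<Rightarrow> real) \<Rightarrow> bool" where
  "landau_weak_solution T \<gamma>1 \<psi> fin f \<longleftrightarrow>
     fin \<in> weighted_L1 2 \<inter> LlnL \<and>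
     (\<lambda>(t, v). f t v) \<in> borel_measurable (lebesgue_on ({0..T} \<times> UNIV)) \<and>
     (\<forall>t\<in>{0..T}. f t \<in> weighted_L1 2 \<inter> LlnL) \<and>
     (\<forall>\<phi>\<in>Cinfc. continuous_on {0..T} (\<lambda>t. \<integral>v. f t v * \<phi> v \<partial>lebesgue)) \<and>
     (\<exists>B. AE t in lebesgue_on {0..T}. weighted_L1_norm 2 (f t) \<le> B \<and> abs_entropy (f t) \<le> B) \<and>
     (AE v in lebesgue. f 0 v = fin v) \<and>
     (\<forall>t\<in>{0..T}. \<forall>\<phi>\<in>{\<lambda>v. 1} \<union> range (\<lambda>i v. v $ i) \<union> {\<lambda>v. (norm v)\<^sup>2 / 2}.
        (\<integral>v. f t v * \<phi> v \<partial>lebesgue) = (\<integral>v. fin v * \<phi> v \<partial>lebesgue)) \<and>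
     bdd_above ((\<lambda>t. abs_entropy (f t)) ` {0..T}) \<and>
     (\<forall>q\<in>Q_exponents TYPE('n). landau_Q T \<gamma>1 f q < \<infinity>) \<and>
     landau_weak_form T \<psi> f"

end

theory Submission
  imports Defs
begin

text \<open>
  Write \<open>y = 1 + |v|^2\<close>, \<open>y' = 1 + |w|^2\<close> and \<open>z = v - w\<close>. For a radial test function \<open>g(y)\<close> the weak form
  integrates \<open>f(v) f(w)\<close> against
  \<open>\<psi>(|z|) / |z|^2 * (- (N - 1) (g'(y) - g'(y')) (y - y') + 2 (g''(y) + g''(y')) (|v|^2 |w|^2 - (v . w)^2))\<close>
  (\<open>landau_op_eq\<close>). If \<open>g\<close> is convex, the first term is nonpositive and can be dropped. In the second one,
  the Gram determinant is at most \<open>y y'\<close>, and at most \<open>|z|^2\<close> times the smaller of \<open>|v|^2\<close> and \<open>|w|^2\<close>.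
  For \<open>g(y) = y^k\<close> with \<open>k > 1\<close> this leaves, up to constants, \<open>y^k y'\<close> when \<open>|z| \<ge> 1\<close>
  and \<open>|z|^(-s) y^(k-1)\<close> when \<open>|z| < 1\<close>, where \<open>s > 0\<close> and \<open>s \<ge> - (\<gamma>2 + 2)\<close> (\<open>landau_op_convex_le\<close>).
  The first contribution is at most a constant times the \<open>k\<close>-th moment times mass plus energy.

  The second contribution loses one power of \<open>y\<close>, so the \<open>k\<close>-th moment controls it as soon as the integral of
  \<open>f(w) |v - w|^(-s)\<close> over the unit ball around \<open>v\<close> is \<open>O(y)\<close>. This is \<open>local_singular_bound\<close>, the heart
  of the proof. Split at the radius \<open>\<rho> = y^(-2/s)\<close>. Outside, \<open>|v - w|^(-s) \<le> y^2\<close>, while the mass of \<open>f\<close> near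
  \<open>v\<close> is \<open>O(1/y)\<close> because the energy is finite. Inside, Hoelder's inequality with the weighted \<open>L^q\<close> norm of \<open>f\<close>
  costs a factor \<open>y^m\<close> with \<open>m = - inf(\<gamma>1/2, -1)\<close> and gains \<open>\<rho>^(d-s)\<close> with \<open>d = N (1 - 1/q)\<close>. The result
  is \<open>O(y)\<close> precisely when \<open>(m + 1) s \<le> 2 d\<close>. Here \<open>d = 2\<close> for \<open>N \<ge> 3\<close>, and \<open>d\<close> is as close to \<open>2\<close> as
  desired for \<open>N = 2\<close>; so \<open>(\<gamma>2 + 2) (1 - inf(\<gamma>1/2, -1)) > -4\<close> is what makes the choice of \<open>q\<close> and \<open>s\<close> possible
  (\<open>admissible_exponent\<close>). Hence the moment grows at a rate proportional to itself, with a factor that is affine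
  in the weighted \<open>L^q\<close> norm and thus integrable in time, and an integral Gronwall inequality concludes
  (\<open>Gronwall_finite_doubling\<close>). For \<open>k \<le> 1\<close>, mass and energy bound the moment directly.

  Since \<open>y^k\<close> has no compact support and its integral may be infinite a priori, it is approximated twice. The
  function \<open>y (y / (1 + \<epsilon> y))^(k-1)\<close> is still convex, satisfies the same inequality between itself and its second
  derivative with a constant independent of \<open>\<epsilon>\<close>, and grows only linearly, so that its integral is finite by
  conservation of energy. Multiplying it by \<open>max(0, 1 - y/n)^3\<close> gives an element of \<open>C2c\<close>; the cutoff destroys
  convexity but is removed by dominated convergence before convexity is used (\<open>reg_power_moment_identity\<close>), and
  \<open>\<epsilon>\<close> tends to \<open>0\<close> by Fatou's lemma at the very end (\<open>moment_growth\<close>).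

  Solution and kernel are only Lebesgue measurable. To apply Fubini's theorem they are replaced by Borel functions
  that agree with them almost everywhere. For the kernel, which enters through \<open>\<psi>(|v - w|)\<close>, this uses that the
  preimage of a null set under the norm is a null set (\<open>AE_norm_notin_null\<close>).
\<close>

section \<open>Lebesgue integrals through Borel representatives\<close>

text \<open>
  The Lebesgue measure is complete, so changing a Borel function on a null set keeps it measurable. This gives the
  measurability of integrands that are only known almost everywhere.
\<close>

lemma AE_eq_measurable_lebesgue:
  fixes F G :: "'a::euclidean_space \<Rightarrow> 'b::second_countable_topology"
  assumes G: "G \<in> borel_measurable lborel" and eq: "AE x in lborel. F x = G x"
  shows "F \<in> borel_measurable lebesgue"
proof (rule measurableI)
  fix A :: "'b set" assume A: "A \<in> sets borel"
  have eq': "AE x in lebesgue. F x = G x" using eq by (rule AE_completion)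
  then obtain N where N: "N \<in> null_sets lebesgue" "{x \<in> space lebesgue. F x \<noteq> G x} \<subseteq> N"
    by (auto elim!: AE_E simp: null_sets_def simp del: emeasure_completion)
  have neg: "{x. F x \<noteq> G x} \<in> null_sets lebesgue"
    using N by (intro completion.complete2[OF _ N(1)]) auto
  have G': "G -` A \<in> sets lebesgue"
    using measurable_sets[OF measurable_completion[OF G] A] by simp
  have "F -` A = (G -` A - {x. F x \<noteq> G x}) \<union> (F -` A \<inter> {x. F x \<noteq> G x})"
    by auto
  moreover have "F -` A \<inter> {x. F x \<noteq> G x} \<in> null_sets lebesgue"
    by (rule completion.complete2[OF _ neg]) auto
  ultimately have "F -` A \<in> sets lebesgue"
    using neg G' by (metis null_setsD2 sets.Diff sets.Un)
  then show "F -` A \<inter> space lebesgue \<in> sets lebesgue" by simp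
qed auto

lemma integral_lebesgue_AE_borel:
  fixes F G :: "'a::euclidean_space \<Rightarrow> real"
  assumes G: "G \<in> borel_measurable lborel" and eq: "AE x in lborel. F x = G x"
  shows "integral\<^sup>L lebesgue F = integral\<^sup>L lborel G"
proof -
  have "integral\<^sup>L lebesgue F = integral\<^sup>L lebesgue G"
    by (rule integral_cong_AE[OF AE_eq_measurable_lebesgue[OF G eq] measurable_completion[OF G]
          AE_completion[OF eq]])
  then show ?thesis using integral_completion[OF G] by simp
qed

lemma nn_integral_lebesgue_AE_borel:
  assumes eq: "AE x in lborel. F x = G x"
  shows "(\<integral>\<^sup>+x. F x \<partial>lebesgue) = (\<integral>\<^sup>+x. G x \<partial>lborel)"
  unfolding nn_integral_completion using eq by (rule nn_integral_cong_AE)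

lemma lebesgue_ex_borel:
  fixes F :: "'a::euclidean_space \<Rightarrow> real"
  assumes "F \<in> borel_measurable lebesgue"
  obtains G where "G \<in> borel_measurable borel" "AE x in lborel. F x = G x"
  using completion_ex_borel_measurable_real[OF assms] by auto

section \<open>Hoelder inequality and radial integration\<close>

text \<open>
  Young's inequality for \<open>(F / a) (G / b)\<close>, where \<open>a\<close> and \<open>b\<close> are the two norms. If one of the norms
  vanishes, so does the product, almost everywhere.
\<close>

lemma Holder_nn_integral:
  fixes F G :: "'a \<Rightarrow> real"
  assumes F[measurable]: "F \<in> borel_measurable M" and G[measurable]: "G \<in> borel_measurable M"
    and F0: "\<And>x. 0 \<le> F x" and G0: "\<And>x. 0 \<le> G x"
    and p: "p > 1" and q: "q > 1" and pq: "1 / p + 1 / q = 1"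
    and A: "(\<integral>\<^sup>+x. ennreal (F x powr p) \<partial>M) = ennreal A" "0 \<le> A"
    and B: "(\<integral>\<^sup>+x. ennreal (G x powr q) \<partial>M) = ennreal B" "0 \<le> B"
  shows "(\<integral>\<^sup>+x. ennreal (F x * G x) \<partial>M) \<le> ennreal (A powr (1 / p) * B powr (1 / q))"
proof (cases "A = 0 \<or> B = 0")
  case True
  have "AE x in M. ennreal (F x * G x) = 0"
    using True
  proof
    assume "A = 0"
    then have "AE x in M. ennreal (F x powr p) = 0"
      using A(1) by (simp add: nn_integral_0_iff_AE)
    then show ?thesis
      by eventually_elim (use F0 in \<open>auto simp: ennreal_eq_0_iff\<close>)
  next
    assume "B = 0"
    then have "AE x in M. ennreal (G x powr q) = 0"
      using B(1) by (simp add: nn_integral_0_iff_AE)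
    then show ?thesis
      by eventually_elim (use G0 in \<open>auto simp: ennreal_eq_0_iff\<close>)
  qed
  then have "(\<integral>\<^sup>+x. ennreal (F x * G x) \<partial>M) = 0"
    by (subst nn_integral_0_iff_AE) auto
  then show ?thesis by simp
next
  case False
  with A B have AB: "A > 0" "B > 0" by auto
  define a where "a = A powr (1 / p)"
  define b where "b = B powr (1 / q)"
  have ab: "a > 0" "b > 0" using AB by (auto simp: a_def b_def)
  have ap: "a powr p = A" "b powr q = B" using AB p q by (auto simp: a_def b_def powr_powr)
  have pt: "ennreal (F x * G x) \<le>
      ennreal (a * b / (p * A)) * ennreal (F x powr p) + ennreal (a * b / (q * B)) * ennreal (G x powr q)" for x
  proof -
    have "(F x / a) * (G x / b) \<le> (F x / a) powr p / p + (G x / b) powr q / q"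
      using F0 G0 ab p q pq by (intro Youngs_inequality) auto
    also have "\<dots> = F x powr p / (p * A) + G x powr q / (q * B)"
      using F0[of x] G0[of x] ab ap by (simp add: powr_divide mult.commute)
    finally have "F x * G x \<le> a * b * (F x powr p / (p * A) + G x powr q / (q * B))"
      using ab by (simp add: divide_simps mult_ac)
    then have "F x * G x \<le> a * b / (p * A) * (F x powr p) + a * b / (q * B) * (G x powr q)"
      by (simp add: algebra_simps)
    then show ?thesis using ab p q AB
      by (simp flip: ennreal_mult' ennreal_plus add: ennreal_leI)
  qed
  have "(\<integral>\<^sup>+x. ennreal (F x * G x) \<partial>M) \<le>
    (\<integral>\<^sup>+x. ennreal (a * b / (p * A)) * ennreal (F x powr p) + ennreal (a * b / (q * B)) * ennreal (G x powr q) \<partial>M)"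
    by (intro nn_integral_mono pt)
  also have "\<dots> = ennreal (a * b / (p * A)) * ennreal A + ennreal (a * b / (q * B)) * ennreal B"
    by (subst nn_integral_add) (auto simp: nn_integral_cmult A B)
  also have "\<dots> = ennreal (a * b / (p * A) * A + a * b / (q * B) * B)"
    using ab p q AB by (simp flip: ennreal_mult' ennreal_plus)
  also have "a * b / (p * A) * A + a * b / (q * B) * B = a * b * (1 / p + 1 / q)"
    using AB p q by (simp add: field_simps)
  finally show ?thesis by (simp add: pq a_def b_def)
qed

text \<open>
  Integration in polar coordinates for radial functions. The image of the Lebesgue measure on a ball under the norm
  and the measure with density \<open>c N r^(N-1)\<close> agree on half-lines, by the formula for the volume of balls, hence
  they are equal.
\<close>

lemma radial_nn_integral:
  fixes G :: "real \<Rightarrow> ennreal"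
  assumes G[measurable]: "G \<in> borel_measurable borel" and R: "R > 0"
  shows "(\<integral>\<^sup>+z\<in>ball 0 R. G (norm (z::real^'n::finite)) \<partial>lborel)
     = (\<integral>\<^sup>+r\<in>{0<..<R}. ennreal (unit_ball_vol (real CARD('n)) * real CARD('n) * r ^ (CARD('n) - 1)) * G r \<partial>lborel)"
proof -
  let ?N = "CARD('n)" and ?c = "unit_ball_vol (real CARD('n))"
  define M where "M = distr (density lborel (indicator (ball (0::real^'n) R))) borel norm"
  define L where "L = density lborel (\<lambda>r. ennreal (?c * real ?N * r ^ (?N - 1)) * indicator {0<..<R} r)"
  have [measurable]: "norm -` {x<..} \<in> sets (borel :: (real^'n) measure)" for x
    by (intro borel_open open_vimage continuous_intros)
  have c0: "?c > 0" by simp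
  have eM: "emeasure M {x<..} = (if x < R then ennreal (?c * (R ^ ?N - (max 0 x) ^ ?N)) else 0)" for x
  proof -
    have "emeasure M {x<..} = (\<integral>\<^sup>+z. indicator (ball (0::real^'n) R) z * indicator (norm -` {x<..}) z \<partial>lborel)"
      unfolding M_def by (subst emeasure_distr) (auto intro!: emeasure_density borel_measurable_indicator simp: measurable_sets_borel)
    also have "\<dots> = (\<integral>\<^sup>+z. indicator (ball (0::real^'n) R \<inter> norm -` {x<..}) z \<partial>lborel)"
      by (intro nn_integral_cong) (simp only: indicator_inter_arith)
    also have "\<dots> = emeasure lborel (ball (0::real^'n) R \<inter> norm -` {x<..})"
      by (rule nn_integral_indicator) simp
    also have "\<dots> = (if x < R then ennreal (?c * (R ^ ?N - (max 0 x) ^ ?N)) else 0)"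
    proof (cases "x < R")
      case False
      then have "ball (0::real^'n) R \<inter> norm -` {x<..} = {}" by auto
      then show ?thesis using False by simp
    next
      case True
      show ?thesis
      proof (cases "x < 0")
        case True2: True
        then have "ball (0::real^'n) R \<inter> norm -` {x<..} = ball 0 R"
          by (auto intro: less_le_trans[OF _ norm_ge_zero])
        then show ?thesis using True True2 R by (simp add: emeasure_ball)
      next
        case False
        then have "ball (0::real^'n) R \<inter> norm -` {x<..} = ball 0 R - cball 0 x"
          by auto
        then have "emeasure lborel (ball (0::real^'n) R \<inter> norm -` {x<..}) =
           emeasure lborel (ball (0::real^'n) R) - emeasure lborel (cball (0::real^'n) x)"
        proof (simp only:, intro emeasure_Diff)
          show "emeasure lborel (cball (0::real^'n) x) \<noteq> \<infinity>"
            using emeasure_lborel_cball_finite[of "0::real^'n" x] by (metis less_irrefl)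
          show "cball (0::real^'n) x \<subseteq> ball 0 R" 
            using True by (intro subsetI) (simp only: mem_cball mem_ball le_less_trans)
        qed simp_all
        also have "\<dots> = ennreal (?c * R ^ ?N) - ennreal (?c * x ^ ?N)"
          using R False by (simp add: emeasure_ball emeasure_cball)
        also have "\<dots> = ennreal (?c * R ^ ?N - ?c * x ^ ?N)"
          using False c0 by (intro ennreal_minus) auto
        finally show ?thesis using True False by (simp add: algebra_simps max_def)
      qed
    qed
    finally show ?thesis .
  qed
  have eL: "emeasure L {x<..} = (if x < R then ennreal (?c * (R ^ ?N - (max 0 x) ^ ?N)) else 0)" for x
  proof -
    have "emeasure L {x<..} = (\<integral>\<^sup>+r. ennreal (?c * real ?N * r ^ (?N - 1)) * indicator {0<..<R} r * indicator {x<..} r \<partial>lborel)"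
      unfolding L_def by (auto simp: emeasure_density)
    also have "\<dots> = (if x < R then ennreal (?c * (R ^ ?N - (max 0 x) ^ ?N)) else 0)"
    proof (cases "x < R")
      case False
      have "(\<integral>\<^sup>+r. ennreal (?c * real ?N * r ^ (?N - 1)) * indicator {0<..<R} r * indicator {x<..} r \<partial>lborel) = (\<integral>\<^sup>+r. 0 \<partial>(lborel :: real measure))"
        using False by (intro nn_integral_cong) (auto simp: indicator_def)
      then show ?thesis using False by simp
    next
      case True
      define y where "y = max 0 x"
      have y: "0 \<le> y" "y < R" using True R by (auto simp: y_def)
      have "(\<integral>\<^sup>+r. ennreal (?c * real ?N * r ^ (?N - 1)) * indicator {0<..<R} r * indicator {x<..} r \<partial>lborel)
        = (\<integral>\<^sup>+r. ennreal (?c * real ?N * r ^ (?N - 1)) * indicator {y..R} r \<partial>lborel)"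
      proof (rule nn_integral_cong_AE)
        have "AE r in lborel. r \<noteq> y" "AE r in lborel. r \<noteq> R" by (rule AE_lborel_singleton)+
        then show "AE r in lborel. ennreal (?c * real ?N * r ^ (?N - 1)) * indicator {0<..<R} r * indicator {x<..} r
            = ennreal (?c * real ?N * r ^ (?N - 1)) * indicator {y..R} r"
          by eventually_elim (auto simp: indicator_def y_def max_def split: if_splits)
      qed
      also have "\<dots> = ennreal (?c * R ^ ?N - ?c * y ^ ?N)"
        using y c0
        by (intro nn_integral_FTC_Icc) (auto intro!: derivative_eq_intros simp: power_Suc[symmetric])
      finally show ?thesis using True by (simp add: algebra_simps y_def)
    qed
    finally show ?thesis .
  qed
  have "M = L"
  proof (rule measure_eqI_lessThan)
    show "sets M = sets borel" "sets L = sets borel" by (simp_all add: M_def L_def)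
  qed (simp_all only: eM eL, simp_all)
  have "(\<integral>\<^sup>+z\<in>ball 0 R. G (norm (z::real^'n)) \<partial>lborel) = (\<integral>\<^sup>+r. G r \<partial>M)"
    unfolding M_def
    by (subst nn_integral_distr, simp, measurable, subst nn_integral_density)
      (auto simp: mult.commute intro!: borel_measurable_indicator)
  also have "\<dots> = (\<integral>\<^sup>+r\<in>{0<..<R}. ennreal (?c * real ?N * r ^ (?N - 1)) * G r \<partial>lborel)"
    unfolding \<open>M = L\<close> L_def by (subst nn_integral_density) (auto intro!: nn_integral_cong simp: mult_ac)
  finally show ?thesis .
qed

text \<open>
  On each ball, integrate the indicator of the null set along the norm: in polar coordinates the integrand is zero
  almost everywhere.
\<close>

lemma AE_norm_notin_null:
  assumes "Z \<in> null_sets (lborel :: real measure)"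
  shows "AE z in (lborel :: (real^'n::finite) measure). norm z \<notin> Z"
proof -
  have [measurable]: "Z \<in> sets borel" using assms by auto
  have AEZ: "AE r in lborel. r \<notin> Z" using assms by (rule AE_not_in)
  have "AE z in (lborel :: (real^'n) measure). z \<in> ball 0 (real (Suc n)) \<longrightarrow> norm z \<notin> Z" for n
  proof -
    have "(\<integral>\<^sup>+z\<in>ball 0 (real (Suc n)). indicator Z (norm (z::real^'n)) \<partial>lborel) = 0"
      by (subst radial_nn_integral, measurable, subst nn_integral_0_iff_AE)
         (use AEZ in \<open>auto elim!: eventually_mono\<close>)
    then show ?thesis
      by (subst (asm) nn_integral_0_iff_AE) (auto elim!: eventually_mono simp: indicator_def split: if_splits)
  qed
  then have "AE z in (lborel :: (real^'n) measure). \<forall>n. z \<in> ball 0 (real (Suc n)) \<longrightarrow> norm z \<notin> Z"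
    by (subst AE_all_countable) blast
  then show ?thesis
  proof eventually_elim
    case (elim z)
    obtain n where "norm z < real n" using reals_Archimedean2 by blast
    then show ?case using elim[rule_format, of n] by auto
  qed
qed

lemma AE_norm:
  assumes "AE r in (lborel :: real measure). P r"
  shows "AE z in (lborel :: (real^'n::finite) measure). P (norm z)"
proof -
  obtain Z where Z: "{r. \<not> P r} \<subseteq> Z" "Z \<in> null_sets lborel"
    using assms by (auto elim!: AE_E simp: null_sets_def)
  from AE_norm_notin_null[OF Z(2)] show ?thesis
    by (rule eventually_mono) (use Z(1) in auto)
qed

section \<open>Null sets of pairs\<close>

text \<open>
  Fubini: for fixed first component, the difference ranges over a reflected translate, which preserves null sets.
\<close>

lemma AE_diff_pair:
  fixes P :: "'a::euclidean_space \<Rightarrow> bool"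
  assumes "AE z in lborel. P z"
  shows "AE x in (lborel :: ('a \<times> 'a) measure). P (fst x - snd x)"
proof -
  obtain N where N: "{z. \<not> P z} \<subseteq> N" "N \<in> null_sets lborel"
    using assms by (auto elim!: AE_E simp: null_sets_def)
  have [measurable]: "N \<in> sets borel" using N by auto
  have "AE z in lborel. z \<notin> N" using N by (auto intro: AE_not_in)
  then have *: "AE w in lborel. v - w \<notin> N" for v :: 'a
  proof -
    assume a: "AE z in lborel. z \<notin> N"
    have "lborel = distr lborel borel (\<lambda>x::'a. v + (-1) *\<^sub>R x)"
      by (subst lborel_affine[of "-1" v]) (auto simp: density_1 one_ennreal_def[symmetric])
    with a have "AE z in distr lborel borel (\<lambda>x::'a. v + (-1) *\<^sub>R x). z \<notin> N" by metis
    then show ?thesis by (subst (asm) AE_distr_iff) auto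
  qed
  have "AE x in lborel \<Otimes>\<^sub>M (lborel :: 'a measure). fst x - snd x \<notin> N"
  proof (rule lborel_pair.AE_pair_measure)
    show "{x \<in> space (lborel \<Otimes>\<^sub>M (lborel :: 'a measure)). fst x - snd x \<notin> N}
        \<in> sets (lborel \<Otimes>\<^sub>M lborel)"
      by measurable
  qed (use * in auto)
  then have "AE x in (lborel :: ('a \<times> 'a) measure). fst x - snd x \<notin> N"
    unfolding lborel_prod .
  then show ?thesis by (rule eventually_mono) (use N(1) in auto)
qed

lemma AE_pair_both:
  fixes P :: "'a::euclidean_space \<Rightarrow> bool"
  assumes "AE z in lborel. P z"
  shows "AE x in (lborel :: ('a \<times> 'a) measure). P (fst x) \<and> P (snd x)"
proof -
  obtain N where N: "{z. \<not> P z} \<subseteq> N" "N \<in> null_sets lborel"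
    using assms by (auto elim!: AE_E simp: null_sets_def)
  have [measurable]: "N \<in> sets borel" using N by auto
  have a: "AE z in lborel. z \<notin> N" using N by (auto intro: AE_not_in)
  have "AE x in lborel \<Otimes>\<^sub>M (lborel :: 'a measure). fst x \<notin> N \<and> snd x \<notin> N"
  proof (rule lborel_pair.AE_pair_measure)
    show "{x \<in> space (lborel \<Otimes>\<^sub>M (lborel :: 'a measure)). fst x \<notin> N \<and> snd x \<notin> N}
        \<in> sets (lborel \<Otimes>\<^sub>M lborel)"
      by measurable
  qed (use a in \<open>auto elim!: eventually_mono\<close>)
  then have "AE x in (lborel :: ('a \<times> 'a) measure). fst x \<notin> N \<and> snd x \<notin> N"
    unfolding lborel_prod .
  then show ?thesis by (rule eventually_mono) (use N(1) in auto)
qed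

section \<open>An integral Gronwall inequality\<close>

text \<open>
  The hypothesis has an upper bound \<open>S\<close> in place of \<open>M\<close>, so that no integral of \<open>a * M\<close> has to exist.
  While the integral of \<open>a\<close> grows by \<open>1/2\<close>, the supremum \<open>S\<close> of \<open>M\<close> satisfies \<open>S \<le> M \<tau> + S/2\<close>, so \<open>M\<close> at most doubles. A finite number
  of such steps covers the interval, whence a factor \<open>2 ^ n\<close> instead of an exponential.
\<close>

lemma Gronwall_finite_doubling:
  fixes M a :: "real \<Rightarrow> real"
  assumes T: "0 \<le> T" and a: "a integrable_on {0..T}" "\<And>t. t \<in> {0..T} \<Longrightarrow> 0 \<le> a t"
    and M: "\<And>t. t \<in> {0..T} \<Longrightarrow> 0 \<le> M t \<and> M t \<le> B"
    and step: "\<And>t1 t2 S. 0 \<le> t1 \<Longrightarrow> t1 \<le> t2 \<Longrightarrow> t2 \<le> T \<Longrightarrow> 0 \<le> S \<Longrightarrow>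
        (\<And>r. r \<in> {t1..t2} \<Longrightarrow> M r \<le> S) \<Longrightarrow> M t2 \<le> M t1 + S * integral {t1..t2} a"
    and t: "t \<in> {0..T}" and n: "integral {0..T} a \<le> real n / 2"
  shows "M t \<le> 2 ^ n * M 0"
proof -
  define A where "A = (\<lambda>t. integral {0..t} a)"
  have sub: "a integrable_on {t1..t2}" if "0 \<le> t1" "t2 \<le> T" for t1 t2
    using a(1) by (rule integrable_on_subinterval) (use that in auto)
  have Aadd: "A t1 + integral {t1..t2} a = A t2" if "0 \<le> t1" "t1 \<le> t2" "t2 \<le> T" for t1 t2
    unfolding A_def using that sub by (intro Henstock_Kurzweil_Integration.integral_combine) auto
  have inn: "0 \<le> integral {t1..t2} a" if "0 \<le> t1" "t2 \<le> T" for t1 t2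
    using that a(2) by (intro Henstock_Kurzweil_Integration.integral_nonneg sub) auto
  have Acont: "continuous_on {0..T} A"
    unfolding A_def using a(1) by (rule indefinite_integral_continuous_1)
  have A0: "A 0 = 0" by (simp add: A_def)
  have claim: "M t \<le> 2 ^ n * M 0" if "t \<in> {0..T}" "A t \<le> real n / 2" for t n
    using that
  proof (induction n arbitrary: t)
    case 0
    have "integral {0..t} a = 0" using 0 inn[of 0 t] by (auto simp: A_def)
    moreover have "M t \<le> M 0 + max 0 B * integral {0..t} a"
      using 0 by (intro step) (use M in \<open>auto simp: max_def intro: order_trans\<close>)
    ultimately show ?case by simp
  next
    case (Suc n)
    have At: "0 \<le> A t" unfolding A_def using Suc.prems by (intro inn) auto
    \<comment> \<open>The time at which the integral of \<open>a\<close> reaches \<open>n/2\<close>, or \<open>t\<close> itself if this does not happen before.\<close>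
    obtain \<tau> where \<tau>: "0 \<le> \<tau>" "\<tau> \<le> t" "A \<tau> = min (A t) (real n / 2)"
      using IVT'[of A 0 "min (A t) (real n / 2)" t] Suc.prems At A0 continuous_on_subset[OF Acont, of "{0..t}"]
      by auto
    have M\<tau>: "M \<tau> \<le> 2 ^ n * M 0" using \<tau> Suc.prems by (intro Suc.IH) auto
    define S where "S = (SUP r\<in>{\<tau>..t}. M r)"
    have bdd: "bdd_above (M ` {\<tau>..t})" using M \<tau> Suc.prems by (intro bdd_aboveI[of _ B]) auto
    have MS: "M r \<le> S" if "r \<in> {\<tau>..t}" for r
      unfolding S_def using that bdd by (intro cSUP_upper)
    have S0: "0 \<le> S" using MS[of \<tau>] M[of \<tau>] \<tau> Suc.prems by auto
    have "M r \<le> M \<tau> + S * (1/2)" if r: "r \<in> {\<tau>..t}" for r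
    proof -
      have "M r \<le> M \<tau> + S * integral {\<tau>..r} a"
        using r \<tau> Suc.prems S0 MS by (intro step) auto
      moreover have "integral {\<tau>..r} a \<le> 1/2"
      proof -
        have "integral {\<tau>..r} a \<le> integral {\<tau>..r} a + integral {r..t} a"
          using inn[of r t] r \<tau> Suc.prems by auto
        also have "\<dots> = A t - A \<tau>"
          using Aadd[of \<tau> r] Aadd[of r t] r \<tau> Suc.prems by auto
        also have "\<dots> \<le> 1/2"
          using \<tau>(3) Suc.prems(2) At by (auto simp: min_def field_simps)
        finally show ?thesis .
      qed
      ultimately show ?thesis using S0 mult_left_mono[of "integral {\<tau>..r} a" "1/2" S] by linarith
    qed
    then have "S \<le> M \<tau> + S * (1/2)" unfolding S_def using \<tau> by (intro cSUP_least) auto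
    then have "S \<le> 2 * M \<tau>" by simp
    then show ?case using MS[of t] \<tau> M\<tau> by auto
  qed
  show ?thesis using n t Aadd[of t T] inn[of t T] by (intro claim) (auto simp: A_def)
qed

section \<open>The singular convolution near a point\<close>

text \<open>
  The square of the Japanese bracket, i.e. the variable in which all radial test functions below are written.
\<close>

definition bracket2 :: "real^'n::finite \<Rightarrow> real" where
  "bracket2 v = 1 + (norm v)\<^sup>2"

lemma bracket2_ge_1: "1 \<le> bracket2 v" and bracket2_pos [simp]: "0 < bracket2 v" and bracket2_nonneg [simp]: "0 \<le> bracket2 v"
  and bracket2_neq_0 [simp]: "bracket2 v \<noteq> 0"
  using zero_le_power2[of "norm v"] unfolding bracket2_def by linarith+

lemma bracket2_measurable [measurable]: "bracket2 \<in> borel_measurable borel"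
  unfolding bracket2_def[abs_def] by measurable

lemma bracket2_near:
  assumes "norm (v - w) \<le> 1"
  shows "bracket2 v \<le> 3 * bracket2 w"
proof -
  have "norm v \<le> norm w + 1" using norm_triangle_ineq[of w "v - w"] assms by simp
  then have "(norm v)\<^sup>2 \<le> (norm w + 1)\<^sup>2" by (rule power_mono) simp
  also have "(norm w + 1)\<^sup>2 \<le> 2 * (norm w)\<^sup>2 + 2"
    using zero_le_power2[of "norm w - 1"] by (simp add: power2_eq_square algebra_simps)
  finally have "(norm v)\<^sup>2 \<le> 2 * (norm w)\<^sup>2 + 2" .
  then show ?thesis using zero_le_power2[of "norm w"] unfolding bracket2_def by (simp only: distrib_left)
qed

lemma singular_ball_integral:
  fixes v :: "real^'n::finite"
  assumes a: "0 < a" "a < real CARD('n)" and \<rho>: "\<rho> > 0"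
  shows "(\<integral>\<^sup>+w\<in>ball v \<rho>. ennreal (norm (v - w) powr (-a)) \<partial>lborel)
     = ennreal (unit_ball_vol (real CARD('n)) * real CARD('n) / (real CARD('n) - a) * \<rho> powr (real CARD('n) - a))"
proof -
  let ?N = "CARD('n)" and ?c = "unit_ball_vol (real CARD('n))"
  have "(\<integral>\<^sup>+w\<in>ball v \<rho>. ennreal (norm (v - w) powr (-a)) \<partial>lborel)
    = (\<integral>\<^sup>+w\<in>ball v \<rho>. ennreal (norm (v - w) powr (-a)) \<partial>(distr lborel borel (\<lambda>x. v + (-1) *\<^sub>R x)))"
    by (subst lborel_affine[of "-1" v]) (auto simp: density_1 one_ennreal_def[symmetric])
  also have "\<dots> = (\<integral>\<^sup>+z\<in>ball 0 \<rho>. ennreal (norm (z::real^'n) powr (-a)) \<partial>lborel)"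
    by (subst nn_integral_distr) (auto simp: indicator_def dist_norm intro!: nn_integral_cong)
  also have "\<dots> = (\<integral>\<^sup>+r\<in>{0<..<\<rho>}. ennreal (?c * real ?N * r ^ (?N - 1)) * ennreal (r powr (-a)) \<partial>lborel)"
    by (rule radial_nn_integral[OF _ \<rho>]) measurable
  also have "\<dots> = (\<integral>\<^sup>+r. ennreal (?c * real ?N) * (ennreal (r powr (real ?N - 1 - a)) * indicator {0..\<rho>} r) \<partial>lborel)"
  proof (rule nn_integral_cong_AE)
    have "AE r in lborel. r \<noteq> 0" "AE r in lborel. r \<noteq> \<rho>" by (rule AE_lborel_singleton)+
    then show "AE r in lborel. ennreal (?c * real ?N * r ^ (?N - 1)) * ennreal (r powr (-a)) * indicator {0<..<\<rho>} r
            = ennreal (?c * real ?N) * (ennreal (r powr (real ?N - 1 - a)) * indicator {0..\<rho>} r)"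
    proof eventually_elim
      case (elim r)
      have "r ^ (?N - 1) * r powr (-a) = r powr (real ?N - 1 - a)" if "r > 0"
      proof -
        have "r ^ (?N - 1) = r powr (real ?N - 1)"
          using that by (simp add: powr_realpow[symmetric] of_nat_diff Suc_le_eq)
        then show ?thesis using that by (simp add: powr_add[symmetric])
      qed
      then show ?case using elim
        by (auto simp: indicator_def ennreal_mult' mult.assoc simp flip: ennreal_mult')
    qed
  qed
  also have "\<dots> = ennreal (?c * real ?N) * (\<integral>\<^sup>+r. ennreal (r powr (real ?N - 1 - a)) * indicator {0..\<rho>} r \<partial>lborel)"
    by (rule nn_integral_cmult) auto
  also have "(\<integral>\<^sup>+r. ennreal (r powr (real ?N - 1 - a)) * indicator {0..\<rho>} r \<partial>lborel)
      = ennreal (\<rho> powr (real ?N - 1 - a + 1) / (real ?N - 1 - a + 1))"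
    using nn_integral_has_integral_lebesgue[OF _ has_integral_powr_from_0[of "real ?N - 1 - a" \<rho>]] a \<rho>
    by (simp add: mult.commute ennreal_indicator ennreal_mult')
  finally show ?thesis using a by (simp flip: ennreal_mult' add: field_simps)
qed

text \<open>
  The exponent \<open>q / (q - 1)\<close> is conjugate to \<open>q\<close>; the quotient is the coefficient in the integral of
  \<open>|z|^(-s q / (q - 1))\<close> over a ball, and the coefficients \<open>3\<close> and \<open>3 powr m\<close> come from comparing \<open>bracket2\<close> at points at
  distance at most \<open>1\<close>.
\<close>

definition singular_constant :: "'n::finite itself \<Rightarrow> real \<Rightarrow> real \<Rightarrow> real \<Rightarrow> real" where
  "singular_constant _ q s m = 3 + 3 powr m * (unit_ball_vol (real CARD('n)) * real CARD('n) /
           (real CARD('n) - s * (q / (q - 1)))) powr ((q - 1) / q)"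

text \<open>
  The bound is linear in \<open>bracket2 v\<close> and in the weighted \<open>L^q\<close> norm. Linearity in the norm matters because
  only this norm itself, and not a higher power of it, is integrable in time. The radius \<open>bracket2 v powr (- 2 / s)\<close>
  is the smallest one for which the energy controls the part outside; the condition on \<open>m\<close> and \<open>s\<close> says that the
  part inside is then small enough to absorb the weight.
\<close>

lemma local_singular_bound:
  fixes g :: "real^'n::finite \<Rightarrow> real" and v :: "real^'n"
  assumes g[measurable]: "g \<in> borel_measurable borel" and g0: "\<And>w. 0 \<le> g w"
    and q: "q > 1" and s: "s > 0" and m: "m \<ge> 1" and ms: "(m + 1) * s < 2 * (real CARD('n) * (1 - 1 / q))"
    and E: "(\<integral>\<^sup>+w. ennreal (g w * bracket2 w) \<partial>lborel) = ennreal E" "0 \<le> E"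
    and Q: "(\<integral>\<^sup>+w. ennreal (g w powr q * bracket2 w powr (q * (-m))) \<partial>lborel) = ennreal Q" "0 \<le> Q"
    and C0: "C0 = singular_constant TYPE('n) q s m"
  shows "(\<integral>\<^sup>+w\<in>ball v 1. ennreal (g w * norm (v - w) powr (-s)) \<partial>lborel)
     \<le> ennreal (C0 * bracket2 v * (E + Q powr (1 / q)))"
proof -
  let ?N = "real CARD('n)" and ?c = "unit_ball_vol (real CARD('n))"
  define q' where "q' = q / (q - 1)"
  have q': "q' > 1" "1 / q + 1 / q' = 1" "1 - 1 / q = 1 / q'" "(q - 1) / q = 1 / q'"
    using q by (auto simp: q'_def field_simps)
  \<comment> \<open>The scaling exponent of the \<open>L^q'\<close> norm of the indicator of a ball.\<close>
  define d where "d = ?N / q'"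
  have d: "(m + 1) * s < 2 * d" using ms by (simp add: q'(3) d_def)
  have "2 * s \<le> (m + 1) * s" using m s by (intro mult_right_mono) auto
  then have sd: "s < d" using d by linarith
  then have sq: "s * q' < ?N" using q' by (simp add: d_def field_simps)
  define \<kappa> where "\<kappa> = ?c * ?N / (?N - s * q')"
  have \<kappa>: "\<kappa> > 0" unfolding \<kappa>_def using sq by simp
  have C0': "C0 = 3 + 3 powr m * \<kappa> powr (1 / q')"
    unfolding C0 singular_constant_def \<kappa>_def q'(4)[symmetric] by (simp add: q'_def)
  define \<rho> where "\<rho> = bracket2 v powr (- (2 / s))"
  have \<rho>: "0 < \<rho>" "\<rho> \<le> 1"
    unfolding \<rho>_def using bracket2_ge_1[of v] s by (auto simp: powr_le_one_le powr_minus_divide ge_one_powr_ge_zero)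
  have sub: "ball v \<rho> \<subseteq> ball v 1" using \<rho> by auto
  have part1: "(\<integral>\<^sup>+w\<in>ball v 1 - ball v \<rho>. ennreal (g w * norm (v - w) powr (-s)) \<partial>lborel)
      \<le> ennreal (3 * bracket2 v * E)"
  proof -
    have "(\<integral>\<^sup>+w\<in>ball v 1 - ball v \<rho>. ennreal (g w * norm (v - w) powr (-s)) \<partial>lborel)
      \<le> (\<integral>\<^sup>+w. ennreal (3 * bracket2 v) * ennreal (g w * bracket2 w) \<partial>lborel)"
    proof (rule nn_integral_mono)
      fix w :: "real^'n"
      show "ennreal (g w * norm (v - w) powr (-s)) * indicator (ball v 1 - ball v \<rho>) w
          \<le> ennreal (3 * bracket2 v) * ennreal (g w * bracket2 w)"
      proof (cases "w \<in> ball v 1 - ball v \<rho>")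
        case True
        then have n: "\<rho> \<le> norm (v - w)" "norm (v - w) \<le> 1" by (auto simp: dist_norm)
        have "norm (v - w) powr (-s) \<le> \<rho> powr (-s)" using n \<rho> s by (intro powr_mono2') auto
        also have "\<dots> = bracket2 v powr 2" unfolding \<rho>_def powr_powr using s by simp
        also have "\<dots> = bracket2 v * bracket2 v" by (simp add: power2_eq_square)
        also have "\<dots> \<le> bracket2 v * (3 * bracket2 w)" using bracket2_near[OF n(2)] by (intro mult_left_mono) auto
        finally have "g w * norm (v - w) powr (-s) \<le> g w * (bracket2 v * (3 * bracket2 w))"
          using g0 by (intro mult_left_mono)
        then show ?thesis using g0 True by (simp flip: ennreal_mult' add: mult_ac ennreal_leI)
      qed simp
    qed
    also have "\<dots> = ennreal (3 * bracket2 v * E)"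
      by (subst nn_integral_cmult) (auto simp: E ennreal_mult')
    finally show ?thesis .
  qed
  define F where "F = (\<lambda>w. g w * bracket2 w powr (-m))"
  define G where "G = (\<lambda>w. norm (v - w) powr (-s) * indicator (ball v \<rho>) w)"
  have FG: "(\<integral>\<^sup>+w. ennreal (F w * G w) \<partial>lborel)
      \<le> ennreal (Q powr (1 / q) * (\<kappa> * \<rho> powr (?N - s * q')) powr (1 / q'))"
  proof (rule Holder_nn_integral[OF _ _ _ _ q q'(1,2)])
    show "F \<in> borel_measurable lborel" "G \<in> borel_measurable lborel"
      unfolding F_def G_def by (measurable; auto intro!: borel_measurable_indicator)+
    show "0 \<le> F x" "0 \<le> G x" for x using g0 by (auto simp: F_def G_def)
    show "(\<integral>\<^sup>+x. ennreal (F x powr q) \<partial>lborel) = ennreal Q"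
      unfolding Q(1)[symmetric] F_def using g0 by (simp add: powr_mult powr_powr mult.commute)
    have "(\<integral>\<^sup>+x. ennreal (G x powr q') \<partial>lborel) =
        (\<integral>\<^sup>+w\<in>ball v \<rho>. ennreal (norm (v - w) powr (-(s * q'))) \<partial>lborel)"
      unfolding G_def using q' by (intro nn_integral_cong) (auto simp: powr_powr indicator_def)
    also have "\<dots> = ennreal (\<kappa> * \<rho> powr (?N - s * q'))"
      unfolding \<kappa>_def using s q' sq \<rho> by (intro singular_ball_integral) auto
    finally show "(\<integral>\<^sup>+x. ennreal (G x powr q') \<partial>lborel) = ennreal (\<kappa> * \<rho> powr (?N - s * q'))" .
  qed (use Q \<kappa> in auto)
  have \<rho>pow: "(\<kappa> * \<rho> powr (?N - s * q')) powr (1 / q') \<le> \<kappa> powr (1 / q') * bracket2 v powr (1 - m)"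
  proof -
    have "(\<kappa> * \<rho> powr (?N - s * q')) powr (1 / q') = \<kappa> powr (1 / q') * bracket2 v powr (- (2 / s) * ((?N - s * q') * (1 / q')))"
      using \<kappa> unfolding \<rho>_def by (simp add: powr_mult powr_powr mult.assoc)
    also have "(?N - s * q') * (1 / q') = d - s" using q' by (simp add: d_def field_simps)
    also have "\<kappa> powr (1 / q') * bracket2 v powr (- (2 / s) * (d - s)) \<le> \<kappa> powr (1 / q') * bracket2 v powr (1 - m)"
    proof (intro mult_left_mono powr_mono)
      \<comment> \<open>Here the smallness of the ball balances the weight and the energy.\<close>
      show "- (2 / s) * (d - s) \<le> 1 - m" using d s by (simp add: field_simps)
    qed (use bracket2_ge_1 in auto)
    finally show ?thesis .
  qed
  have part2: "(\<integral>\<^sup>+w\<in>ball v \<rho>. ennreal (g w * norm (v - w) powr (-s)) \<partial>lborel)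
      \<le> ennreal (3 powr m * \<kappa> powr (1 / q') * bracket2 v * Q powr (1 / q))"
  proof -
    have "(\<integral>\<^sup>+w\<in>ball v \<rho>. ennreal (g w * norm (v - w) powr (-s)) \<partial>lborel)
      \<le> (\<integral>\<^sup>+w. ennreal ((3 * bracket2 v) powr m) * ennreal (F w * G w) \<partial>lborel)"
    proof (rule nn_integral_mono)
      fix w :: "real^'n"
      show "ennreal (g w * norm (v - w) powr (-s)) * indicator (ball v \<rho>) w
          \<le> ennreal ((3 * bracket2 v) powr m) * ennreal (F w * G w)"
      proof (cases "w \<in> ball v \<rho>")
        case True
        then have n: "norm (w - v) \<le> 1" using \<rho> by (auto simp: dist_norm norm_minus_commute)
        have "bracket2 w powr m \<le> (3 * bracket2 v) powr m" using bracket2_near[OF n] m by (intro powr_mono2) auto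
        then have "1 \<le> (3 * bracket2 v) powr m * bracket2 w powr (-m)"
          by (simp add: powr_minus_divide)
        then have "g w * norm (v - w) powr (-s) * 1 \<le>
           g w * norm (v - w) powr (-s) * ((3 * bracket2 v) powr m * bracket2 w powr (-m))"
          using g0 by (intro mult_left_mono) auto
        then show ?thesis using g0 True
          by (simp flip: ennreal_mult' add: mult_ac ennreal_leI F_def G_def)
      qed simp
    qed
    also have "\<dots> = ennreal ((3 * bracket2 v) powr m) * (\<integral>\<^sup>+w. ennreal (F w * G w) \<partial>lborel)"
      unfolding F_def G_def by (rule nn_integral_cmult) (measurable; auto intro!: borel_measurable_indicator)
    also have "\<dots> \<le> ennreal ((3 * bracket2 v) powr m) *
       ennreal (Q powr (1 / q) * (\<kappa> powr (1 / q') * bracket2 v powr (1 - m)))"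
      using \<rho>pow by (intro mult_left_mono order_trans[OF FG] ennreal_leI) auto
    also have "\<dots> = ennreal (3 powr m * \<kappa> powr (1 / q') * bracket2 v * Q powr (1 / q))"
    proof -
      have "bracket2 v powr m * bracket2 v powr (1 - m) = bracket2 v" by (simp add: powr_add[symmetric])
      then show ?thesis by (simp flip: ennreal_mult' add: powr_mult mult_ac)
    qed
    finally show ?thesis .
  qed
  have "(\<integral>\<^sup>+w\<in>ball v 1. ennreal (g w * norm (v - w) powr (-s)) \<partial>lborel)
    = (\<integral>\<^sup>+w\<in>ball v 1 - ball v \<rho>. ennreal (g w * norm (v - w) powr (-s)) \<partial>lborel)
     + (\<integral>\<^sup>+w\<in>ball v \<rho>. ennreal (g w * norm (v - w) powr (-s)) \<partial>lborel)"
    using sub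
    by (subst nn_integral_add[symmetric])
      (auto intro!: nn_integral_cong borel_measurable_indicator borel_measurable_times_ennreal
            simp: indicator_def)
  also have "\<dots> \<le> ennreal (3 * bracket2 v * E) + ennreal (3 powr m * \<kappa> powr (1 / q') * bracket2 v * Q powr (1 / q))"
    by (rule add_mono[OF part1 part2])
  also have "\<dots> = ennreal (3 * bracket2 v * E + 3 powr m * \<kappa> powr (1 / q') * bracket2 v * Q powr (1 / q))"
    using E by simp
  also have "\<dots> \<le> ennreal (C0 * bracket2 v * (E + Q powr (1 / q)))"
  proof (rule ennreal_leI)
    have "0 \<le> 3 powr m * \<kappa> powr (1 / q') * bracket2 v * E + 3 * bracket2 v * Q powr (1 / q)" using E by simp
    then show "3 * bracket2 v * E + 3 powr m * \<kappa> powr (1 / q') * bracket2 v * Q powr (1 / q)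
       \<le> C0 * bracket2 v * (E + Q powr (1 / q))"
      by (simp add: C0' algebra_simps)
  qed
  finally show ?thesis .
qed

section \<open>Weighted double integrals\<close>

text \<open>
  Bounds the Landau operator on a convex radial function \<open>h\<close>: far from the diagonal the factor \<open>bracket2 w\<close> is
  integrated by the energy, near the diagonal the division by \<open>bracket2 v\<close> compensates the linear growth in
  \<open>local_singular_bound\<close>. For \<open>h = bracket2\<close> it also dominates the kernel itself.
\<close>

definition pair_weight :: "real \<Rightarrow> (real^'n::finite \<Rightarrow> real) \<Rightarrow> real^'n \<Rightarrow> real^'n \<Rightarrow> real" where
  "pair_weight s h v w = (if 1 \<le> norm (v - w) then h v * bracket2 w else norm (v - w) powr (-s) * (h v / bracket2 v))"

lemma pair_weight_measurable [measurable]: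
  assumes [measurable]: "h \<in> borel_measurable borel"
  shows "(\<lambda>x. pair_weight s h (fst x) (snd x)) \<in> borel_measurable (borel \<Otimes>\<^sub>M borel)"
    and pair_weight_measurable_swap: "(\<lambda>x. pair_weight s h (snd x) (fst x)) \<in> borel_measurable (borel \<Otimes>\<^sub>M borel)"
  unfolding pair_weight_def[abs_def] by measurable

lemma pair_weight_nonneg: "(\<And>v. 0 \<le> h v) \<Longrightarrow> 0 \<le> pair_weight s h v w"
  by (auto simp: pair_weight_def intro!: mult_nonneg_nonneg divide_nonneg_nonneg)

text \<open>
  After integration in \<open>w\<close> both parts of the weight are at most a constant times \<open>h v\<close>.
\<close>

lemma pair_weight_double_integral:
  fixes g h :: "real^'n::finite \<Rightarrow> real"
  assumes g[measurable]: "g \<in> borel_measurable borel" and g0: "\<And>w. 0 \<le> g w"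
    and h[measurable]: "h \<in> borel_measurable borel" and h0: "\<And>w. 0 \<le> h w"
    and q: "q > 1" and s: "s > 0" and m: "m \<ge> 1" and ms: "(m + 1) * s < 2 * (real CARD('n) * (1 - 1 / q))"
    and E: "(\<integral>\<^sup>+w. ennreal (g w * bracket2 w) \<partial>lborel) = ennreal E" "0 \<le> E"
    and Q: "(\<integral>\<^sup>+w. ennreal (g w powr q * bracket2 w powr (q * (-m))) \<partial>lborel) = ennreal Q" "0 \<le> Q"
    and C0: "C0 = singular_constant TYPE('n) q s m"
  shows "(\<integral>\<^sup>+x. ennreal (g (fst x) * g (snd x) * pair_weight s h (fst x) (snd x)) \<partial>lborel)
     \<le> ennreal ((1 + C0) * (E + Q powr (1 / q))) * (\<integral>\<^sup>+v. ennreal (g v * h v) \<partial>lborel)" (is "?A \<le> ?B")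
    and "(\<integral>\<^sup>+x. ennreal (g (fst x) * g (snd x) * pair_weight s h (snd x) (fst x)) \<partial>lborel)
     \<le> ennreal ((1 + C0) * (E + Q powr (1 / q))) * (\<integral>\<^sup>+v. ennreal (g v * h v) \<partial>lborel)"
proof -
  have C0p: "C0 \<ge> 0" unfolding C0 singular_constant_def by simp
  let ?b = "(1 + C0) * (E + Q powr (1 / q))"
  have inner: "(\<integral>\<^sup>+w. ennreal (g v * g w * pair_weight s h v w) \<partial>lborel) \<le> ennreal ?b * ennreal (g v * h v)" for v
  proof -
    have "(\<integral>\<^sup>+w. ennreal (g v * g w * pair_weight s h v w) \<partial>lborel)
       \<le> (\<integral>\<^sup>+w. ennreal (g v * h v) * ennreal (g w * bracket2 w) +
             ennreal (g v * h v / bracket2 v) * (ennreal (g w * norm (v - w) powr (-s)) * indicator (ball v 1) w) \<partial>lborel)"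
    proof (rule nn_integral_mono)
      fix w
      show "ennreal (g v * g w * pair_weight s h v w) \<le> ennreal (g v * h v) * ennreal (g w * bracket2 w) +
             ennreal (g v * h v / bracket2 v) * (ennreal (g w * norm (v - w) powr (-s)) * indicator (ball v 1) w)"
      proof (cases "1 \<le> norm (v - w)")
        case True
        then have "ennreal (g v * g w * pair_weight s h v w) = ennreal (g v * h v) * ennreal (g w * bracket2 w)"
          using g0 h0 by (simp add: pair_weight_def ennreal_mult'[symmetric] mult_ac)
        then show ?thesis by simp
      next
        case False
        then have "ennreal (g v * g w * pair_weight s h v w) = ennreal (g v * h v / bracket2 v) * (ennreal (g w * norm (v - w) powr (-s)) * indicator (ball v 1) w)"
          using g0 h0 by (simp add: pair_weight_def ennreal_mult'[symmetric] dist_norm mult_ac)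
        then show ?thesis by simp
      qed
    qed
    also have "\<dots> = ennreal (g v * h v) * (\<integral>\<^sup>+w. ennreal (g w * bracket2 w) \<partial>lborel) +
        ennreal (g v * h v / bracket2 v) * (\<integral>\<^sup>+w\<in>ball v 1. ennreal (g w * norm (v - w) powr (-s)) \<partial>lborel)"
    proof -
      have "(\<lambda>w. ennreal (g w * norm (v - w) powr (-s)) * indicator (ball v 1) w) \<in> borel_measurable lborel"
        by (intro borel_measurable_times_ennreal borel_measurable_indicator) auto
      then show ?thesis
        by (subst nn_integral_add) (auto simp: nn_integral_cmult)
    qed
    also have "\<dots> \<le> ennreal (g v * h v) * ennreal E +
        ennreal (g v * h v / bracket2 v) * ennreal (C0 * bracket2 v * (E + Q powr (1 / q)))"
      unfolding E(1) by (intro add_left_mono mult_left_mono local_singular_bound[OF g g0 q s m ms E Q C0]) auto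
    also have "\<dots> = ennreal (g v * h v * E + g v * h v * (C0 * (E + Q powr (1 / q))))"
      using g0 h0 E C0p by (simp add: ennreal_mult'[symmetric] ennreal_plus[symmetric] del: ennreal_plus)
    also have "\<dots> \<le> ennreal (?b * (g v * h v))"
    proof (rule ennreal_leI)
      have "0 \<le> g v * h v * Q powr (1 / q)" using g0 h0 by simp
      then show "g v * h v * E + g v * h v * (C0 * (E + Q powr (1 / q))) \<le> ?b * (g v * h v)"
        by (simp add: algebra_simps)
    qed
    also have "\<dots> = ennreal ?b * ennreal (g v * h v)"
      using g0 h0 E C0p by (intro ennreal_mult) auto
    finally show ?thesis .
  qed
  have meas: "(\<lambda>x. ennreal (g (fst x) * g (snd x) * pair_weight s h (fst x) (snd x))) \<in> borel_measurable (lborel \<Otimes>\<^sub>M lborel)"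
  proof -
    have "(\<lambda>x. ennreal (g (fst x) * g (snd x) * pair_weight s h (fst x) (snd x))) \<in> borel_measurable (borel \<Otimes>\<^sub>M borel)"
      by measurable
    then show ?thesis by (simp add: lborel_prod borel_prod)
  qed
  have "?A = (\<integral>\<^sup>+v. (\<integral>\<^sup>+w. ennreal (g v * g w * pair_weight s h v w) \<partial>lborel) \<partial>lborel)"
    unfolding lborel_prod[symmetric] by (subst lborel.nn_integral_fst[OF meas, symmetric]) simp
  also have "\<dots> \<le> (\<integral>\<^sup>+v. ennreal ?b * ennreal (g v * h v) \<partial>lborel)"
    by (intro nn_integral_mono inner)
  also have "\<dots> = ?B" by (rule nn_integral_cmult) measurable
  finally show *: "?A \<le> ?B" .
  have meas': "(\<lambda>x. ennreal (g (snd x) * g (fst x) * pair_weight s h (snd x) (fst x))) \<in> borel_measurable (lborel \<Otimes>\<^sub>M lborel)"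
    using measurable_compose[OF measurable_pair_swap' meas] by (simp add: case_prod_beta)
  have "(\<integral>\<^sup>+x. ennreal (g (fst x) * g (snd x) * pair_weight s h (snd x) (fst x)) \<partial>lborel) = 
     (\<integral>\<^sup>+x. ennreal (g (snd x) * g (fst x) * pair_weight s h (snd x) (fst x)) \<partial>lborel)"
    by (intro nn_integral_cong) (simp only: mult.commute)
  also have "\<dots> = ?A"
    unfolding lborel_prod[symmetric]
    by (subst lborel.nn_integral_fst[OF meas', symmetric], subst lborel_pair.nn_integral_snd[OF meas, symmetric]) simp
  finally show "(\<integral>\<^sup>+x. ennreal (g (fst x) * g (snd x) * pair_weight s h (snd x) (fst x)) \<partial>lborel) \<le> ?B" using * by simp
qed

section \<open>The Landau operator on radial functions\<close>

text \<open>
  All exponents of the upper bound lie between \<open>- s\<close> and \<open>2\<close>.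
\<close>

lemma kernel_upper:
  fixes K1 K2 \<delta> \<gamma>2 s r :: real
  assumes K: "K1 > 0" "K2 > 0" and e: "\<delta> \<le> 2" "0 < \<delta>" "\<gamma>2 \<le> - \<delta>" and s: "0 \<le> s" "- (\<gamma>2 + 2) \<le> s"
    and \<psi>: "\<psi> r \<le> K1 * r powr (2 - \<delta>) + K2 * r powr (\<gamma>2 + 2)" and r: "r > 0"
  shows "1 \<le> r \<Longrightarrow> \<psi> r \<le> (K1 + K2) * r\<^sup>2" "r < 1 \<Longrightarrow> \<psi> r \<le> (K1 + K2) * r powr (-s)"
proof -
  assume "1 \<le> r"
  then have "r powr (2 - \<delta>) \<le> r powr 2" and "r powr (\<gamma>2 + 2) \<le> r powr 2"
    using e powr_mono[of "2 - \<delta>" 2 r] powr_mono[of "\<gamma>2 + 2" 2 r] by linarith+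
  then have "r powr (2 - \<delta>) \<le> r\<^sup>2" "r powr (\<gamma>2 + 2) \<le> r\<^sup>2" using r by simp_all
  then have "K1 * r powr (2 - \<delta>) + K2 * r powr (\<gamma>2 + 2) \<le> K1 * r\<^sup>2 + K2 * r\<^sup>2"
    using K by (intro add_mono mult_left_mono) auto
  then show "\<psi> r \<le> (K1 + K2) * r\<^sup>2" using \<psi> by (simp add: distrib_right)
next
  assume "r < 1"
  then have "r powr (2 - \<delta>) \<le> r powr (-s)" "r powr (\<gamma>2 + 2) \<le> r powr (-s)"
    using e s r by (auto intro!: powr_mono')
  then have "K1 * r powr (2 - \<delta>) + K2 * r powr (\<gamma>2 + 2) \<le> K1 * r powr (-s) + K2 * r powr (-s)"
    using K by (intro add_mono mult_left_mono) auto
  then show "\<psi> r \<le> (K1 + K2) * r powr (-s)" using \<psi> by (simp add: distrib_right)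
qed

lemma kernel_le_pair_weight:
  assumes ub: "1 \<le> norm (v - w) \<Longrightarrow> \<psi> (norm (v - w)) \<le> K * (norm (v - w))\<^sup>2"
     "norm (v - w) < 1 \<Longrightarrow> \<psi> (norm (v - w)) \<le> K * norm (v - w) powr (-s)" and K: "K > 0"
  shows "\<psi> (norm (v - w)) \<le> 2 * K * pair_weight s bracket2 v w"
proof (cases "1 \<le> norm (v - w)")
  case True
  have "(norm (v - w))\<^sup>2 \<le> (norm v + norm w)\<^sup>2" by (intro power_mono norm_triangle_ineq4) auto
  also have "\<dots> \<le> 2 * (norm v)\<^sup>2 + 2 * (norm w)\<^sup>2"
    using zero_le_power2[of "norm v - norm w"] by (simp add: power2_eq_square algebra_simps)
  also have "\<dots> \<le> 2 * (bracket2 v * bracket2 w)" 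
    using mult_nonneg_nonneg[OF zero_le_power2[of "norm v"] zero_le_power2[of "norm w"]] 
    by (simp add: bracket2_def algebra_simps)
  finally have "K * (norm (v - w))\<^sup>2 \<le> K * (2 * (bracket2 v * bracket2 w))" using K by (intro mult_left_mono) auto
  then show ?thesis using ub(1)[OF True] True by (simp add: pair_weight_def)
next
  case False
  then have "\<psi> (norm (v - w)) \<le> K * norm (v - w) powr (-s)" using ub(2) by simp
  also have "\<dots> \<le> 2 * K * norm (v - w) powr (-s)" using K by (intro mult_right_mono) auto
  finally show ?thesis using False by (simp add: pair_weight_def)
qed

text \<open>
  The Gram determinant of two vectors. It does not change when one vector is replaced by the difference of both,
  which is why it vanishes quadratically on the diagonal.
\<close>

definition gram_det :: "'a::real_inner \<Rightarrow> 'a \<Rightarrow> real" where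
  "gram_det v w = (norm v)\<^sup>2 * (norm w)\<^sup>2 - (v \<bullet> w)\<^sup>2"

lemma gram_det_diff: "gram_det v w = (norm v)\<^sup>2 * (norm (v - w))\<^sup>2 - (v \<bullet> (v - w))\<^sup>2"
  "gram_det v w = (norm w)\<^sup>2 * (norm (v - w))\<^sup>2 - (w \<bullet> (v - w))\<^sup>2"
  unfolding gram_det_def power2_norm_eq_inner
  by (simp_all add: inner_diff_left inner_diff_right inner_commute
      power2_eq_square algebra_simps)

lemma gram_det_bounds: "0 \<le> gram_det v w" "gram_det v w \<le> (norm v)\<^sup>2 * (norm w)\<^sup>2"
   "gram_det v w \<le> (norm v)\<^sup>2 * (norm (v - w))\<^sup>2" "gram_det v w \<le> (norm w)\<^sup>2 * (norm (v - w))\<^sup>2"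
proof -
  show "0 \<le> gram_det v w" unfolding gram_det_def
    using Cauchy_Schwarz_ineq[of v w] by (simp add: power2_norm_eq_inner)
  show "gram_det v w \<le> (norm v)\<^sup>2 * (norm w)\<^sup>2" by (simp add: gram_det_def)
  show "gram_det v w \<le> (norm v)\<^sup>2 * (norm (v - w))\<^sup>2" unfolding gram_det_diff(1) by simp
  show "gram_det v w \<le> (norm w)\<^sup>2 * (norm (v - w))\<^sup>2" unfolding gram_det_diff(2) by simp
qed

text \<open>
  The second partial derivatives of \<open>g (bracket2 v)\<close>, expressed through functions \<open>g1\<close> and \<open>g2\<close> that stand
  for the first two derivatives of \<open>g\<close>.
\<close>

definition radial_hess :: "(real \<Rightarrow> real) \<Rightarrow> (real \<Rightarrow> real) \<Rightarrow> 'n::finite \<Rightarrow> 'n \<Rightarrow> real^'n \<Rightarrow> real" where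
  "radial_hess g1 g2 i j v = (if i = j then 2 * g1 (bracket2 v) else 0) + 4 * g2 (bracket2 v) * (v $ i * v $ j)"

definition radial_grad :: "(real \<Rightarrow> real) \<Rightarrow> 'n::finite \<Rightarrow> real^'n \<Rightarrow> real" where
  "radial_grad g1 i v = 2 * g1 (bracket2 v) * v $ i"

text \<open>
  The matrix \<open>landau_a\<close> is \<open>\<psi>\<close> times the projection orthogonal to \<open>z\<close>: its trace is \<open>N - 1\<close>, and its
  quadratic form at \<open>u\<close> is the squared length of the orthogonal part of \<open>u\<close>.
\<close>

lemma landau_a_radial_hess:
  fixes z u :: "real^'n::finite"
  assumes z: "z \<noteq> 0"
  shows "(\<Sum>i\<in>UNIV. \<Sum>j\<in>UNIV. landau_a \<psi> i j z * radial_hess g1 g2 i j u)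
    = \<psi> (norm z) * (2 * g1 (bracket2 u) * (real CARD('n) - 1)
        + 4 * g2 (bracket2 u) * ((norm u)\<^sup>2 - (u \<bullet> z)\<^sup>2 / (norm z)\<^sup>2))"
proof -
  let ?A = "2 * g1 (bracket2 u)" and ?B = "4 * g2 (bracket2 u)"
  have nz: "(norm z)\<^sup>2 = (\<Sum>i\<in>UNIV. z $ i * z $ i)"
    by (simp add: power2_norm_eq_inner inner_vec_def)
  have nu: "(norm u)\<^sup>2 = (\<Sum>i\<in>UNIV. u $ i * u $ i)"
    by (simp add: power2_norm_eq_inner inner_vec_def)
  have uz: "(u \<bullet> z)\<^sup>2 = (\<Sum>i\<in>UNIV. \<Sum>j\<in>UNIV. (u $ i * z $ i) * (u $ j * z $ j))"
    by (simp add: inner_vec_def power2_eq_square sum_product)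
  let ?P = "\<psi> (norm z)"
  have diag: "(\<Sum>i\<in>UNIV. \<Sum>j\<in>UNIV. if i = j then c i else 0) = (\<Sum>i\<in>UNIV. c i)" for c :: "'n \<Rightarrow> real"
    by simp
  have "(\<Sum>i\<in>UNIV. \<Sum>j\<in>UNIV. landau_a \<psi> i j z * radial_hess g1 g2 i j u)
    = (\<Sum>i\<in>UNIV. \<Sum>j\<in>UNIV. (if i = j then ?P * (?A - ?A / (norm z)\<^sup>2 * (z $ i * z $ i) + ?B * (u $ i * u $ i)) else 0)
        - ?P * ?B / (norm z)\<^sup>2 * ((u $ i * z $ i) * (u $ j * z $ j)))"
  proof (intro sum.cong refl)
    fix i j :: 'n
    have eq: "(1 - a / Z) * P * (A + B * b) = P * (A - A / Z * a + B * b) - P * B / Z * (a * b)"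
      "(0 - a / Z) * P * (0 + B * b) = 0 - P * B / Z * (a * b)" for a b A B P Z :: real
      by (simp_all add: algebra_simps add_divide_distrib)
    have ab: "u $ i * z $ i * (u $ j * z $ j) = z $ i * z $ j * (u $ i * u $ j)" by (simp only: mult_ac)
    show "landau_a \<psi> i j z * radial_hess g1 g2 i j u =
      (if i = j then ?P * (?A - ?A / (norm z)\<^sup>2 * (z $ i * z $ i) + ?B * (u $ i * u $ i)) else 0)
        - ?P * ?B / (norm z)\<^sup>2 * ((u $ i * z $ i) * (u $ j * z $ j))"
      unfolding landau_a_def radial_hess_def ab
      by (cases "i = j") (simp_all only: if_True if_False eq refl)
  qed
  also have "\<dots> = (\<Sum>i\<in>UNIV. ?P * (?A - ?A / (norm z)\<^sup>2 * (z $ i * z $ i) + ?B * (u $ i * u $ i)))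
        - ?P * ?B / (norm z)\<^sup>2 * (u \<bullet> z)\<^sup>2"
    by (simp only: sum_subtractf diag uz sum_distrib_left)
  also have "(\<Sum>i\<in>UNIV. ?P * (?A - ?A / (norm z)\<^sup>2 * (z $ i * z $ i) + ?B * (u $ i * u $ i)))
      = ?P * (?A * real CARD('n) - ?A / (norm z)\<^sup>2 * (\<Sum>i\<in>UNIV. z $ i * z $ i) + ?B * (\<Sum>i\<in>UNIV. u $ i * u $ i))"
    by (simp only: sum_distrib_left[symmetric] sum.distrib sum_subtractf sum_constant) (simp only: mult_ac)
  also have "\<dots> = ?P * (?A * (real CARD('n) - 1) + ?B * (norm u)\<^sup>2)"
  proof -
    have "A * n - A / Z * Z + B * U = A * (n - 1) + B * U" if "Z \<noteq> 0" for A n Z B U :: real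
      using that by (simp add: algebra_simps)
    moreover have "(norm z)\<^sup>2 \<noteq> 0" using z by simp
    ultimately show ?thesis unfolding nz[symmetric] nu[symmetric] by presburger
  qed
  also have "\<dots> - ?P * ?B / (norm z)\<^sup>2 * (u \<bullet> z)\<^sup>2
     = ?P * (?A * (real CARD('n) - 1) + ?B * ((norm u)\<^sup>2 - (u \<bullet> z)\<^sup>2 / (norm z)\<^sup>2))"
    by (simp only: distrib_left right_diff_distrib times_divide_eq_right times_divide_eq_left mult.assoc)
  finally show ?thesis .
qed

text \<open>
  The integrand of the weak form for a radial test function, without the factor \<open>f v * f w\<close>.
\<close>

definition landau_op :: "(real \<Rightarrow> real) \<Rightarrow> (real \<Rightarrow> real) \<Rightarrow> (real \<Rightarrow> real) \<Rightarrow> real^'n::finite \<Rightarrow> real^'n \<Rightarrow> real" where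
  "landau_op \<psi> g1 g2 v w =
     1 / 2 * (\<Sum>i\<in>UNIV. \<Sum>j\<in>UNIV. landau_a \<psi> i j (v - w) * (radial_hess g1 g2 i j v + radial_hess g1 g2 i j w))
     + (\<Sum>i\<in>UNIV. landau_b \<psi> i (v - w) * (radial_grad g1 i v - radial_grad g1 i w))"

text \<open>
  The trace terms of the diffusion part and the drift part combine, because
  \<open>|z|^2 - 2 v . z = |w|^2 - |v|^2\<close> and \<open>|z|^2 + 2 w . z = |v|^2 - |w|^2\<close>. In this form
  conservation of mass and energy (\<open>g1\<close> constant) and the sign for convex functions are visible.
\<close>

lemma landau_op_eq:
  fixes v w :: "real^'n::finite"
  assumes vw: "v \<noteq> w"
  shows "landau_op \<psi> g1 g2 v w = \<psi> (norm (v - w)) / (norm (v - w))\<^sup>2 *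
     (- (real CARD('n) - 1) * ((g1 (bracket2 v) - g1 (bracket2 w)) * (bracket2 v - bracket2 w))
       + 2 * (g2 (bracket2 v) + g2 (bracket2 w)) * gram_det v w)"
proof -
  let ?z = "v - w" and ?N = "real CARD('n)"
  have z: "?z \<noteq> 0" using vw by simp
  have a: "(\<Sum>i\<in>UNIV. \<Sum>j\<in>UNIV. landau_a \<psi> i j ?z * (radial_hess g1 g2 i j v + radial_hess g1 g2 i j w))
    = \<psi> (norm ?z) * (2 * (g1 (bracket2 v) + g1 (bracket2 w)) * (?N - 1)
        + 4 * g2 (bracket2 v) * (gram_det v w / (norm ?z)\<^sup>2) + 4 * g2 (bracket2 w) * (gram_det v w / (norm ?z)\<^sup>2))"
  proof -
    have "(norm v)\<^sup>2 - (v \<bullet> ?z)\<^sup>2 / (norm ?z)\<^sup>2 = gram_det v w / (norm ?z)\<^sup>2"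
      using z by (simp add: gram_det_diff(1) diff_divide_distrib)
    moreover have "(norm w)\<^sup>2 - (w \<bullet> ?z)\<^sup>2 / (norm ?z)\<^sup>2 = gram_det v w / (norm ?z)\<^sup>2"
      using z by (simp add: gram_det_diff(2) diff_divide_distrib)
    ultimately show ?thesis
      by (simp add: distrib_left sum.distrib landau_a_radial_hess[OF z]) (simp add: algebra_simps)
  qed
  have b: "(\<Sum>i\<in>UNIV. landau_b \<psi> i ?z * (radial_grad g1 i v - radial_grad g1 i w))
     = - (?N - 1) * \<psi> (norm ?z) / (norm ?z)\<^sup>2 * (2 * g1 (bracket2 v) * (v \<bullet> ?z) - 2 * g1 (bracket2 w) * (w \<bullet> ?z))"
  proof -
    let ?c = "- (?N - 1) * \<psi> (norm ?z) / (norm ?z)\<^sup>2"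
    have "(\<Sum>i\<in>UNIV. landau_b \<psi> i ?z * (radial_grad g1 i v - radial_grad g1 i w))
      = (\<Sum>i\<in>UNIV. ?c * (2 * g1 (bracket2 v) * (v $ i * ?z $ i) - 2 * g1 (bracket2 w) * (w $ i * ?z $ i)))"
      unfolding landau_b_def radial_grad_def
      by (intro sum.cong refl) (simp only: times_divide_eq_left times_divide_eq_right, simp only: algebra_simps)
    also have "\<dots> = ?c * (2 * g1 (bracket2 v) * (v \<bullet> ?z) - 2 * g1 (bracket2 w) * (w \<bullet> ?z))"
      by (simp only: inner_vec_def inner_real_def sum_distrib_left sum_subtractf[symmetric])
    finally show ?thesis .
  qed
  have nz: "(norm ?z)\<^sup>2 = (norm v)\<^sup>2 + (norm w)\<^sup>2 - 2 * (v \<bullet> w)"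
    by (simp add: power2_norm_eq_inner inner_diff_left inner_diff_right inner_commute)
  have vz: "v \<bullet> ?z = (norm v)\<^sup>2 - v \<bullet> w" "w \<bullet> ?z = v \<bullet> w - (norm w)\<^sup>2"
    by (simp_all add: power2_norm_eq_inner inner_diff_right inner_commute)
  have key: "(g1 (bracket2 v) + g1 (bracket2 w)) * (norm ?z)\<^sup>2 - 2 * g1 (bracket2 v) * (v \<bullet> ?z) + 2 * g1 (bracket2 w) * (w \<bullet> ?z)
     = - ((g1 (bracket2 v) - g1 (bracket2 w)) * (bracket2 v - bracket2 w))"
    unfolding nz vz by (simp add: bracket2_def algebra_simps)
  have n0: "(norm ?z)\<^sup>2 \<noteq> 0" using z by simp
  have "landau_op \<psi> g1 g2 v w = \<psi> (norm ?z) / (norm ?z)\<^sup>2 *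
     ((?N - 1) * ((g1 (bracket2 v) + g1 (bracket2 w)) * (norm ?z)\<^sup>2 - 2 * g1 (bracket2 v) * (v \<bullet> ?z) + 2 * g1 (bracket2 w) * (w \<bullet> ?z))
       + 2 * (g2 (bracket2 v) + g2 (bracket2 w)) * gram_det v w)"
  proof -
    have "1 / 2 * (P * (2 * (a + b) * (n - 1) + 4 * c * (X / Z) + 4 * d * (X / Z)))
        + - (n - 1) * P / Z * (2 * a * x - 2 * b * y)
       = P / Z * ((n - 1) * ((a + b) * Z - 2 * a * x + 2 * b * y) + 2 * (c + d) * X)"
      if "Z \<noteq> 0" for P a b c d n x y X Z :: real
      using that by (simp add: field_simps)
    from this[OF n0] show ?thesis unfolding landau_op_def a b .
  qed
  then show ?thesis unfolding key by (simp only: mult_minus_left mult_minus_right)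
qed

text \<open>
  Monotonicity of \<open>g1\<close> removes the first term of \<open>landau_op_eq\<close>. The remaining one uses
  \<open>gram_det v w \<le> bracket2 v * bracket2 w\<close> away from the diagonal and the quadratic vanishing of the Gram
  determinant near it.
\<close>

lemma landau_op_convex_le:
  fixes v w :: "real^'n::finite" and h g1 g2 :: "real \<Rightarrow> real"
  assumes \<psi>0: "0 \<le> \<psi> (norm (v - w))" and vw: "v \<noteq> w"
    and ub: "1 \<le> norm (v - w) \<Longrightarrow> \<psi> (norm (v - w)) \<le> K * (norm (v - w))\<^sup>2"
     "norm (v - w) < 1 \<Longrightarrow> \<psi> (norm (v - w)) \<le> K * norm (v - w) powr (-s)" and K: "K > 0"
    and mono: "\<And>x y. 1 \<le> x \<Longrightarrow> x \<le> y \<Longrightarrow> g1 x \<le> g1 y"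
    and g2: "\<And>y. 1 \<le> y \<Longrightarrow> 0 \<le> g2 y" and gh: "\<And>y. 1 \<le> y \<Longrightarrow> y\<^sup>2 * g2 y \<le> c * h y"
  shows "landau_op \<psi> g1 g2 v w \<le> 2 * K * c * (pair_weight s (\<lambda>v. h (bracket2 v)) v w + pair_weight s (\<lambda>v. h (bracket2 v)) w v)"
proof -
  let ?z = "v - w" and ?N = "real CARD('n)"
  let ?X = "gram_det v w"
  have n0: "(norm ?z)\<^sup>2 > 0" using vw by simp
  have ghv: "bracket2 u * g2 (bracket2 u) \<le> c * (h (bracket2 u) / bracket2 u)" for u :: "real^'n"
    using gh[OF bracket2_ge_1, of u] by (simp add: field_simps power2_eq_square)
  have "0 \<le> (g1 (bracket2 v) - g1 (bracket2 w)) * (bracket2 v - bracket2 w)"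
    using mono[OF bracket2_ge_1, of v "bracket2 w"] mono[OF bracket2_ge_1, of w "bracket2 v"]
    by (cases "bracket2 v \<le> bracket2 w") (auto intro: mult_nonpos_nonpos)
  moreover have "1 \<le> ?N" by (simp add: Suc_le_eq)
  ultimately have "- (?N - 1) * ((g1 (bracket2 v) - g1 (bracket2 w)) * (bracket2 v - bracket2 w)) \<le> 0"
    by (simp add: mult_le_0_iff)
  then have "landau_op \<psi> g1 g2 v w \<le> \<psi> (norm ?z) / (norm ?z)\<^sup>2 * (2 * (g2 (bracket2 v) + g2 (bracket2 w)) * ?X)"
    unfolding landau_op_eq[OF vw] using \<psi>0 by (intro mult_left_mono) auto
  also have "\<dots> \<le> 2 * K * c * (pair_weight s (\<lambda>v. h (bracket2 v)) v w + pair_weight s (\<lambda>v. h (bracket2 v)) w v)"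
  proof (cases "1 \<le> norm ?z")
    case True
    have "\<psi> (norm ?z) / (norm ?z)\<^sup>2 \<le> K" using ub(1)[OF True] n0 by (simp add: divide_le_eq)
    then have "\<psi> (norm ?z) / (norm ?z)\<^sup>2 * (2 * (g2 (bracket2 v) + g2 (bracket2 w)) * ?X)
       \<le> K * (2 * (g2 (bracket2 v) + g2 (bracket2 w)) * ?X)"
      using g2[OF bracket2_ge_1] gram_det_bounds(1)[of v w]
      by (intro mult_right_mono mult_nonneg_nonneg add_nonneg_nonneg) auto
    also have "\<dots> \<le> K * (2 * (g2 (bracket2 v) + g2 (bracket2 w)) * (bracket2 v * bracket2 w))"
    proof -
      have "?X \<le> (norm v)\<^sup>2 * (norm w)\<^sup>2" by (rule gram_det_bounds)
      also have "\<dots> \<le> bracket2 v * bracket2 w" by (intro mult_mono) (auto simp: bracket2_def)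
      finally show ?thesis using K g2[OF bracket2_ge_1]
        by (intro mult_left_mono mult_nonneg_nonneg add_nonneg_nonneg) auto
    qed
    also have "\<dots> = 2 * K * ((bracket2 v * g2 (bracket2 v)) * bracket2 w + (bracket2 w * g2 (bracket2 w)) * bracket2 v)"
      by (simp add: algebra_simps)
    also have "\<dots> \<le> 2 * K * (c * h (bracket2 v) * bracket2 w + c * h (bracket2 w) * bracket2 v)"
    proof -
      have "bracket2 u * g2 (bracket2 u) \<le> c * h (bracket2 u)" for u :: "real^'n"
      proof -
        have "bracket2 u * g2 (bracket2 u) \<le> (bracket2 u)\<^sup>2 * g2 (bracket2 u)"
          using bracket2_ge_1[of u] g2[OF bracket2_ge_1, of u] by (intro mult_right_mono) (auto simp: power2_eq_square)
        then show ?thesis using gh[OF bracket2_ge_1, of u] by linarith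
      qed
      then show ?thesis using K by (intro mult_left_mono add_mono mult_right_mono) auto
    qed
    finally show ?thesis using True
      by (simp only: pair_weight_def norm_minus_commute[of w v] if_True) (simp only: algebra_simps)
  next
    case False
    then have zs: "\<psi> (norm ?z) \<le> K * norm ?z powr (-s)" using ub(2) by simp
    have "\<psi> (norm ?z) / (norm ?z)\<^sup>2 * (2 * (g2 (bracket2 v) + g2 (bracket2 w)) * ?X)
      = \<psi> (norm ?z) * (2 * (g2 (bracket2 v) * (?X / (norm ?z)\<^sup>2) + g2 (bracket2 w) * (?X / (norm ?z)\<^sup>2)))"
      by (simp add: algebra_simps add_divide_distrib)
    also have "\<dots> \<le> \<psi> (norm ?z) * (2 * (g2 (bracket2 v) * bracket2 v + g2 (bracket2 w) * bracket2 w))"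
    proof -
      have "?X / (norm ?z)\<^sup>2 \<le> (norm v)\<^sup>2" "?X / (norm ?z)\<^sup>2 \<le> (norm w)\<^sup>2"
        using gram_det_bounds(3,4)[of v w] n0 by (simp_all add: divide_le_eq)
      then have "?X / (norm ?z)\<^sup>2 \<le> bracket2 v" "?X / (norm ?z)\<^sup>2 \<le> bracket2 w" by (simp_all add: bracket2_def)
      then show ?thesis using \<psi>0 g2[OF bracket2_ge_1] by (intro mult_left_mono add_mono) auto
    qed
    also have "\<dots> \<le> (K * norm ?z powr (-s)) * (2 * (g2 (bracket2 v) * bracket2 v + g2 (bracket2 w) * bracket2 w))"
      using zs g2[OF bracket2_ge_1] by (intro mult_right_mono) (auto intro!: add_nonneg_nonneg mult_nonneg_nonneg)
    also have "\<dots> \<le> (K * norm ?z powr (-s)) * (2 * (c * (h (bracket2 v) / bracket2 v) + c * (h (bracket2 w) / bracket2 w)))"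
      using K ghv by (intro mult_left_mono add_mono) (auto simp: mult.commute)
    finally show ?thesis using False
      by (simp only: pair_weight_def norm_minus_commute[of w v] if_False) (simp only: algebra_simps)
  qed
  finally show ?thesis .
qed

section \<open>Radial test functions\<close>

lemma bracket2_has_derivative: "(bracket2 has_derivative (\<lambda>h. 2 * (v \<bullet> h))) (at v)"
  unfolding bracket2_def[abs_def] power2_norm_eq_inner
  by (auto intro!: derivative_eq_intros simp: inner_commute)

lemma partial_eq:
  assumes "(\<phi> has_derivative D) (at v)"
  shows "partial i \<phi> v = D (axis i 1)"
  unfolding partial_def using frechet_derivative_at[OF assms] by simp

text \<open>
  Differentiability is required on \<open>{0<..}\<close> only, where \<open>bracket2\<close> takes its values; powers with real exponents
  are not differentiable at \<open>0\<close> in general.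
\<close>

locale radial_C2 =
  fixes g g1 g2 :: "real \<Rightarrow> real"
  assumes g: "\<And>y. 0 < y \<Longrightarrow> (g has_real_derivative g1 y) (at y)"
    and g1: "\<And>y. 0 < y \<Longrightarrow> (g1 has_real_derivative g2 y) (at y)"
    and g2: "continuous_on {0<..} g2"
begin

lemma derivative: "((\<lambda>v. g (bracket2 v)) has_derivative (\<lambda>h. g1 (bracket2 v) * (2 * (v \<bullet> h)))) (at v)"
  using has_derivative_compose[OF bracket2_has_derivative[of v] g[OF bracket2_pos[of v], THEN has_field_derivative_imp_has_derivative]]
  by simp

lemma partial_radial: "partial i (\<lambda>v. g (bracket2 v)) = radial_grad g1 i"
  by (rule ext, subst partial_eq[OF derivative]) (simp add: radial_grad_def inner_axis)

lemma grad_derivative: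
  "(radial_grad g1 i has_derivative (\<lambda>h. 2 * g1 (bracket2 v) * h $ i + 4 * g2 (bracket2 v) * (v \<bullet> h) * v $ i)) (at v)"
proof -
  have g1': "((\<lambda>v. g1 (bracket2 v)) has_derivative (\<lambda>h. g2 (bracket2 v) * (2 * (v \<bullet> h)))) (at v)"
    using has_derivative_compose[OF bracket2_has_derivative[of v] g1[OF bracket2_pos[of v], THEN has_field_derivative_imp_has_derivative]]
    by simp
  show ?thesis unfolding radial_grad_def[abs_def]
    by (auto intro!: derivative_eq_intros g1' bounded_linear.has_derivative[OF bounded_linear_vec_nth] simp: algebra_simps)
qed

lemma partial_partial_radial: "partial i (partial j (\<lambda>v. g (bracket2 v))) = radial_hess g1 g2 i j"
  unfolding partial_radial
  by (rule ext, subst partial_eq[OF grad_derivative]) (auto simp: radial_hess_def inner_axis, simp_all add: axis_def)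

lemma bracket2_continuous: "continuous_on UNIV bracket2"
  unfolding bracket2_def[abs_def] by (intro continuous_intros)

lemma continuous_g1: "continuous_on {0<..} g1"
  using g1 by (intro DERIV_continuous_on[of _ _ g2]) (auto intro: has_field_derivative_at_within)

lemma continuous_hess: "continuous_on UNIV (radial_hess g1 g2 i j)"
proof -
  have "continuous_on UNIV (\<lambda>v. g1 (bracket2 v))" "continuous_on UNIV (\<lambda>v. g2 (bracket2 v))"
    by (rule continuous_on_compose2[OF continuous_g1 bracket2_continuous]
             continuous_on_compose2[OF g2 bracket2_continuous]; auto)+
  then show ?thesis unfolding radial_hess_def[abs_def]
    by (cases "i = j") (auto intro!: continuous_intros)
qed

lemma C2c_radial:
  assumes n: "\<And>y. n \<le> y \<Longrightarrow> g y = 0"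
  shows "(\<lambda>v::real^'n::finite. g (bracket2 v)) \<in> C2c"
proof -
  have d1: "(\<lambda>v::real^'n. g (bracket2 v)) differentiable_on UNIV"
    using derivative unfolding differentiable_on_def by (auto simp: differentiable_def)
  have d2: "partial i (\<lambda>v::real^'n. g (bracket2 v)) differentiable_on UNIV" for i
    unfolding partial_radial using grad_derivative unfolding differentiable_on_def by (auto simp: differentiable_def)
  have "Ck 2 (\<lambda>v::real^'n. g (bracket2 v))"
    using d1 d2 by (simp add: numeral_2_eq_2 partial_partial_radial continuous_hess)
  moreover have "compact_support (\<lambda>v::real^'n. g (bracket2 v))"
  proof -
    have "support_on UNIV (\<lambda>v::real^'n. g (bracket2 v)) \<subseteq> cball 0 (sqrt (max 0 n))"
    proof
      fix v :: "real^'n" assume "v \<in> support_on UNIV (\<lambda>v. g (bracket2 v))"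
      then have "bracket2 v < n" using n[of "bracket2 v"] by (auto simp: support_on_def not_le[symmetric])
      then have "(norm v)\<^sup>2 \<le> max 0 n" by (auto simp: bracket2_def)
      then show "v \<in> cball 0 (sqrt (max 0 n))" by (simp add: real_le_rsqrt)
    qed
    then have "bounded (support_on UNIV (\<lambda>v::real^'n. g (bracket2 v)))" by (rule bounded_subset[OF bounded_cball])
    then show ?thesis by (simp add: compact_support_def)
  qed
  ultimately show ?thesis by (simp add: C2c_def)
qed

text \<open>
  The gradient is Lipschitz because the Hessian is bounded. A direct argument: for \<open>|w| \<le> |v|\<close> write the difference
  as \<open>g1\<close> at the outer point times \<open>v - w\<close> plus an increment of \<open>g1\<close> times \<open>w\<close>, and apply the mean value theorem
  in the radius, where \<open>|w|\<close> is dominated by the intermediate radius.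
\<close>

lemma grad_lipschitz:
  assumes b1: "\<And>y. 1 \<le> y \<Longrightarrow> \<bar>g1 y\<bar> \<le> C" and b2: "\<And>y. 1 \<le> y \<Longrightarrow> y * \<bar>g2 y\<bar> \<le> C"
  shows "\<bar>radial_grad g1 i v - radial_grad g1 i w\<bar> \<le> 6 * C * norm (v - w)"
proof -
  have C: "0 \<le> C" using b1[of 1] by auto
  have *: "\<bar>radial_grad g1 i v - radial_grad g1 i w\<bar> \<le> 6 * C * norm (v - w)" if le: "norm w \<le> norm v" for v w
  proof -
    have lip: "norm w * \<bar>g1 (bracket2 v) - g1 (bracket2 w)\<bar> \<le> 2 * C * norm (v - w)"
    proof (cases "norm w = norm v")
      case True
      then show ?thesis using C by (simp add: bracket2_def)
    next
      case False
      with le have lt: "norm w < norm v" by simp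
      have pos: "0 < 1 + r\<^sup>2" for r :: real using zero_le_power2[of r] by linarith
      have "\<exists>z. norm w < z \<and> z < norm v \<and> g1 (1 + (norm v)\<^sup>2) - g1 (1 + (norm w)\<^sup>2)
           = (norm v - norm w) * (g2 (1 + z\<^sup>2) * (2 * z))"
        by (rule MVT2[OF lt]) (auto intro!: derivative_eq_intros DERIV_chain2[where f = g1 and g = "\<lambda>r. 1 + r\<^sup>2"] g1[OF pos])
      then obtain z where z: "norm w < z" "g1 (bracket2 v) - g1 (bracket2 w) = (norm v - norm w) * (g2 (1 + z\<^sup>2) * (2 * z))"
        unfolding bracket2_def by blast
      have zp: "0 \<le> z" using z(1) norm_ge_zero[of w] by linarith
      have "norm w * \<bar>g1 (bracket2 v) - g1 (bracket2 w)\<bar> = norm w * ((norm v - norm w) * (\<bar>g2 (1 + z\<^sup>2)\<bar> * (2 * z)))"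
        unfolding z(2) using lt zp by (simp add: abs_mult)
      also have "\<dots> \<le> z * ((norm v - norm w) * (\<bar>g2 (1 + z\<^sup>2)\<bar> * (2 * z)))"
        using z(1) lt zp by (intro mult_right_mono) auto
      also have "\<dots> = 2 * (norm v - norm w) * (z\<^sup>2 * \<bar>g2 (1 + z\<^sup>2)\<bar>)"
        by (simp add: power2_eq_square)
      also have "\<dots> \<le> 2 * (norm v - norm w) * C"
      proof (intro mult_left_mono)
        have "z\<^sup>2 * \<bar>g2 (1 + z\<^sup>2)\<bar> \<le> (1 + z\<^sup>2) * \<bar>g2 (1 + z\<^sup>2)\<bar>" by (intro mult_right_mono) auto
        also have "\<dots> \<le> C" by (rule b2) simp
        finally show "z\<^sup>2 * \<bar>g2 (1 + z\<^sup>2)\<bar> \<le> C" .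
      qed (use lt in auto)
      also have "\<dots> \<le> 2 * norm (v - w) * C"
        using norm_triangle_ineq2[of v w] C by (intro mult_right_mono mult_left_mono) auto
      finally show ?thesis by (simp add: mult_ac)
    qed
    have "radial_grad g1 i v - radial_grad g1 i w = 2 * (g1 (bracket2 v) * (v - w) $ i) + 2 * (w $ i * (g1 (bracket2 v) - g1 (bracket2 w)))"
      by (simp add: radial_grad_def algebra_simps)
    also have "\<bar>\<dots>\<bar> \<le> 2 * (\<bar>g1 (bracket2 v)\<bar> * \<bar>(v - w) $ i\<bar>) + 2 * (\<bar>w $ i\<bar> * \<bar>g1 (bracket2 v) - g1 (bracket2 w)\<bar>)"
      by (rule order_trans[OF abs_triangle_ineq]) (simp only: abs_mult abs_numeral order_refl)
    also have "\<dots> \<le> 2 * (C * norm (v - w)) + 2 * (norm w * \<bar>g1 (bracket2 v) - g1 (bracket2 w)\<bar>)"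
      using b1[OF bracket2_ge_1] C by (intro add_mono mult_left_mono mult_mono mult_right_mono component_le_norm_cart) auto
    also have "\<dots> \<le> 6 * C * norm (v - w)" using lip by simp
    finally show ?thesis .
  qed
  show ?thesis
  proof (cases "norm w \<le> norm v")
    case True then show ?thesis by (rule *)
  next
    case False
    then have "\<bar>radial_grad g1 i w - radial_grad g1 i v\<bar> \<le> 6 * C * norm (w - v)" by (intro *) auto
    then show ?thesis by (simp add: norm_minus_commute abs_minus_commute)
  qed
qed

lemma hess_bound:
  assumes b1: "\<And>y. 1 \<le> y \<Longrightarrow> \<bar>g1 y\<bar> \<le> C" and b2: "\<And>y. 1 \<le> y \<Longrightarrow> y * \<bar>g2 y\<bar> \<le> C"
  shows "\<bar>radial_hess g1 g2 i j v\<bar> \<le> 6 * C"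
proof -
  have C: "0 \<le> C" using b1[of 1] by auto
  have "\<bar>v $ i * v $ j\<bar> \<le> norm v * norm v"
    unfolding abs_mult by (intro mult_mono component_le_norm_cart) auto
  also have "\<dots> \<le> bracket2 v" by (simp add: bracket2_def power2_eq_square)
  finally have "\<bar>g2 (bracket2 v)\<bar> * \<bar>v $ i * v $ j\<bar> \<le> \<bar>g2 (bracket2 v)\<bar> * bracket2 v" by (intro mult_left_mono) auto
  also have "\<dots> \<le> C" using b2[OF bracket2_ge_1, of v] by (simp add: mult.commute)
  finally have "\<bar>4 * g2 (bracket2 v) * (v $ i * v $ j)\<bar> \<le> 4 * C" by (simp add: abs_mult)
  moreover have "\<bar>if i = j then 2 * g1 (bracket2 v) else 0\<bar> \<le> 2 * C" using b1[OF bracket2_ge_1, of v] C by auto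
  ultimately show ?thesis unfolding radial_hess_def by linarith
qed

end

section \<open>Regularised powers and their cutoffs\<close>

text \<open>
  Its powers with exponent at least \<open>3\<close> are cutoffs of class \<open>C^2\<close> in \<open>y\<close>, supported in \<open>y \<le> n\<close>.
\<close>

definition ramp :: "real \<Rightarrow> real \<Rightarrow> real" where "ramp n y = max 0 (1 - y / n)"

lemma ramp_bounds: "0 \<le> ramp n y" "n > 0 \<Longrightarrow> 0 \<le> y \<Longrightarrow> ramp n y \<le> 1" "n > 0 \<Longrightarrow> n \<le> y \<Longrightarrow> ramp n y = 0"
  by (auto simp: ramp_def)

text \<open>
  The only delicate point is the kink at \<open>y = n\<close>, where the difference quotient of \<open>max 0 u ^ k\<close> is at most
  \<open>|u| ^ (k - 1)\<close>.
\<close>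

lemma ramp_power_deriv:
  assumes n: "n > 0" and k: "k \<ge> 2"
  shows "((\<lambda>y. ramp n y ^ k) has_real_derivative (- (real k / n) * ramp n y ^ (k - 1))) (at y)"
proof -
  have pos: "((\<lambda>u::real. max 0 u ^ k) has_real_derivative real k * max 0 u ^ (k - 1)) (at u)" for u
  proof -
    consider "u > 0" | "u < 0" | "u = 0" by linarith
    then show ?thesis
    proof cases
      case 1
      have "((\<lambda>u::real. u ^ k) has_real_derivative real k * max 0 u ^ (k - 1)) (at u)"
        using 1 by (auto intro!: derivative_eq_intros)
      then show ?thesis
        by (rule has_field_derivative_transform_within_open[of _ _ _ "{0<..}"]) (use 1 in auto)
    next
      case 2
      have "((\<lambda>u::real. 0) has_real_derivative real k * max 0 u ^ (k - 1)) (at u)"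
        using 2 k by (auto simp: power_0_left)
      then show ?thesis
        by (rule has_field_derivative_transform_within_open[of _ _ _ "{..<0}"]) (use 2 k in \<open>auto simp: power_0_left\<close>)
    next
      case 3
      have "((\<lambda>h::real. max 0 h ^ k / h) \<longlongrightarrow> 0) (at 0)"
      proof (rule Lim_null_comparison)
        show "\<forall>\<^sub>F h in at (0::real). norm (max 0 h ^ k / h) \<le> \<bar>h\<bar> ^ (k - 1)"
        proof (rule always_eventually, rule allI)
          fix h :: real
          have "max 0 h ^ k \<le> \<bar>h\<bar> ^ k" by (intro power_mono) auto
          also have "\<dots> = \<bar>h\<bar> ^ (k - 1) * \<bar>h\<bar>" using k by (simp add: power_eq_if)
          finally show "norm (max 0 h ^ k / h) \<le> \<bar>h\<bar> ^ (k - 1)"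
            by (cases "h = 0") (auto simp: divide_le_eq)
        qed
        have "((\<lambda>h::real. \<bar>h\<bar> ^ (k - 1)) \<longlongrightarrow> \<bar>0\<bar> ^ (k - 1)) (at 0)" by (intro tendsto_intros)
        then show "((\<lambda>h::real. \<bar>h\<bar> ^ (k - 1)) \<longlongrightarrow> 0) (at 0)" using k by (simp add: power_0_left)
      qed
      then show ?thesis using 3 k by (simp add: DERIV_def power_0_left)
    qed
  qed
  have "((\<lambda>y. 1 - y / n) has_real_derivative (- 1 / n)) (at y)"
    using n by (auto intro!: derivative_eq_intros)
  from DERIV_chain2[OF pos this] show ?thesis by (simp add: ramp_def)
qed

text \<open>
  Agrees with \<open>y powr p\<close> in the limit \<open>\<epsilon> \<rightarrow> 0\<close> but stays bounded by \<open>\<epsilon> powr (- p)\<close>.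
\<close>

definition saturated :: "real \<Rightarrow> real \<Rightarrow> real \<Rightarrow> real" where
  "saturated p \<epsilon> y = (y / (1 + \<epsilon> * y)) powr p"

text \<open>
  The regularisation of \<open>y powr (1 + p)\<close>, followed by its first and second derivatives. The second derivative is
  positive: in the derivative of \<open>reg_power1\<close> the terms with a negative sign cancel exactly.
\<close>

definition reg_power :: "real \<Rightarrow> real \<Rightarrow> real \<Rightarrow> real" where
  "reg_power p \<epsilon> y = y * saturated p \<epsilon> y"

definition reg_power1 :: "real \<Rightarrow> real \<Rightarrow> real \<Rightarrow> real" where
  "reg_power1 p \<epsilon> y = saturated p \<epsilon> y * (1 + p / (1 + \<epsilon> * y))"

definition reg_power2 :: "real \<Rightarrow> real \<Rightarrow> real \<Rightarrow> real" where
  "reg_power2 p \<epsilon> y = p * (p + 1) * saturated p \<epsilon> y / (y * (1 + \<epsilon> * y)\<^sup>2)"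

definition cut_power :: "real \<Rightarrow> real \<Rightarrow> real \<Rightarrow> real \<Rightarrow> real" where
  "cut_power p \<epsilon> n y = reg_power p \<epsilon> y * ramp n y ^ 3"

definition cut_power1 :: "real \<Rightarrow> real \<Rightarrow> real \<Rightarrow> real \<Rightarrow> real" where
  "cut_power1 p \<epsilon> n y = reg_power1 p \<epsilon> y * ramp n y ^ 3 - (3 / n) * (reg_power p \<epsilon> y * ramp n y ^ 2)"

definition cut_power2 :: "real \<Rightarrow> real \<Rightarrow> real \<Rightarrow> real \<Rightarrow> real" where
  "cut_power2 p \<epsilon> n y = reg_power2 p \<epsilon> y * ramp n y ^ 3 - (6 / n) * (reg_power1 p \<epsilon> y * ramp n y ^ 2)
     + (6 / n\<^sup>2) * (reg_power p \<epsilon> y * ramp n y)"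

context
  fixes p \<epsilon> :: real
  assumes p: "0 < p" and e: "0 < \<epsilon>"
begin

lemma den_pos: "0 < y \<Longrightarrow> 0 < 1 + \<epsilon> * y"
  using e by (simp add: add_pos_pos)

lemma saturated_deriv:
  assumes y: "0 < y"
  shows "(saturated p \<epsilon> has_real_derivative p * saturated p \<epsilon> y / (y * (1 + \<epsilon> * y))) (at y)"
proof -
  have d: "0 < 1 + \<epsilon> * y" using den_pos[OF y] .
  have "((\<lambda>y. y / (1 + \<epsilon> * y)) has_real_derivative 1 / (1 + \<epsilon> * y)\<^sup>2) (at y)"
    using d by (auto intro!: derivative_eq_intros simp: power2_eq_square field_simps)
  from DERIV_fun_powr[OF this, of p] have
    "(saturated p \<epsilon> has_real_derivative p * (y / (1 + \<epsilon> * y)) powr (p - 1) * (1 / (1 + \<epsilon> * y)\<^sup>2)) (at y)"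
    using d y unfolding saturated_def[abs_def] by simp
  moreover have "(y / (1 + \<epsilon> * y)) powr (p - 1) = saturated p \<epsilon> y / (y / (1 + \<epsilon> * y))"
    unfolding saturated_def using d y by (subst powr_diff) simp
  moreover have "p * (S / (y / D)) * (1 / D\<^sup>2) = p * S / (y * D)" if "D \<noteq> 0" for S D :: real
    using that y by (simp add: power2_eq_square field_simps)
  ultimately show ?thesis using d by simp
qed

lemma reg_power_deriv:
  assumes y: "0 < y"
  shows "(reg_power p \<epsilon> has_real_derivative reg_power1 p \<epsilon> y) (at y)"
proof -
  have "1 * S + p * S / (y * D) * y = S * (1 + p / D)" if "D \<noteq> 0" for S D :: real
    using that y by (simp add: field_simps)
  then show ?thesis
    using DERIV_mult[OF DERIV_ident saturated_deriv[OF y]] den_pos[OF y]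
    unfolding reg_power_def[abs_def] reg_power1_def by (simp add: less_imp_neq[symmetric])
qed

lemma reg_power1_deriv:
  assumes y: "0 < y"
  shows "(reg_power1 p \<epsilon> has_real_derivative reg_power2 p \<epsilon> y) (at y)"
proof -
  have d: "0 < 1 + \<epsilon> * y" using den_pos[OF y] .
  have "((\<lambda>y. 1 + p / (1 + \<epsilon> * y)) has_real_derivative - (p * \<epsilon> / (1 + \<epsilon> * y)\<^sup>2)) (at y)"
    using d by (auto intro!: derivative_eq_intros simp: power2_eq_square)
  note * = DERIV_mult[OF saturated_deriv[OF y] this]
  have "p * S / (y * D) * (1 + p / D) + - (p * e / D\<^sup>2) * S = p * (p + 1) * S / (y * D\<^sup>2)"
    if D: "D \<noteq> 0" "D = 1 + e * y" for S D e :: real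
  proof -
    \<comment> \<open>Eliminating \<open>e\<close> leaves an identity of rational functions in \<open>y\<close> and \<open>D\<close>.\<close>
    have e: "e = (D - 1) / y" using D y by simp
    show ?thesis unfolding e using D(1) y by (simp add: power2_eq_square field_simps)
  qed
  from this[OF _ refl, of \<epsilon>] d * show ?thesis
    unfolding reg_power1_def[abs_def] reg_power2_def by simp
qed

lemma reg_power2_continuous: "continuous_on {0<..} (reg_power2 p \<epsilon>)"
proof -
  have "continuous_on {0<..} (saturated p \<epsilon>)"
    by (rule DERIV_continuous_on[OF has_field_derivative_at_within[OF saturated_deriv]]) auto
  then show ?thesis unfolding reg_power2_def[abs_def]
    using den_pos by (auto intro!: continuous_intros simp: less_imp_neq[symmetric])
qed

lemma saturated_bounds:
  assumes y: "0 < y"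
  shows "0 \<le> saturated p \<epsilon> y" "saturated p \<epsilon> y \<le> \<epsilon> powr (-p)" "saturated p \<epsilon> y \<le> y powr p"
proof -
  have d: "0 < 1 + \<epsilon> * y" using den_pos[OF y] .
  show "0 \<le> saturated p \<epsilon> y" by (simp add: saturated_def)
  have "y / (1 + \<epsilon> * y) \<le> 1 / \<epsilon>" using d e by (simp add: field_simps)
  then have "saturated p \<epsilon> y \<le> (1 / \<epsilon>) powr p" unfolding saturated_def using d y p by (intro powr_mono2) auto
  then show "saturated p \<epsilon> y \<le> \<epsilon> powr (-p)" using e by (simp add: powr_divide powr_minus_divide)
  have "y / (1 + \<epsilon> * y) \<le> y" using d y e by (simp add: divide_le_eq)
  then show "saturated p \<epsilon> y \<le> y powr p" unfolding saturated_def using d y p by (intro powr_mono2) auto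
qed

text \<open>
  The bounds containing \<open>\<epsilon> powr (- p)\<close> are used for integrability only. The last one is uniform in \<open>\<epsilon>\<close>; it is
  the inequality between a power and its second derivative that determines the growth rate of the moment.
\<close>

lemma reg_power_bounds:
  assumes y: "0 < y"
  shows "0 \<le> reg_power p \<epsilon> y" "reg_power p \<epsilon> y \<le> \<epsilon> powr (-p) * y" "reg_power p \<epsilon> y \<le> y powr (1 + p)"
    "0 \<le> reg_power1 p \<epsilon> y" "reg_power1 p \<epsilon> y \<le> (1 + p) * \<epsilon> powr (-p)"
    "0 \<le> reg_power2 p \<epsilon> y" "y * reg_power2 p \<epsilon> y \<le> p * (p + 1) * \<epsilon> powr (-p)"
    "y\<^sup>2 * reg_power2 p \<epsilon> y \<le> p * (p + 1) * reg_power p \<epsilon> y"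
proof -
  note s = saturated_bounds[OF y]
  define D where "D = 1 + \<epsilon> * y"
  have D: "1 \<le> D" using y e by (simp add: D_def)
  have d: "0 < 1 + \<epsilon> * y" using den_pos[OF y] .
  show "0 \<le> reg_power p \<epsilon> y" using s y by (simp add: reg_power_def)
  show "reg_power p \<epsilon> y \<le> \<epsilon> powr (-p) * y" using s y by (simp add: reg_power_def mult.commute mult_left_mono)
  have "y * saturated p \<epsilon> y \<le> y * y powr p" using s y by (intro mult_left_mono) auto
  then show "reg_power p \<epsilon> y \<le> y powr (1 + p)" using y by (simp add: reg_power_def powr_add)
  show "0 \<le> reg_power1 p \<epsilon> y" using s y d p e by (simp add: reg_power1_def)
  have "p / D \<le> p" using D p by (simp add: divide_le_eq)
  then have "saturated p \<epsilon> y * (1 + p / D) \<le> \<epsilon> powr (-p) * (1 + p)"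
    using s D p by (intro mult_mono) auto
  then show "reg_power1 p \<epsilon> y \<le> (1 + p) * \<epsilon> powr (-p)" by (simp add: reg_power1_def D_def algebra_simps)
  show "0 \<le> reg_power2 p \<epsilon> y" using s y d p by (simp add: reg_power2_def)
  have D2: "saturated p \<epsilon> y / D\<^sup>2 \<le> saturated p \<epsilon> y" using D s by (simp add: divide_le_eq mult_le_cancel_left1 one_le_power)
  have eq: "y * reg_power2 p \<epsilon> y = p * (p + 1) * (saturated p \<epsilon> y / D\<^sup>2)"
    using y by (simp add: reg_power2_def D_def)
  also have "\<dots> \<le> p * (p + 1) * saturated p \<epsilon> y" using D2 p by (intro mult_left_mono) auto
  finally have le: "y * reg_power2 p \<epsilon> y \<le> p * (p + 1) * saturated p \<epsilon> y" .
  also have "\<dots> \<le> p * (p + 1) * \<epsilon> powr (-p)" using s p by (intro mult_left_mono) auto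
  finally show "y * reg_power2 p \<epsilon> y \<le> p * (p + 1) * \<epsilon> powr (-p)" .
  show "y\<^sup>2 * reg_power2 p \<epsilon> y \<le> p * (p + 1) * reg_power p \<epsilon> y"
    using mult_left_mono[OF le, of y] y by (simp add: reg_power_def power2_eq_square mult_ac)
qed

lemma reg_power1_mono:
  assumes "1 \<le> x" "x \<le> y"
  shows "reg_power1 p \<epsilon> x \<le> reg_power1 p \<epsilon> y"
proof (rule DERIV_nonneg_imp_nondecreasing[OF assms(2)])
  fix t assume "x \<le> t" "t \<le> y"
  then have "0 < t" using assms by auto
  then show "\<exists>d. (reg_power1 p \<epsilon> has_real_derivative d) (at t) \<and> 0 \<le> d"
    using reg_power1_deriv reg_power_bounds(6) by blast
qed

lemma cut_power_radial_C2:
  assumes n: "n > 0"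
  shows "radial_C2 (cut_power p \<epsilon> n) (cut_power1 p \<epsilon> n) (cut_power2 p \<epsilon> n)"
proof
  fix y :: real assume y: "0 < y"
  have c3: "((\<lambda>y. ramp n y ^ 3) has_real_derivative (- (3 / n) * ramp n y ^ 2)) (at y)"
    using ramp_power_deriv[OF n, of 3 y] by simp
  have c2: "((\<lambda>y. ramp n y ^ 2) has_real_derivative (- (2 / n) * ramp n y)) (at y)"
    using ramp_power_deriv[OF n, of 2 y] by simp
  show "(cut_power p \<epsilon> n has_real_derivative cut_power1 p \<epsilon> n y) (at y)"
    using DERIV_mult[OF reg_power_deriv[OF y] c3] unfolding cut_power_def[abs_def] cut_power1_def
    by (simp add: algebra_simps)
  show "(cut_power1 p \<epsilon> n has_real_derivative cut_power2 p \<epsilon> n y) (at y)"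
    using DERIV_diff[OF DERIV_mult[OF reg_power1_deriv[OF y] c3]
        DERIV_cmult[OF DERIV_mult[OF reg_power_deriv[OF y] c2], of "3 / n"]]
    unfolding cut_power1_def[abs_def] cut_power2_def
    by (simp add: algebra_simps power2_eq_square)
next
  have "continuous_on {0<..} (reg_power p \<epsilon>)"
    by (rule DERIV_continuous_on[OF has_field_derivative_at_within[OF reg_power_deriv]]) auto
  moreover have "continuous_on {0<..} (reg_power1 p \<epsilon>)"
    by (rule DERIV_continuous_on[OF has_field_derivative_at_within[OF reg_power1_deriv]]) auto
  ultimately show "continuous_on {0<..} (cut_power2 p \<epsilon> n)"
    unfolding cut_power2_def[abs_def] ramp_def using n
    by (auto intro!: continuous_intros reg_power2_continuous)
qed

text \<open>
  Each derivative of the cutoff costs a factor \<open>1 / n\<close> and each factor \<open>y\<close> is at most \<open>n\<close> on the support, so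
  the bounds are uniform in \<open>n\<close>.
\<close>

lemma cut_power_bounds:
  assumes n: "n > 0" and y: "0 < y" and C: "C = \<epsilon> powr (-p) * ((p + 1) * (p + 6) + 6)"
  shows "0 \<le> cut_power p \<epsilon> n y" "cut_power p \<epsilon> n y \<le> \<epsilon> powr (-p) * y" "\<bar>cut_power1 p \<epsilon> n y\<bar> \<le> C" "y * \<bar>cut_power2 p \<epsilon> n y\<bar> \<le> C"
    "n \<le> y \<Longrightarrow> cut_power p \<epsilon> n y = 0"
proof -
  note hb = reg_power_bounds[OF y]
  let ?c = "ramp n y" and ?B = "\<epsilon> powr (-p)"
  have c: "0 \<le> ?c" "?c \<le> 1" using ramp_bounds n y by auto
  have ck: "0 \<le> ?c ^ k" "?c ^ k \<le> 1" for k using c by (auto simp: power_le_one)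
  have B: "0 \<le> ?B" by simp
  have yc: "y * ?c \<le> n" using n y c by (cases "y \<le> n") (auto simp: ramp_bounds(3) intro: order_trans[OF mult_left_le])
  have ycn: "y / n * ?c \<le> 1" using yc n by (simp add: divide_le_eq)
  have ycnk: "y / n * ?c ^ Suc k \<le> 1" for k
  proof -
    have "y / n * ?c ^ Suc k = (y / n * ?c) * ?c ^ k" by simp
    also have "\<dots> \<le> 1 * 1" using ycn ck by (intro mult_mono) auto
    finally show ?thesis by simp
  qed
  have hc: "reg_power p \<epsilon> y / n * ?c ^ Suc k \<le> ?B" for k
  proof -
    have "reg_power p \<epsilon> y / n * ?c ^ Suc k \<le> ?B * y / n * ?c ^ Suc k"
      using hb n by (intro mult_right_mono divide_right_mono ck) auto
    also have "\<dots> = ?B * (y / n * ?c ^ Suc k)" by simp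
    also have "\<dots> \<le> ?B * 1" using ycnk B by (intro mult_left_mono) auto
    finally show ?thesis by simp
  qed
  show "0 \<le> cut_power p \<epsilon> n y" unfolding cut_power_def by (intro mult_nonneg_nonneg hb ck)
  have "reg_power p \<epsilon> y * ?c ^ 3 \<le> (?B * y) * 1" using y by (intro mult_mono hb ck) auto
  then show "cut_power p \<epsilon> n y \<le> ?B * y" by (simp add: cut_power_def)
  show "n \<le> y \<Longrightarrow> cut_power p \<epsilon> n y = 0" using n by (simp add: cut_power_def ramp_bounds(3))
  have h1c: "0 \<le> reg_power1 p \<epsilon> y * ?c ^ k" "reg_power1 p \<epsilon> y * ?c ^ k \<le> (1 + p) * ?B" for k
    using hb ck mult_mono[OF hb(5) ck(2)[of k]] p by auto
  have h0c: "0 \<le> reg_power p \<epsilon> y / n * ?c ^ k" for k using hb ck n by simp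
  have "\<bar>cut_power1 p \<epsilon> n y\<bar> = \<bar>reg_power1 p \<epsilon> y * ?c ^ 3 - 3 * (reg_power p \<epsilon> y / n * ?c ^ Suc 1)\<bar>"
    by (simp add: cut_power1_def numeral_2_eq_2)
  also have "\<dots> \<le> (1 + p) * ?B + 3 * ?B" using h1c[of 3] h0c[of "Suc 1"] hc[of 1] by linarith
  also have "\<dots> \<le> C"
  proof -
    have "(1 + p) + 3 \<le> (p + 1) * (p + 6) + 6"
      using p mult_nonneg_nonneg[of p p] by (simp add: algebra_simps)
    from mult_left_mono[OF this B] show ?thesis by (simp add: C algebra_simps)
  qed
  finally show "\<bar>cut_power1 p \<epsilon> n y\<bar> \<le> C" .
  have t1: "0 \<le> y * reg_power2 p \<epsilon> y * ?c ^ 3" "y * reg_power2 p \<epsilon> y * ?c ^ 3 \<le> p * (p + 1) * ?B"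
  proof -
    show "0 \<le> y * reg_power2 p \<epsilon> y * ?c ^ 3" using y by (intro mult_nonneg_nonneg hb ck) auto
    have "y * reg_power2 p \<epsilon> y * ?c ^ 3 \<le> p * (p + 1) * ?B * 1"
      using p y by (intro mult_mono hb ck mult_nonneg_nonneg) auto
    then show "y * reg_power2 p \<epsilon> y * ?c ^ 3 \<le> p * (p + 1) * ?B" by simp
  qed
  have t2: "0 \<le> reg_power1 p \<epsilon> y * (y / n * ?c ^ Suc 1)" "reg_power1 p \<epsilon> y * (y / n * ?c ^ Suc 1) \<le> (1 + p) * ?B"
  proof -
    show "0 \<le> reg_power1 p \<epsilon> y * (y / n * ?c ^ Suc 1)" using hb ck[of "Suc 1"] y n by (intro mult_nonneg_nonneg divide_nonneg_nonneg) auto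
    have "reg_power1 p \<epsilon> y * (y / n * ?c ^ Suc 1) \<le> (1 + p) * ?B * 1"
      using hb(4,5) ycnk[of 1] ck[of "Suc 1"] y n p B
      by (intro mult_mono mult_nonneg_nonneg divide_nonneg_nonneg) auto
    then show "reg_power1 p \<epsilon> y * (y / n * ?c ^ Suc 1) \<le> (1 + p) * ?B" by simp
  qed
  have t3: "0 \<le> reg_power p \<epsilon> y / n * (y / n * ?c)" "reg_power p \<epsilon> y / n * (y / n * ?c) \<le> ?B"
  proof -
    show "0 \<le> reg_power p \<epsilon> y / n * (y / n * ?c)" using hb c y n by simp
    show "reg_power p \<epsilon> y / n * (y / n * ?c) \<le> ?B"
    proof (cases "y \<le> n")
      case True
      have "reg_power p \<epsilon> y \<le> ?B * n" using hb(2) True B by (meson mult_left_mono order_trans)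
      then have "reg_power p \<epsilon> y / n \<le> ?B" using n by (simp add: divide_le_eq)
      then have "reg_power p \<epsilon> y / n * (y / n * ?c) \<le> ?B * 1"
        using ycn y n c hb by (intro mult_mono) auto
      then show ?thesis by simp
    next
      case False
      then show ?thesis using n B by (simp add: ramp_bounds(3))
    qed
  qed
  have "y * \<bar>cut_power2 p \<epsilon> n y\<bar> = \<bar>y * cut_power2 p \<epsilon> n y\<bar>" using y by (simp add: abs_mult)
  also have "y * cut_power2 p \<epsilon> n y = y * reg_power2 p \<epsilon> y * ?c ^ 3 - 6 * (reg_power1 p \<epsilon> y * (y / n * ?c ^ Suc 1))
      + 6 * (reg_power p \<epsilon> y / n * (y / n * ?c))"
    using n by (simp add: cut_power2_def power2_eq_square field_simps)
  also have "\<bar>\<dots>\<bar> \<le> p * (p + 1) * ?B + 6 * ((1 + p) * ?B) + 6 * ?B"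
    using t1 t2 t3 by linarith
  also have "\<dots> = C" by (simp add: C algebra_simps)
  finally show "y * \<bar>cut_power2 p \<epsilon> n y\<bar> \<le> C" .
qed

lemma cut_power_tendsto:
  shows "(\<lambda>n. cut_power p \<epsilon> (real (Suc n)) y) \<longlonglongrightarrow> reg_power p \<epsilon> y"
    "(\<lambda>n. cut_power1 p \<epsilon> (real (Suc n)) y) \<longlonglongrightarrow> reg_power1 p \<epsilon> y"
    "(\<lambda>n. cut_power2 p \<epsilon> (real (Suc n)) y) \<longlonglongrightarrow> reg_power2 p \<epsilon> y"
proof -
  have inv: "(\<lambda>n. k / real (Suc n)) \<longlonglongrightarrow> 0" for k
    using tendsto_mult[OF tendsto_const[of k] LIMSEQ_inverse_real_of_nat] by (simp add: divide_inverse)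
  have "(\<lambda>n. max 0 (1 - y / real (Suc n))) \<longlonglongrightarrow> max 0 (1 - 0)"
    by (intro tendsto_intros inv)
  then have c: "(\<lambda>n. ramp (real (Suc n)) y) \<longlonglongrightarrow> 1" by (simp add: ramp_def)
  have inv2: "(\<lambda>n. k / (real (Suc n))\<^sup>2) \<longlonglongrightarrow> 0" for k
    using tendsto_mult[OF inv[of k] inv[of 1]] by (simp add: power2_eq_square)
  have "(\<lambda>n. cut_power p \<epsilon> (real (Suc n)) y) \<longlonglongrightarrow> reg_power p \<epsilon> y * 1 ^ 3"
    unfolding cut_power_def by (intro tendsto_intros c)
  then show "(\<lambda>n. cut_power p \<epsilon> (real (Suc n)) y) \<longlonglongrightarrow> reg_power p \<epsilon> y" by simp
  have "(\<lambda>n. cut_power1 p \<epsilon> (real (Suc n)) y) \<longlonglongrightarrow> reg_power1 p \<epsilon> y * 1 ^ 3 - 0 * (reg_power p \<epsilon> y * 1 ^ 2)"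
    unfolding cut_power1_def by (intro tendsto_intros c inv)
  then show "(\<lambda>n. cut_power1 p \<epsilon> (real (Suc n)) y) \<longlonglongrightarrow> reg_power1 p \<epsilon> y" by simp
  have "(\<lambda>n. cut_power2 p \<epsilon> (real (Suc n)) y) \<longlonglongrightarrow> reg_power2 p \<epsilon> y * 1 ^ 3 - 0 * (reg_power1 p \<epsilon> y * 1 ^ 2) + 0 * (reg_power p \<epsilon> y * 1)"
    unfolding cut_power2_def by (intro tendsto_intros c inv inv2)
  then show "(\<lambda>n. cut_power2 p \<epsilon> (real (Suc n)) y) \<longlonglongrightarrow> reg_power2 p \<epsilon> y" by simp
qed

end

section \<open>Integrating the weak form in time and velocity\<close>

lemma landau_measurable [measurable]:
  assumes [measurable]: "\<psi> \<in> borel_measurable borel"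
  shows "landau_a \<psi> i j \<in> borel_measurable borel" "landau_b \<psi> i \<in> borel_measurable borel"
  unfolding landau_a_def[abs_def] landau_b_def[abs_def] by measurable

lemma radial_measurable [measurable]:
  assumes [measurable]: "g1 \<in> borel_measurable borel" "g2 \<in> borel_measurable borel"
  shows "radial_hess g1 g2 i j \<in> borel_measurable borel" "radial_grad g1 i \<in> borel_measurable borel"
  unfolding radial_hess_def[abs_def] radial_grad_def[abs_def] by measurable

lemma landau_op_measurable [measurable]:
  assumes [measurable]: "\<psi> \<in> borel_measurable borel" "g1 \<in> borel_measurable borel" "g2 \<in> borel_measurable borel"
  shows "(\<lambda>x. landau_op \<psi> g1 g2 (fst x) (snd x)) \<in> borel_measurable (borel \<Otimes>\<^sub>M borel)"
  unfolding landau_op_def by measurable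

lemma abs_landau_a_le:
  assumes "0 \<le> \<psi> (norm z)"
  shows "\<bar>landau_a \<psi> i j z\<bar> \<le> 2 * \<psi> (norm z)"
proof -
  have "\<bar>z $ i * z $ j\<bar> \<le> (norm z)\<^sup>2"
    unfolding abs_mult power2_eq_square by (intro mult_mono component_le_norm_cart) auto
  then have "\<bar>z $ i * z $ j / (norm z)\<^sup>2\<bar> \<le> 1"
    by (cases "z = 0") (auto simp: divide_le_eq)
  moreover have "\<bar>(if c then 1 else 0) - x\<bar> \<le> 2" if "\<bar>x\<bar> \<le> 1" for c and x :: real
    using that by auto
  ultimately have "\<bar>(if i = j then 1 else 0) - z $ i * z $ j / (norm z)\<^sup>2\<bar> \<le> 2" by blast
  from mult_right_mono[OF this assms] show ?thesis
    using assms by (simp add: landau_a_def abs_mult)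
qed

text \<open>
  The drift is as singular as \<open>\<psi> (norm z) / norm z\<close>; the factor \<open>norm z\<close> is supplied by the Lipschitz bound on
  the gradient of the test function.
\<close>

lemma abs_landau_b_le:
  fixes z :: "real^'n::finite"
  assumes "0 \<le> \<psi> (norm z)"
  shows "\<bar>landau_b \<psi> i z\<bar> * norm z \<le> real CARD('n) * \<psi> (norm z)"
proof -
  have N: "1 \<le> real CARD('n)" by (simp add: Suc_le_eq)
  have "\<bar>z $ i\<bar> * norm z \<le> norm z * norm z" by (intro mult_right_mono component_le_norm_cart) auto
  then have 1: "\<bar>z $ i\<bar> * norm z / (norm z)\<^sup>2 \<le> 1"
    by (cases "z = 0") (auto simp: divide_le_eq power2_eq_square)
  have "\<bar>landau_b \<psi> i z\<bar> * norm z = (real CARD('n) - 1) * \<psi> (norm z) * (\<bar>z $ i\<bar> * norm z / (norm z)\<^sup>2)"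
    using N assms by (simp add: landau_b_def abs_mult)
  also have "\<dots> \<le> (real CARD('n) - 1) * \<psi> (norm z) * 1"
    using N assms 1 by (intro mult_left_mono) auto
  also have "\<dots> \<le> real CARD('n) * \<psi> (norm z)" using assms by (simp add: mult_right_mono)
  finally show ?thesis .
qed

text \<open>
  Borel data extracted from a weak solution: \<open>F\<close> and \<open>\<psi>\<close> are representatives of the solution and of the kernel,
  \<open>E\<close> is mass plus twice the energy, \<open>Qt t\<close> is the weighted \<open>L^q\<close> integral of the time slice \<open>t\<close> before taking
  the root, and \<open>A\<close> is the time integral of its root. The value of \<open>\<psi>\<close> at \<open>0\<close> is chosen to be \<open>0\<close>, so that all
  pointwise estimates hold on the diagonal as well.
\<close>

locale landau_data =
  fixes T K q s m C0 E A :: real and \<psi> :: "real \<Rightarrow> real" and F :: "real \<times> (real^'n::finite) \<Rightarrow> real"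
    and Qt :: "real \<Rightarrow> real"
  assumes F_meas [measurable]: "F \<in> borel_measurable borel" and F0: "\<And>x. 0 \<le> F x"
    and \<psi>_meas [measurable]: "\<psi> \<in> borel_measurable borel" and \<psi>0: "\<And>r. 0 \<le> \<psi> r"
    and \<psi>z: "\<psi> 0 = 0"
    and \<psi>_far: "\<And>r. 1 \<le> r \<Longrightarrow> \<psi> r \<le> K * r\<^sup>2"
    and \<psi>_near: "\<And>r. 0 < r \<Longrightarrow> r < 1 \<Longrightarrow> \<psi> r \<le> K * r powr (-s)"
    and K: "K > 0"
    and q: "q > 1" and s: "s > 0" and m: "m \<ge> 1" and ms: "(m + 1) * s < 2 * (real CARD('n) * (1 - 1 / q))"
    and C0: "C0 = singular_constant TYPE('n) q s m"
    and E0: "0 \<le> E"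
    and Qt_meas [measurable]: "Qt \<in> borel_measurable borel" and Qt0: "\<And>t. 0 \<le> Qt t"
    and slices: "AE t in lborel. t \<in> {0..T} \<longrightarrow>
        (\<integral>\<^sup>+w. ennreal (F (t, w) * bracket2 w) \<partial>lborel) = ennreal E \<and>
        (\<integral>\<^sup>+w. ennreal (F (t, w) powr q * bracket2 w powr (q * (-m))) \<partial>lborel) = ennreal (Qt t)"
    and QA: "(\<integral>\<^sup>+t\<in>{0..T}. ennreal (Qt t powr (1 / q)) \<partial>lborel) = ennreal A" and A0: "0 \<le> A" and T0: "0 < T"
begin

lemma C0_nonneg: "0 \<le> C0" unfolding C0 singular_constant_def by simp

text \<open>
  The factor in front of the integral of \<open>F (t, v) * h v\<close> in \<open>pair_weight_double_integral\<close>.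
\<close>

definition rate :: "real \<Rightarrow> real" where
  "rate t = (1 + C0) * (E + Qt t powr (1 / q))"

lemma rate_nonneg: "0 \<le> rate t"
  using C0_nonneg E0 by (simp add: rate_def)

lemma rate_measurable [measurable]: "rate \<in> borel_measurable borel"
  unfolding rate_def[abs_def] by measurable

lemma rate_nn_integral: "(\<integral>\<^sup>+t\<in>{0..T}. ennreal (rate t) \<partial>lborel) = ennreal ((1 + C0) * (E * T + A))"
proof -
  have "(\<integral>\<^sup>+t\<in>{0..T}. ennreal (rate t) \<partial>lborel) =
     (\<integral>\<^sup>+t. ennreal (1 + C0) * (ennreal E * indicator {0..T} t + ennreal (Qt t powr (1 / q)) * indicator {0..T} t) \<partial>lborel)"
    using C0_nonneg E0 by (intro nn_integral_cong) (auto simp: rate_def indicator_def ennreal_mult)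
  also have "\<dots> = ennreal (1 + C0) * (ennreal E * ennreal T + ennreal A)"
    using T0 by (subst nn_integral_cmult) (auto simp: nn_integral_add nn_integral_cmult QA)
  also have "\<dots> = ennreal ((1 + C0) * (E * T + A))"
    using C0_nonneg E0 A0 T0 by (simp add: ennreal_mult)
  finally show ?thesis .
qed

lemma rate_integrable_on: "0 \<le> t1 \<Longrightarrow> t2 \<le> T \<Longrightarrow> rate integrable_on {t1..t2}"
proof -
  assume t: "0 \<le> t1" "t2 \<le> T"
  have "set_integrable lborel {0..T} rate"
    unfolding set_integrable_def
  proof (rule integrableI_bounded)
    have "(\<integral>\<^sup>+x. ennreal (norm (indicat_real {0..T} x *\<^sub>R rate x)) \<partial>lborel) = (\<integral>\<^sup>+t\<in>{0..T}. ennreal (rate t) \<partial>lborel)"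
      using rate_nonneg by (intro nn_integral_cong) (auto simp: indicator_def)
    then show "(\<integral>\<^sup>+x. ennreal (norm (indicat_real {0..T} x *\<^sub>R rate x)) \<partial>lborel) < \<infinity>"
      by (simp add: rate_nn_integral)
  qed measurable
  then have "rate integrable_on {0..T}" by (rule set_borel_integral_eq_integral)
  then show ?thesis by (rule integrable_on_subinterval) (use t in auto)
qed

lemma rate_nn_integral_eq:
  assumes "0 \<le> t1" "t2 \<le> T"
  shows "(\<integral>\<^sup>+t\<in>{t1..t2}. ennreal (rate t) \<partial>lborel) = ennreal (integral {t1..t2} rate)"
proof -
  have "(\<integral>\<^sup>+t\<in>{t1..t2}. ennreal (rate t) \<partial>lborel) = (\<integral>\<^sup>+t. ennreal (indicator {t1..t2} t * rate t) \<partial>lborel)"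
    by (intro nn_integral_cong) (auto simp: indicator_def)
  also have "\<dots> = ennreal (integral {t1..t2} rate)"
    using rate_nonneg rate_integrable_on[OF assms]
    by (intro nn_integral_has_integral_lebesgue integrable_integral) auto
  finally show ?thesis .
qed

lemma rate_integral: "integral {0..T} rate = (1 + C0) * (E * T + A)"
proof -
  have "0 \<le> integral {0..T} rate"
    using rate_nonneg by (intro Henstock_Kurzweil_Integration.integral_nonneg rate_integrable_on) auto
  then show ?thesis
    using rate_nn_integral rate_nn_integral_eq[of 0 T] C0_nonneg E0 A0 T0 by (simp add: ennreal_inj)
qed

definition pair_density :: "real \<times> (real^'n) \<times> (real^'n) \<Rightarrow> real" where
  "pair_density y = F (fst y, fst (snd y)) * F (fst y, snd (snd y))"

lemma pair_density_nonneg: "0 \<le> pair_density y" using F0 by (simp add: pair_density_def)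

lemma pair_density_measurable [measurable]: "pair_density \<in> borel_measurable (borel \<Otimes>\<^sub>M (borel \<Otimes>\<^sub>M borel))"
  unfolding pair_density_def[abs_def] by measurable

lemma time_space_nn_integral:
  assumes [measurable]: "R \<in> borel_measurable (borel \<Otimes>\<^sub>M borel)"
  shows "(\<integral>\<^sup>+y. ennreal (indicator {t1..t2} (fst y) * (pair_density y * R (snd y))) \<partial>lborel)
    = (\<integral>\<^sup>+t\<in>{t1..t2}. (\<integral>\<^sup>+x. ennreal (F (t, fst x) * F (t, snd x) * R x) \<partial>lborel) \<partial>lborel)"
proof -
  have "(\<lambda>y. ennreal (indicator {t1..t2} (fst y) * (pair_density y * R (snd y)))) \<in> borel_measurable (borel \<Otimes>\<^sub>M (borel \<Otimes>\<^sub>M borel))"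
    by measurable
  then have *: "(\<lambda>y. ennreal (indicator {t1..t2} (fst y) * (pair_density y * R (snd y)))) \<in> borel_measurable (lborel \<Otimes>\<^sub>M lborel)"
    by (simp add: borel_prod lborel_prod)
  show ?thesis
    unfolding lborel_prod[symmetric, where 'a = real]
    by (subst lborel.nn_integral_fst[OF *, symmetric])
      (auto intro!: nn_integral_cong simp: pair_density_def indicator_def)
qed

lemma pair_weight_time_bound:
  assumes h[measurable]: "h \<in> borel_measurable borel" and h0: "\<And>v. 0 \<le> h v" and t: "0 \<le> t1" "t2 \<le> T"
    and S: "0 \<le> S" and hS: "AE t in lborel. t \<in> {t1..t2} \<longrightarrow> (\<integral>\<^sup>+v. ennreal (F (t, v) * h v) \<partial>lborel) \<le> ennreal S"
  shows "(\<integral>\<^sup>+y. ennreal (indicator {t1..t2} (fst y) * (pair_density y * pair_weight s h (fst (snd y)) (snd (snd y)))) \<partial>lborel)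
      \<le> ennreal (S * integral {t1..t2} rate)" (is "?thesis1")
    and "(\<integral>\<^sup>+y. ennreal (indicator {t1..t2} (fst y) * (pair_density y * pair_weight s h (snd (snd y)) (fst (snd y)))) \<partial>lborel)
      \<le> ennreal (S * integral {t1..t2} rate)" (is "?thesis2")
proof -
  have *: "(\<integral>\<^sup>+y. ennreal (indicator {t1..t2} (fst y) * (pair_density y * R (snd y))) \<partial>lborel)
      \<le> ennreal (S * integral {t1..t2} rate)"
    if R[measurable]: "R \<in> borel_measurable (borel \<Otimes>\<^sub>M borel)"
      and RW: "\<And>t. (\<integral>\<^sup>+w. ennreal (F (t, w) * bracket2 w) \<partial>lborel) = ennreal E \<Longrightarrow>
        (\<integral>\<^sup>+w. ennreal (F (t, w) powr q * bracket2 w powr (q * (-m))) \<partial>lborel) = ennreal (Qt t) \<Longrightarrow>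
        (\<integral>\<^sup>+x. ennreal (F (t, fst x) * F (t, snd x) * R x) \<partial>lborel)
          \<le> ennreal ((1 + C0) * (E + Qt t powr (1 / q))) * (\<integral>\<^sup>+v. ennreal (F (t, v) * h v) \<partial>lborel)"
    for R
  proof -
    have "(\<integral>\<^sup>+t\<in>{t1..t2}. (\<integral>\<^sup>+x. ennreal (F (t, fst x) * F (t, snd x) * R x) \<partial>lborel) \<partial>lborel)
       \<le> (\<integral>\<^sup>+t. ennreal S * (ennreal (rate t) * indicator {t1..t2} t) \<partial>lborel)"
    proof (rule nn_integral_mono_AE)
      show "AE t in lborel. (\<integral>\<^sup>+x. ennreal (F (t, fst x) * F (t, snd x) * R x) \<partial>lborel) * indicator {t1..t2} t
          \<le> ennreal S * (ennreal (rate t) * indicator {t1..t2} t)"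
        using slices hS
      proof eventually_elim
        case (elim t)
        show ?case
        proof (cases "t \<in> {t1..t2}")
          case True
          then have "t \<in> {0..T}" using t by auto
          then have "(\<integral>\<^sup>+x. ennreal (F (t, fst x) * F (t, snd x) * R x) \<partial>lborel)
             \<le> ennreal (rate t) * (\<integral>\<^sup>+v. ennreal (F (t, v) * h v) \<partial>lborel)"
            unfolding rate_def using elim by (intro RW) auto
          also have "\<dots> \<le> ennreal (rate t) * ennreal S" using elim True by (intro mult_left_mono) auto
          finally show ?thesis using True by (simp add: mult.commute)
        qed simp
      qed
    qed
    also have "\<dots> = ennreal S * ennreal (integral {t1..t2} rate)"
      by (subst nn_integral_cmult) (auto simp: rate_nn_integral_eq[OF t])
    also have "\<dots> = ennreal (S * integral {t1..t2} rate)" using S by (simp add: ennreal_mult')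
    finally show ?thesis unfolding time_space_nn_integral[OF R] .
  qed
  have Ft: "(\<lambda>w. F (t, w)) \<in> borel_measurable borel" for t by measurable
  show ?thesis1
    by (rule *[of "\<lambda>x. pair_weight s h (fst x) (snd x)"], measurable)
      (rule pair_weight_double_integral(1)[OF Ft F0 h h0 q s m ms _ E0 _ Qt0 C0])
  show ?thesis2
    by (rule *[of "\<lambda>x. pair_weight s h (snd x) (fst x)"], measurable)
      (rule pair_weight_double_integral(2)[OF Ft F0 h h0 q s m ms _ E0 _ Qt0 C0])
qed

text \<open>
  An integrable function on time and pairs of velocities that dominates, up to a constant, every term of the weak
  form when \<open>g1 y\<close> and \<open>y * g2 y\<close> are bounded.
\<close>

definition dominant :: "real \<times> (real^'n) \<times> (real^'n) \<Rightarrow> real" where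
  "dominant y = indicator {0..T} (fst y) * (pair_density y * pair_weight s bracket2 (fst (snd y)) (snd (snd y)))"

lemma borel_triple: "h \<in> borel_measurable (borel \<Otimes>\<^sub>M (borel \<Otimes>\<^sub>M borel)) \<Longrightarrow>
   h \<in> borel_measurable (lborel :: (real \<times> (real^'n) \<times> (real^'n)) measure)"
  by (simp add: borel_prod)

text \<open>
  The case \<open>h = bracket2\<close> of \<open>pair_weight_time_bound\<close>, where the integral of \<open>F (t, v) * h v\<close> is \<open>E\<close>.
\<close>

lemma dominant_integrable: "integrable lborel dominant"
proof (rule integrableI_bounded)
  show "dominant \<in> borel_measurable lborel"
    unfolding dominant_def[abs_def] by (rule borel_triple) measurable
  have "AE t in lborel. t \<in> {0..T} \<longrightarrow> (\<integral>\<^sup>+v. ennreal (F (t, v) * bracket2 v) \<partial>lborel) \<le> ennreal E"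
    using slices by eventually_elim auto
  then have "(\<integral>\<^sup>+y. ennreal (dominant y) \<partial>lborel) \<le> ennreal (E * integral {0..T} rate)"
    unfolding dominant_def by (intro pair_weight_time_bound) (auto simp: E0)
  moreover have "norm (dominant y) = dominant y" for y
    unfolding dominant_def real_norm_def
    by (intro abs_of_nonneg mult_nonneg_nonneg pair_density_nonneg pair_weight_nonneg) auto
  ultimately show "(\<integral>\<^sup>+y. ennreal (norm (dominant y)) \<partial>lborel) < \<infinity>"
    by (simp add: le_less_trans)
qed

lemma \<psi>_le_pair_weight: "\<psi> (norm (v - w)) \<le> 2 * K * pair_weight s bracket2 v w"
proof (cases "v = w")
  case True
  have "0 \<le> pair_weight s bracket2 w w" by (rule pair_weight_nonneg) simp
  then show ?thesis using True \<psi>z K by simp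
next
  case False
  then show ?thesis by (intro kernel_le_pair_weight \<psi>_far \<psi>_near K) auto
qed

lemma term_integrable:
  assumes R[measurable]: "R \<in> borel_measurable (borel \<Otimes>\<^sub>M borel)" and t: "0 \<le> t1" "t2 \<le> T"
    and c: "\<And>v w. \<bar>R (v, w)\<bar> \<le> c * pair_weight s bracket2 v w"
  shows "integrable lborel (\<lambda>y. indicator {t1..t2} (fst y) * (pair_density y * R (snd y)))"
    and "\<bar>indicator {t1..t2} (fst y) * (pair_density y * R (snd y))\<bar> \<le> c * dominant y"
proof -
  have b: "\<bar>indicator {t1..t2} (fst y) * (pair_density y * R (snd y))\<bar> \<le> c * dominant y" for y
  proof (cases "fst y \<in> {t1..t2}")
    case True
    then have "fst y \<in> {0..T}" using t by auto
    moreover have "pair_density y * \<bar>R (snd y)\<bar> \<le> pair_density y * (c * pair_weight s bracket2 (fst (snd y)) (snd (snd y)))"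
      using c[of "fst (snd y)" "snd (snd y)"] pair_density_nonneg by (intro mult_left_mono) auto
    ultimately show ?thesis using True pair_density_nonneg by (simp add: dominant_def abs_mult mult_ac)
  next
    case False
    have "0 \<le> c * pair_weight s bracket2 (fst (snd y)) (snd (snd y))" using c order_trans abs_ge_zero by blast
    then have "0 \<le> c * dominant y"
      using pair_density_nonneg[of y] by (auto simp: dominant_def indicator_def mult.left_commute[of c])
    then show ?thesis using False by simp
  qed
  show "\<bar>indicator {t1..t2} (fst y) * (pair_density y * R (snd y))\<bar> \<le> c * dominant y" by (rule b)
  show "integrable lborel (\<lambda>y. indicator {t1..t2} (fst y) * (pair_density y * R (snd y)))"
  proof (rule Bochner_Integration.integrable_bound)
    show "integrable lborel (\<lambda>y. c * dominant y)" using dominant_integrable by simp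
    show "(\<lambda>y. indicator {t1..t2} (fst y) * (pair_density y * R (snd y))) \<in> borel_measurable lborel"
      by (rule borel_triple) measurable
    show "AE y in lborel. norm (indicator {t1..t2} (fst y) * (pair_density y * R (snd y))) \<le> norm (c * dominant y)"
      using b by (intro AE_I2) (smt (verit) real_norm_def)
  qed
qed

text \<open>
  Turns one iterated Lebesgue integral of the weak form into a single integral of a Borel function. Here \<open>a\<close> stands
  for a coefficient of the given kernel, \<open>a'\<close> for its Borel version and \<open>b\<close> for the derivatives of the test
  function.
\<close>

lemma term_integral:
  fixes f :: "real \<Rightarrow> real^'n \<Rightarrow> real"
  assumes f: "AE t in lborel. t \<in> {0..T} \<longrightarrow> (AE v in lborel. f t v = F (t, v))"
    and a'[measurable]: "a' \<in> borel_measurable borel" and a: "AE z in lborel. a z = a' z"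
    and b[measurable]: "b \<in> borel_measurable (borel \<Otimes>\<^sub>M borel)" and t: "0 \<le> t1" "t2 \<le> T"
    and c: "\<And>v w. \<bar>a' (v - w) * b (v, w)\<bar> \<le> c * pair_weight s bracket2 v w"
  shows "(LINT r:{t1..t2}|lebesgue. (\<integral>(v, w). f r v * f r w * a (v - w) * b (v, w) \<partial>lebesgue))
    = (\<integral>y. indicator {t1..t2} (fst y) * (pair_density y * (a' (fst (snd y) - snd (snd y)) * b (snd y))) \<partial>lborel)"
proof -
  let ?R = "\<lambda>x. a' (fst x - snd x) * b x"
  have R[measurable]: "?R \<in> borel_measurable (borel \<Otimes>\<^sub>M borel)" by measurable
  let ?G = "\<lambda>y. indicator {t1..t2} (fst y) * (pair_density y * ?R (snd y))"
  have int: "integrable (lborel \<Otimes>\<^sub>M lborel) ?G"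
    using term_integrable(1)[OF R t, of c] c by (simp add: lborel_prod)
  have inner: "(\<integral>(v, w). f r v * f r w * a (v - w) * b (v, w) \<partial>lebesgue)
      = (\<integral>x. F (r, fst x) * F (r, snd x) * ?R x \<partial>lborel)"
    if fr: "AE v in lborel. f r v = F (r, v)" for r
  proof (rule integral_lebesgue_AE_borel)
    have "(\<lambda>x. F (r, fst x) * F (r, snd x) * ?R x) \<in> borel_measurable (borel \<Otimes>\<^sub>M borel)" by measurable
    then show "(\<lambda>x. F (r, fst x) * F (r, snd x) * ?R x) \<in> borel_measurable lborel" by (simp add: borel_prod)
    show "AE x in lborel. (case x of (v, w) \<Rightarrow> f r v * f r w * a (v - w) * b (v, w)) = F (r, fst x) * F (r, snd x) * ?R x"
      using AE_pair_both[OF fr] AE_diff_pair[OF a] by eventually_elim (auto simp: case_prod_beta)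
  qed
  have "(LINT r:{t1..t2}|lebesgue. (\<integral>(v, w). f r v * f r w * a (v - w) * b (v, w) \<partial>lebesgue))
     = (\<integral>r. (\<integral>x. ?G (r, x) \<partial>lborel) \<partial>lborel)"
    unfolding set_lebesgue_integral_def
  proof (rule integral_lebesgue_AE_borel)
    show "(\<lambda>r. (\<integral>x. ?G (r, x) \<partial>lborel)) \<in> borel_measurable lborel"
      using lborel_pair.integrable_fst'[OF int] by (rule borel_measurable_integrable)
    show "AE r in lborel. indicat_real {t1..t2} r *\<^sub>R (\<integral>(v, w). f r v * f r w * a (v - w) * b (v, w) \<partial>lebesgue)
        = (\<integral>x. ?G (r, x) \<partial>lborel)"
      using f
    proof eventually_elim
      case (elim r)
      show ?case
      proof (cases "r \<in> {t1..t2}")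
        case True
        then have "AE v in lborel. f r v = F (r, v)" using elim t by auto
        then show ?thesis using True by (simp add: inner pair_density_def)
      qed simp
    qed
  qed
  also have "\<dots> = (\<integral>y. ?G y \<partial>(lborel \<Otimes>\<^sub>M lborel))" by (rule lborel_pair.integral_fst'[OF int])
  finally show ?thesis by (simp add: lborel_prod)
qed

definition op_integral :: "(real \<Rightarrow> real) \<Rightarrow> (real \<Rightarrow> real) \<Rightarrow> real \<Rightarrow> real \<Rightarrow> real" where
  "op_integral g1 g2 t1 t2 = (\<integral>y. indicator {t1..t2} (fst y) * (pair_density y * landau_op \<psi> g1 g2 (fst (snd y)) (snd (snd y))) \<partial>lborel)"

end

section \<open>The weak form for radial test functions\<close>

lemma abs_sum_le_card:
  fixes x :: "'i::finite \<Rightarrow> real"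
  assumes "\<And>i. \<bar>x i\<bar> \<le> B"
  shows "\<bar>\<Sum>i\<in>UNIV. x i\<bar> \<le> real CARD('i) * B"
proof -
  have "\<bar>\<Sum>i\<in>UNIV. x i\<bar> \<le> (\<Sum>i\<in>UNIV. \<bar>x i\<bar>)" by (rule sum_abs)
  also have "\<dots> \<le> real CARD('i) * B" using sum_bounded_above[of UNIV "\<lambda>i. \<bar>x i\<bar>" B] assms by simp
  finally show ?thesis .
qed

context landau_data
begin

lemma hess_term_bound:
  fixes v w :: "real^'n"
  assumes "radial_C2 g g1 g2" and b: "\<And>y. 1 \<le> y \<Longrightarrow> \<bar>g1 y\<bar> \<le> C" "\<And>y. 1 \<le> y \<Longrightarrow> y * \<bar>g2 y\<bar> \<le> C"
  shows "\<bar>landau_a \<psi> i j (v - w) * (radial_hess g1 g2 i j v + radial_hess g1 g2 i j w)\<bar> \<le> (48 * K * C) * pair_weight s bracket2 v w"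
proof -
  interpret radial_C2 g g1 g2 by fact
  have C: "0 \<le> C" using b(1)[of 1] by auto
  have "\<bar>radial_hess g1 g2 i j v + radial_hess g1 g2 i j w\<bar> \<le> 12 * C"
    using hess_bound[OF b, of i j v] hess_bound[OF b, of i j w] by linarith
  then have "\<bar>landau_a \<psi> i j (v - w) * (radial_hess g1 g2 i j v + radial_hess g1 g2 i j w)\<bar>
     \<le> (2 * \<psi> (norm (v - w))) * (12 * C)"
    unfolding abs_mult using \<psi>0 by (intro mult_mono abs_landau_a_le) auto
  also have "\<dots> \<le> (2 * (2 * K * pair_weight s bracket2 v w)) * (12 * C)"
    using C by (intro mult_right_mono mult_left_mono \<psi>_le_pair_weight) auto
  finally show ?thesis by (simp add: mult_ac)
qed

lemma grad_term_bound:
  fixes v w :: "real^'n"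
  assumes "radial_C2 g g1 g2" and b: "\<And>y. 1 \<le> y \<Longrightarrow> \<bar>g1 y\<bar> \<le> C" "\<And>y. 1 \<le> y \<Longrightarrow> y * \<bar>g2 y\<bar> \<le> C"
  shows "\<bar>landau_b \<psi> i (v - w) * (radial_grad g1 i v - radial_grad g1 i w)\<bar> \<le> (12 * real CARD('n) * K * C) * pair_weight s bracket2 v w"
proof -
  interpret radial_C2 g g1 g2 by fact
  have C: "0 \<le> C" using b(1)[of 1] by auto
  have "\<bar>landau_b \<psi> i (v - w) * (radial_grad g1 i v - radial_grad g1 i w)\<bar>
     \<le> \<bar>landau_b \<psi> i (v - w)\<bar> * (6 * C * norm (v - w))"
    unfolding abs_mult by (intro mult_left_mono grad_lipschitz[OF b]) auto
  also have "\<dots> = 6 * C * (\<bar>landau_b \<psi> i (v - w)\<bar> * norm (v - w))" by simp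
  also have "\<dots> \<le> 6 * C * (real CARD('n) * \<psi> (norm (v - w)))"
    using C by (intro mult_left_mono abs_landau_b_le[of \<psi> "v - w" i, OF \<psi>0]) auto
  also have "\<dots> \<le> 6 * C * (real CARD('n) * (2 * K * pair_weight s bracket2 v w))"
    using C by (intro mult_left_mono \<psi>_le_pair_weight) auto
  finally show ?thesis by (simp add: mult_ac)
qed

lemma op_bound:
  fixes v w :: "real^'n"
  assumes "radial_C2 g g1 g2" and b: "\<And>y. 1 \<le> y \<Longrightarrow> \<bar>g1 y\<bar> \<le> C" "\<And>y. 1 \<le> y \<Longrightarrow> y * \<bar>g2 y\<bar> \<le> C"
  shows "\<bar>landau_op \<psi> g1 g2 v w\<bar> \<le> (36 * (real CARD('n))\<^sup>2 * K * C) * pair_weight s bracket2 v w"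
proof -
  let ?N = "real CARD('n)" and ?W = "pair_weight s bracket2 v w"
  have 1: "\<bar>\<Sum>i\<in>UNIV. \<Sum>j\<in>UNIV. landau_a \<psi> i j (v - w) * (radial_hess g1 g2 i j v + radial_hess g1 g2 i j w)\<bar>
     \<le> ?N * (?N * ((48 * K * C) * ?W))"
    by (rule abs_sum_le_card, rule abs_sum_le_card, rule hess_term_bound[OF assms])
  have 2: "\<bar>\<Sum>i\<in>UNIV. landau_b \<psi> i (v - w) * (radial_grad g1 i v - radial_grad g1 i w)\<bar>
     \<le> ?N * ((12 * ?N * K * C) * ?W)"
    by (rule abs_sum_le_card, rule grad_term_bound[OF assms])
  have eq: "?N * (?N * ((48 * K * C) * ?W)) = 48 * (?N\<^sup>2 * K * C * ?W)"
    "?N * ((12 * ?N * K * C) * ?W) = 12 * (?N\<^sup>2 * K * C * ?W)"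
    "(36 * ?N\<^sup>2 * K * C) * ?W = 36 * (?N\<^sup>2 * K * C * ?W)"
    by (simp_all only: power2_eq_square mult_ac)
  have "\<bar>1 / 2 * a + b\<bar> \<le> 36 * x" if "\<bar>a\<bar> \<le> 48 * x" "\<bar>b\<bar> \<le> 12 * x" for a b x :: real
    using that by linarith
  from this[OF 1[unfolded eq] 2[unfolded eq]] show ?thesis
    unfolding landau_op_def eq .
qed

text \<open>
  Each term of the weak form is dominated by \<open>dominant\<close>, so that the sum of the integrals is the integral of the
  sum, i.e. of \<open>landau_op\<close>.
\<close>

lemma weak_form_op:
  fixes f :: "real \<Rightarrow> real^'n \<Rightarrow> real"
  assumes f: "AE t in lborel. t \<in> {0..T} \<longrightarrow> (AE v in lborel. f t v = F (t, v))"
    and \<psi>': "AE z in (lborel :: (real^'n) measure). \<psi>' (norm z) = \<psi> (norm z)"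
    and wf: "landau_weak_form T \<psi>' f"
    and g: "radial_C2 g g1 g2" and b: "\<And>y. 1 \<le> y \<Longrightarrow> \<bar>g1 y\<bar> \<le> C" "\<And>y. 1 \<le> y \<Longrightarrow> y * \<bar>g2 y\<bar> \<le> C"
    and [measurable]: "g1 \<in> borel_measurable borel" "g2 \<in> borel_measurable borel"
    and van: "\<And>y. n \<le> y \<Longrightarrow> g y = 0"
    and t: "0 \<le> t1" "t1 \<le> t2" "t2 \<le> T"
  shows "(\<integral>v. f t2 v * g (bracket2 v) \<partial>lebesgue) - (\<integral>v. f t1 v * g (bracket2 v) \<partial>lebesgue) = op_integral g1 g2 t1 t2"
proof -
  interpret g: radial_C2 g g1 g2 by fact
  let ?A = "\<lambda>i j x. landau_a \<psi> i j (fst x - snd x) * (radial_hess g1 g2 i j (fst x) + radial_hess g1 g2 i j (snd x))"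
  let ?B = "\<lambda>i x. landau_b \<psi> i (fst x - snd x) * (radial_grad g1 i (fst x) - radial_grad g1 i (snd x))"
  let ?ind = "\<lambda>R y. indicat_real {t1..t2} (fst y) * (pair_density y * R (snd y))"
  have mA[measurable]: "?A i j \<in> borel_measurable (borel \<Otimes>\<^sub>M borel)" for i j by measurable
  have mB[measurable]: "?B i \<in> borel_measurable (borel \<Otimes>\<^sub>M borel)" for i by measurable
  have iA: "integrable lborel (?ind (?A i j))" for i j
    by (rule term_integrable(1)[OF mA t(1,3)], simp only: fst_conv snd_conv, rule hess_term_bound[OF g b])
  have iB: "integrable lborel (?ind (?B i))" for i
    by (rule term_integrable(1)[OF mB t(1,3)], simp only: fst_conv snd_conv, rule grad_term_bound[OF g b])
  have A: "(LINT r:{t1..t2}|lebesgue. (\<integral>(v, w). f r v * f r w * landau_a \<psi>' i j (v - w) *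
                (partial i (partial j (\<lambda>v. g (bracket2 v))) v + partial i (partial j (\<lambda>v. g (bracket2 v))) w) \<partial>lebesgue))
      = (\<integral>y. ?ind (?A i j) y \<partial>lborel)" for i j
  proof -
    have "AE z in lborel. landau_a \<psi>' i j z = landau_a \<psi> i j z"
      using \<psi>' by eventually_elim (simp add: landau_a_def)
    from term_integral[OF f landau_measurable(1)[OF \<psi>_meas] this,
        of "\<lambda>x. radial_hess g1 g2 i j (fst x) + radial_hess g1 g2 i j (snd x)", OF _ t(1,3), of "48 * K * C",
        unfolded fst_conv snd_conv, OF _ hess_term_bound[OF g b]]
    show ?thesis unfolding g.partial_partial_radial by measurable
  qed
  have B: "(LINT r:{t1..t2}|lebesgue. (\<integral>(v, w). f r v * f r w * landau_b \<psi>' i (v - w) *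
                (partial i (\<lambda>v. g (bracket2 v)) v - partial i (\<lambda>v. g (bracket2 v)) w) \<partial>lebesgue))
      = (\<integral>y. ?ind (?B i) y \<partial>lborel)" for i
  proof -
    have "AE z in lborel. landau_b \<psi>' i z = landau_b \<psi> i z"
      using \<psi>' by eventually_elim (simp add: landau_b_def)
    from term_integral[OF f landau_measurable(2)[OF \<psi>_meas] this,
        of "\<lambda>x. radial_grad g1 i (fst x) - radial_grad g1 i (snd x)", OF _ t(1,3), of "12 * real CARD('n) * K * C",
        unfolded fst_conv snd_conv, OF _ grad_term_bound[OF g b]]
    show ?thesis unfolding g.partial_radial by measurable
  qed
  have C2: "(\<lambda>v::real^'n. g (bracket2 v)) \<in> C2c" using van by (rule g.C2c_radial)
  have "(\<integral>v. f t2 v * g (bracket2 v) \<partial>lebesgue) - (\<integral>v. f t1 v * g (bracket2 v) \<partial>lebesgue) =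
     1 / 2 * (\<Sum>i\<in>UNIV. \<Sum>j\<in>UNIV. (\<integral>y. ?ind (?A i j) y \<partial>lborel)) + (\<Sum>i\<in>UNIV. (\<integral>y. ?ind (?B i) y \<partial>lborel))"
    using wf[unfolded landau_weak_form_def, rule_format, OF C2 conjI[OF t(1) conjI[OF t(2,3)]]]
    unfolding A B .
  also have "\<dots> = (\<integral>y. 1 / 2 * (\<Sum>i\<in>UNIV. \<Sum>j\<in>UNIV. ?ind (?A i j) y) + (\<Sum>i\<in>UNIV. ?ind (?B i) y) \<partial>lborel)"
  proof -
    have iA2: "integrable lborel (\<lambda>y. 1 / 2 * (\<Sum>i\<in>UNIV. \<Sum>j\<in>UNIV. ?ind (?A i j) y))"
      by (intro integrable_mult_right Bochner_Integration.integrable_sum iA)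
    have iB2: "integrable lborel (\<lambda>y. \<Sum>i\<in>UNIV. ?ind (?B i) y)"
      by (intro Bochner_Integration.integrable_sum iB)
    have sA: "(\<integral>y. (\<Sum>i\<in>UNIV. \<Sum>j\<in>UNIV. ?ind (?A i j) y) \<partial>lborel)
        = (\<Sum>i\<in>UNIV. \<Sum>j\<in>UNIV. (\<integral>y. ?ind (?A i j) y \<partial>lborel))"
      by (subst Bochner_Integration.integral_sum, intro Bochner_Integration.integrable_sum iA)
        (intro sum.cong refl Bochner_Integration.integral_sum iA)
    have sB: "(\<integral>y. (\<Sum>i\<in>UNIV. ?ind (?B i) y) \<partial>lborel) = (\<Sum>i\<in>UNIV. (\<integral>y. ?ind (?B i) y \<partial>lborel))"
      by (intro Bochner_Integration.integral_sum iB)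
    show ?thesis
      unfolding Bochner_Integration.integral_add[OF iA2 iB2] integral_mult_right_zero sA sB ..
  qed
  also have "\<dots> = op_integral g1 g2 t1 t2"
    unfolding op_integral_def landau_op_def
    by (intro Bochner_Integration.integral_cong refl)
      (simp only: sum_distrib_left distrib_left mult.left_commute[of "1 / 2"])
  finally show ?thesis .
qed

text \<open>
  Lets the weak form pass from compactly supported test functions to functions of linear growth in
  \<open>bracket2\<close>: the uniform bounds on the derivatives provide a multiple of \<open>dominant\<close> as majorant.
\<close>

lemma op_integral_limit:
  assumes g: "\<And>n::nat. radial_C2 (G n) (G1 n) (G2 n)"
    and b: "\<And>n y. 1 \<le> y \<Longrightarrow> \<bar>G1 n y\<bar> \<le> C" "\<And>n y. 1 \<le> y \<Longrightarrow> y * \<bar>G2 n y\<bar> \<le> C"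
    and m [measurable]: "\<And>n. G1 n \<in> borel_measurable borel" "\<And>n. G2 n \<in> borel_measurable borel"
      "g1 \<in> borel_measurable borel" "g2 \<in> borel_measurable borel"
    and lim: "\<And>y. (\<lambda>n. G1 n y) \<longlonglongrightarrow> g1 y" "\<And>y. (\<lambda>n. G2 n y) \<longlonglongrightarrow> g2 y"
    and t: "0 \<le> t1" "t2 \<le> T"
  shows "(\<lambda>n. op_integral (G1 n) (G2 n) t1 t2) \<longlonglongrightarrow> op_integral g1 g2 t1 t2"
  unfolding op_integral_def
proof (rule integral_dominated_convergence)
  let ?c = "36 * (real CARD('n))\<^sup>2 * K * C"
  show "integrable lborel (\<lambda>y. ?c * dominant y)" using dominant_integrable by simp
  show "(\<lambda>y. indicat_real {t1..t2} (fst y) * (pair_density y * landau_op \<psi> g1 g2 (fst (snd y)) (snd (snd y)))) \<in> borel_measurable lborel"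
    by (rule borel_triple) measurable
  show "(\<lambda>y. indicat_real {t1..t2} (fst y) * (pair_density y * landau_op \<psi> (G1 n) (G2 n) (fst (snd y)) (snd (snd y)))) \<in> borel_measurable lborel" for n
    by (rule borel_triple) measurable
  show "AE y in lborel. norm (indicat_real {t1..t2} (fst y) * (pair_density y * landau_op \<psi> (G1 n) (G2 n) (fst (snd y)) (snd (snd y)))) \<le> ?c * dominant y" for n
  proof (rule AE_I2)
    fix y
    have meas: "(\<lambda>x. landau_op \<psi> (G1 n) (G2 n) (fst x) (snd x)) \<in> borel_measurable (borel \<Otimes>\<^sub>M borel)" by measurable
    have "\<bar>landau_op \<psi> (G1 n) (G2 n) (fst (v, w)) (snd (v, w))\<bar> \<le> ?c * pair_weight s bracket2 v w" for v w :: "real^'n"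
      unfolding fst_conv snd_conv by (rule op_bound[OF g b])
    from term_integrable(2)[OF meas t this]
    show "norm (indicat_real {t1..t2} (fst y) * (pair_density y * landau_op \<psi> (G1 n) (G2 n) (fst (snd y)) (snd (snd y)))) \<le> ?c * dominant y"
      by simp
  qed
  show "AE y in lborel. (\<lambda>n. indicat_real {t1..t2} (fst y) * (pair_density y * landau_op \<psi> (G1 n) (G2 n) (fst (snd y)) (snd (snd y))))
     \<longlonglongrightarrow> indicat_real {t1..t2} (fst y) * (pair_density y * landau_op \<psi> g1 g2 (fst (snd y)) (snd (snd y)))"
  proof (rule AE_I2)
    fix y
    have H: "(\<lambda>n. radial_hess (G1 n) (G2 n) i j v) \<longlonglongrightarrow> radial_hess g1 g2 i j v" for i j and v :: "real^'n"
      unfolding radial_hess_def by (cases "i = j") (auto intro!: tendsto_intros lim)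
    have R: "(\<lambda>n. radial_grad (G1 n) i v) \<longlonglongrightarrow> radial_grad g1 i v" for i and v :: "real^'n"
      unfolding radial_grad_def by (intro tendsto_intros lim)
    show "(\<lambda>n. indicat_real {t1..t2} (fst y) * (pair_density y * landau_op \<psi> (G1 n) (G2 n) (fst (snd y)) (snd (snd y))))
     \<longlonglongrightarrow> indicat_real {t1..t2} (fst y) * (pair_density y * landau_op \<psi> g1 g2 (fst (snd y)) (snd (snd y)))"
      unfolding landau_op_def by (intro tendsto_intros H R)
  qed
qed

text \<open>
  The two summands in \<open>landau_op_convex_le\<close> differ by exchanging \<open>v\<close> and \<open>w\<close> and contribute equally.
\<close>

lemma op_integral_convex_le:
  assumes [measurable]: "h \<in> borel_measurable borel"
    and h0: "\<And>v :: real^'n. 0 \<le> h (bracket2 v)" and c0: "0 \<le> c"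
    and mono: "\<And>x y. 1 \<le> x \<Longrightarrow> x \<le> y \<Longrightarrow> g1 x \<le> g1 y"
    and g2: "\<And>y. 1 \<le> y \<Longrightarrow> 0 \<le> g2 y" and gh: "\<And>y. 1 \<le> y \<Longrightarrow> y\<^sup>2 * g2 y \<le> c * h y"
    and t: "0 \<le> t1" "t1 \<le> t2" "t2 \<le> T" and S: "0 \<le> S"
    and hS: "AE t in lborel. t \<in> {t1..t2} \<longrightarrow> (\<integral>\<^sup>+v. ennreal (F (t, v) * h (bracket2 v)) \<partial>lborel) \<le> ennreal S"
  shows "op_integral g1 g2 t1 t2 \<le> 4 * K * c * (S * integral {t1..t2} rate)"
  unfolding op_integral_def
proof (rule integral_real_bounded)
  let ?H = "\<lambda>v. h (bracket2 v)"
  let ?I = "S * integral {t1..t2} rate"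
  have rp: "0 \<le> integral {t1..t2} rate"
    using rate_nonneg t by (intro Henstock_Kurzweil_Integration.integral_nonneg rate_integrable_on) auto
  have I0: "0 \<le> ?I" using rp S by simp
  show "0 \<le> 4 * K * c * ?I" using I0 K c0 by simp
  let ?W1 = "\<lambda>y. indicat_real {t1..t2} (fst y) * (pair_density y * pair_weight s ?H (fst (snd y)) (snd (snd y)))"
  let ?W2 = "\<lambda>y. indicat_real {t1..t2} (fst y) * (pair_density y * pair_weight s ?H (snd (snd y)) (fst (snd y)))"
  have W0: "0 \<le> ?W1 y" "0 \<le> ?W2 y" for y
    by (intro mult_nonneg_nonneg pair_density_nonneg pair_weight_nonneg h0; simp)+
  have [measurable]: "(\<lambda>y. pair_weight s ?H (fst (snd y)) (snd (snd y))) \<in> borel_measurable (borel \<Otimes>\<^sub>M (borel \<Otimes>\<^sub>M borel))"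
     "(\<lambda>y. pair_weight s ?H (snd (snd y)) (fst (snd y))) \<in> borel_measurable (borel \<Otimes>\<^sub>M (borel \<Otimes>\<^sub>M borel))"
    by (rule measurable_compose[OF measurable_snd pair_weight_measurable(1)] measurable_compose[OF measurable_snd pair_weight_measurable_swap], measurable)+
  have mW1: "?W1 \<in> borel_measurable lborel" by (rule borel_triple) measurable
  have mW2: "?W2 \<in> borel_measurable lborel" by (rule borel_triple) measurable
  have pt: "indicat_real {t1..t2} (fst y) * (pair_density y * landau_op \<psi> g1 g2 (fst (snd y)) (snd (snd y)))
      \<le> 2 * K * c * (?W1 y + ?W2 y)" for y
  proof -
    have op: "landau_op \<psi> g1 g2 v w \<le> 2 * K * c * (pair_weight s ?H v w + pair_weight s ?H w v)" for v w :: "real^'n"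
    proof (cases "v = w")
      case True
      then have "landau_op \<psi> g1 g2 v w = 0"
        using \<psi>z by (simp add: landau_op_def landau_a_def landau_b_def)
      then show ?thesis using K c0 pair_weight_nonneg[of ?H, OF h0] by simp
    next
      case False
      then show ?thesis
        by (intro landau_op_convex_le \<psi>0 \<psi>_far \<psi>_near K mono g2 gh) auto
    qed
    have "indicat_real {t1..t2} (fst y) * (pair_density y * landau_op \<psi> g1 g2 (fst (snd y)) (snd (snd y)))
      \<le> indicat_real {t1..t2} (fst y) * (pair_density y * (2 * K * c * (pair_weight s ?H (fst (snd y)) (snd (snd y)) + pair_weight s ?H (snd (snd y)) (fst (snd y)))))"
      by (intro mult_left_mono op pair_density_nonneg) auto
    then show ?thesis by (simp only: distrib_left mult.left_commute[of _ "2 * K * c"])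
  qed
  have "(\<integral>\<^sup>+y. ennreal (indicat_real {t1..t2} (fst y) * (pair_density y * landau_op \<psi> g1 g2 (fst (snd y)) (snd (snd y)))) \<partial>lborel)
     \<le> (\<integral>\<^sup>+y. ennreal (2 * K * c) * (ennreal (?W1 y) + ennreal (?W2 y)) \<partial>lborel)"
  proof (rule nn_integral_mono)
    fix y
    have "ennreal (2 * K * c) * (ennreal (?W1 y) + ennreal (?W2 y)) = ennreal (2 * K * c * (?W1 y + ?W2 y))"
      using W0[of y] K c0 by (simp only: ennreal_plus[symmetric]) (intro ennreal_mult[symmetric] add_nonneg_nonneg; simp)
    then show "ennreal (indicat_real {t1..t2} (fst y) * (pair_density y * landau_op \<psi> g1 g2 (fst (snd y)) (snd (snd y))))
        \<le> ennreal (2 * K * c) * (ennreal (?W1 y) + ennreal (?W2 y))"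
      using ennreal_leI[OF pt[of y]] by simp
  qed
  also have "\<dots> = ennreal (2 * K * c) * ((\<integral>\<^sup>+y. ennreal (?W1 y) \<partial>lborel) + (\<integral>\<^sup>+y. ennreal (?W2 y) \<partial>lborel))"
    using mW1 mW2 by (subst nn_integral_cmult) (auto simp: nn_integral_add)
  also have "\<dots> \<le> ennreal (2 * K * c) * (ennreal ?I + ennreal ?I)"
    using t S hS h0 by (intro mult_left_mono add_mono pair_weight_time_bound) auto
  also have "\<dots> = ennreal (4 * K * c * ?I)"
  proof -
    have "ennreal ?I + ennreal ?I = ennreal (2 * ?I)" using I0 by (simp flip: ennreal_plus)
    then have "ennreal (2 * K * c) * (ennreal ?I + ennreal ?I) = ennreal ((2 * K * c) * (2 * ?I))"
      using I0 K c0 by (simp only:) (intro ennreal_mult[symmetric]; simp)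
    also have "(2 * K * c) * (2 * ?I) = 4 * K * c * ?I" by simp
    finally show ?thesis .
  qed
  finally show "(\<integral>\<^sup>+y. ennreal (indicat_real {t1..t2} (fst y) * (pair_density y * landau_op \<psi> g1 g2 (fst (snd y)) (snd (snd y)))) \<partial>lborel)
     \<le> ennreal (4 * K * c * ?I)" .
qed

end

section \<open>Growth of moments\<close>

lemma reg_power_measurable [measurable]:
  "reg_power p e \<in> borel_measurable borel" "reg_power1 p e \<in> borel_measurable borel" "reg_power2 p e \<in> borel_measurable borel"
  unfolding reg_power_def[abs_def] reg_power1_def[abs_def] reg_power2_def[abs_def] saturated_def by measurable

lemma cut_power_measurable [measurable]:
  "cut_power1 p e n \<in> borel_measurable borel" "cut_power2 p e n \<in> borel_measurable borel" "cut_power p e n \<in> borel_measurable borel"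
  unfolding cut_power_def[abs_def] cut_power1_def[abs_def] cut_power2_def[abs_def] ramp_def by measurable

lemma bracket2_lebesgue_measurable [measurable]:
  assumes [measurable]: "h \<in> borel_measurable borel"
  shows "(\<lambda>v. h (bracket2 v)) \<in> borel_measurable lebesgue"
proof -
  have "(\<lambda>v. h (bracket2 v)) \<in> borel_measurable lborel" by simp
  then show ?thesis by (rule measurable_completion)
qed

context landau_data
begin

context
  fixes f :: "real \<Rightarrow> real^'n \<Rightarrow> real" and \<psi>' :: "real \<Rightarrow> real"
  assumes fF: "AE t in lborel. t \<in> {0..T} \<longrightarrow> (AE v in lborel. f t v = F (t, v))"
    and \<psi>': "AE z in (lborel :: (real^'n) measure). \<psi>' (norm z) = \<psi> (norm z)"
    and wf: "landau_weak_form T \<psi>' f"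
    and fm: "\<And>t. t \<in> {0..T} \<Longrightarrow> f t \<in> borel_measurable lebesgue"
    and f0: "\<And>t. t \<in> {0..T} \<Longrightarrow> AE v in lebesgue. 0 \<le> f t v"
    and fE: "\<And>t. t \<in> {0..T} \<Longrightarrow> (\<integral>\<^sup>+v. ennreal (f t v * bracket2 v) \<partial>lebesgue) = ennreal E"
begin

lemma f_bracket2_integrable:
  assumes t: "t \<in> {0..T}"
  shows "integrable lebesgue (\<lambda>v. f t v * bracket2 v)"
proof (rule integrableI_bounded)
  have [measurable]: "f t \<in> borel_measurable lebesgue" using fm t .
  have [measurable]: "bracket2 \<in> borel_measurable lebesgue" using bracket2_lebesgue_measurable[of "\<lambda>x. x"] by simp
  show "(\<lambda>v. f t v * bracket2 v) \<in> borel_measurable lebesgue" by measurable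
  have "(\<integral>\<^sup>+v. ennreal (norm (f t v * bracket2 v)) \<partial>lebesgue) = (\<integral>\<^sup>+v. ennreal (f t v * bracket2 v) \<partial>lebesgue)"
    using f0[OF t] by (intro nn_integral_cong_AE) (auto elim!: eventually_mono)
  then show "(\<integral>\<^sup>+v. ennreal (norm (f t v * bracket2 v)) \<partial>lebesgue) < \<infinity>" using fE[OF t] by simp
qed

text \<open>
  Mass and energy control the integral of every function of at most linear growth in \<open>bracket2\<close>.
\<close>

lemma f_h_integrable:
  assumes t: "t \<in> {0..T}" and h: "h \<in> borel_measurable borel" and b: "\<And>v::real^'n. 0 \<le> h (bracket2 v)" "\<And>v::real^'n. h (bracket2 v) \<le> B * bracket2 v"
  shows "integrable lebesgue (\<lambda>v. f t v * h (bracket2 v))"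
    and "ennreal (\<integral>v. f t v * h (bracket2 v) \<partial>lebesgue) = (\<integral>\<^sup>+v. ennreal (f t v * h (bracket2 v)) \<partial>lebesgue)"
    and "0 \<le> (\<integral>v. f t v * h (bracket2 v) \<partial>lebesgue)"
    and "(\<integral>v. f t v * h (bracket2 v) \<partial>lebesgue) \<le> B * (\<integral>v. f t v * bracket2 v \<partial>lebesgue)"
proof -
  have [measurable]: "f t \<in> borel_measurable lebesgue" using fm t .
  have [measurable]: "(\<lambda>v::real^'n. h (bracket2 v)) \<in> borel_measurable lebesgue" using h by (rule bracket2_lebesgue_measurable)
  have le: "AE v in lebesgue. 0 \<le> f t v * h (bracket2 v) \<and> f t v * h (bracket2 v) \<le> B * (f t v * bracket2 v)"
    using f0[OF t]
  proof eventually_elim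
    case (elim v)
    then show ?case using b[of v] mult_left_mono[OF b(2)[of v] elim] by (simp add: mult_ac)
  qed
  show int: "integrable lebesgue (\<lambda>v. f t v * h (bracket2 v))"
  proof (rule Bochner_Integration.integrable_bound)
    show "integrable lebesgue (\<lambda>v. B * (f t v * bracket2 v))" using f_bracket2_integrable[OF t] by simp
    show "AE v in lebesgue. norm (f t v * h (bracket2 v)) \<le> norm (B * (f t v * bracket2 v))"
      using le by eventually_elim auto
  qed measurable
  show "ennreal (\<integral>v. f t v * h (bracket2 v) \<partial>lebesgue) = (\<integral>\<^sup>+v. ennreal (f t v * h (bracket2 v)) \<partial>lebesgue)"
    using le by (intro nn_integral_eq_integral[symmetric] int) (auto elim!: eventually_mono)
  show "0 \<le> (\<integral>v. f t v * h (bracket2 v) \<partial>lebesgue)"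
    using le by (intro integral_nonneg_AE) (auto elim!: eventually_mono)
  have "(\<integral>v. f t v * h (bracket2 v) \<partial>lebesgue) \<le> (\<integral>v. B * (f t v * bracket2 v) \<partial>lebesgue)"
    using le f_bracket2_integrable[OF t] by (intro integral_mono_AE int) (auto elim!: eventually_mono)
  then show "(\<integral>v. f t v * h (bracket2 v) \<partial>lebesgue) \<le> B * (\<integral>v. f t v * bracket2 v \<partial>lebesgue)" by simp
qed

lemma f_bracket2_integral:
  assumes t: "t \<in> {0..T}"
  shows "(\<integral>v. f t v * bracket2 v \<partial>lebesgue) = E"
proof -
  have "ennreal (\<integral>v. f t v * bracket2 v \<partial>lebesgue) = (\<integral>\<^sup>+v. ennreal (f t v * bracket2 v) \<partial>lebesgue)"
    using f_h_integrable(2)[OF t, of "\<lambda>x. x" 1] by simp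
  moreover have "0 \<le> (\<integral>v. f t v * bracket2 v \<partial>lebesgue)" using f_h_integrable(3)[OF t, of "\<lambda>x. x" 1] by simp
  ultimately show ?thesis using fE[OF t] E0 by (simp add: ennreal_inj)
qed

text \<open>
  The weak form for a test function that is not compactly supported: the cutoff is removed on both sides.
\<close>

lemma reg_power_moment_identity:
  assumes p: "0 < p" and e: "0 < e" and t: "0 \<le> t1" "t1 \<le> t2" "t2 \<le> T"
  shows "(\<integral>v. f t2 v * reg_power p e (bracket2 v) \<partial>lebesgue) - (\<integral>v. f t1 v * reg_power p e (bracket2 v) \<partial>lebesgue)
    = op_integral (reg_power1 p e) (reg_power2 p e) t1 t2"
proof -
  define C where "C = e powr (-p) * ((p + 1) * (p + 6) + 6)"
  have n: "0 < real (Suc n)" for n by simp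
  note gb = cut_power_bounds[OF p e n _ C_def]
  have conv: "(\<lambda>n. \<integral>v. f t v * cut_power p e (real (Suc n)) (bracket2 v) \<partial>lebesgue) \<longlonglongrightarrow> (\<integral>v. f t v * reg_power p e (bracket2 v) \<partial>lebesgue)"
    if t: "t \<in> {0..T}" for t
  proof (rule integral_dominated_convergence)
    have [measurable]: "f t \<in> borel_measurable lebesgue" using fm t .
    show "integrable lebesgue (\<lambda>v. e powr (-p) * (f t v * bracket2 v))" using f_bracket2_integrable[OF t] by simp
    show "(\<lambda>v. f t v * reg_power p e (bracket2 v)) \<in> borel_measurable lebesgue" by measurable
    show "(\<lambda>v. f t v * cut_power p e (real (Suc n)) (bracket2 v)) \<in> borel_measurable lebesgue" for n by measurable
    show "AE v in lebesgue. (\<lambda>n. f t v * cut_power p e (real (Suc n)) (bracket2 v)) \<longlonglongrightarrow> f t v * reg_power p e (bracket2 v)"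
      by (intro AE_I2 tendsto_intros cut_power_tendsto[OF p e])
    show "AE v in lebesgue. norm (f t v * cut_power p e (real (Suc n)) (bracket2 v)) \<le> e powr (-p) * (f t v * bracket2 v)" for n
      using f0[OF t]
    proof eventually_elim
      case (elim v)
      have "f t v * cut_power p e (real (Suc n)) (bracket2 v) \<le> f t v * (e powr (-p) * bracket2 v)"
        using elim by (intro mult_left_mono gb) auto
      moreover have "0 \<le> f t v * cut_power p e (real (Suc n)) (bracket2 v)" by (intro mult_nonneg_nonneg elim gb) auto
      ultimately show ?case by (simp only: real_norm_def abs_of_nonneg mult_ac)
    qed
  qed
  have "(\<lambda>n. (\<integral>v. f t2 v * cut_power p e (real (Suc n)) (bracket2 v) \<partial>lebesgue) - (\<integral>v. f t1 v * cut_power p e (real (Suc n)) (bracket2 v) \<partial>lebesgue))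
     \<longlonglongrightarrow> (\<integral>v. f t2 v * reg_power p e (bracket2 v) \<partial>lebesgue) - (\<integral>v. f t1 v * reg_power p e (bracket2 v) \<partial>lebesgue)"
    using t by (intro tendsto_diff conv) auto
  moreover have "(\<integral>v. f t2 v * cut_power p e (real (Suc n)) (bracket2 v) \<partial>lebesgue) - (\<integral>v. f t1 v * cut_power p e (real (Suc n)) (bracket2 v) \<partial>lebesgue)
      = op_integral (cut_power1 p e (real (Suc n))) (cut_power2 p e (real (Suc n))) t1 t2" for n
    by (rule weak_form_op[where C = C and n = "real (Suc n)", OF fF \<psi>' wf cut_power_radial_C2[OF p e n]]) (use gb n t in \<open>auto simp: less_le_trans\<close>)
  moreover have "(\<lambda>n. op_integral (cut_power1 p e (real (Suc n))) (cut_power2 p e (real (Suc n))) t1 t2)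
      \<longlonglongrightarrow> op_integral (reg_power1 p e) (reg_power2 p e) t1 t2"
    by (rule op_integral_limit[where C = C, OF cut_power_radial_C2[OF p e n]])
       (use gb t cut_power_tendsto[OF p e] in \<open>auto simp: less_le_trans\<close>)
  ultimately show ?thesis using LIMSEQ_unique by simp
qed

text \<open>
  Convexity of the regularised power turns the identity into the hypothesis of the Gronwall inequality. The
  constants do not depend on \<open>\<epsilon>\<close>.
\<close>

lemma reg_power_moment_growth:
  assumes p: "0 < p" and e: "0 < e" and t: "t \<in> {0..T}"
    and n: "4 * K * (p * (p + 1)) * ((1 + C0) * (E * T + A)) \<le> real n / 2"
  shows "(\<integral>\<^sup>+v. ennreal (f t v * reg_power p e (bracket2 v)) \<partial>lebesgue) \<le> 2 ^ n * (\<integral>\<^sup>+v. ennreal (f 0 v * reg_power p e (bracket2 v)) \<partial>lebesgue)"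
proof -
  let ?c = "4 * K * (p * (p + 1))"
  define M where "M = (\<lambda>t. \<integral>v. f t v * reg_power p e (bracket2 v) \<partial>lebesgue)"
  note hb = reg_power_bounds[OF p e]
  note fh = f_h_integrable[OF _ reg_power_measurable(1) hb(1,2)[OF bracket2_pos], folded M_def]
  have c0: "0 \<le> ?c" using K p by simp
  have "M t \<le> 2 ^ n * M 0"
  proof (rule Gronwall_finite_doubling[where a = "\<lambda>t. ?c * rate t" and B = "e powr (-p) * E" and T = T])
    show "(\<lambda>t. ?c * rate t) integrable_on {0..T}"
      using rate_integrable_on[of 0 T] by (intro integrable_on_mult_right) auto
    show "0 \<le> ?c * rate t" for t using c0 rate_nonneg by (rule mult_nonneg_nonneg)
    show "integral {0..T} (\<lambda>t. ?c * rate t) \<le> real n / 2" using n by (simp add: rate_integral)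
    show "0 \<le> M t \<and> M t \<le> e powr (-p) * E" if "t \<in> {0..T}" for t
      using fh(3,4)[OF that] by (simp add: f_bracket2_integral[OF that] M_def)
    fix t1 t2 S :: real
    assume t: "0 \<le> t1" "t1 \<le> t2" "t2 \<le> T" and S: "0 \<le> S" and MS: "\<And>r. r \<in> {t1..t2} \<Longrightarrow> M r \<le> S"
    have "M t2 - M t1 = op_integral (reg_power1 p e) (reg_power2 p e) t1 t2"
      unfolding M_def by (rule reg_power_moment_identity[OF p e t])
    also have "\<dots> \<le> ?c * (S * integral {t1..t2} rate)"
    proof (rule op_integral_convex_le[where h = "reg_power p e"])
      show "AE t in lborel. t \<in> {t1..t2} \<longrightarrow> (\<integral>\<^sup>+v. ennreal (F (t, v) * reg_power p e (bracket2 v)) \<partial>lborel) \<le> ennreal S"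
        using fF
      proof eventually_elim
        case (elim r)
        show ?case
        proof
          assume r: "r \<in> {t1..t2}"
          then have rT: "r \<in> {0..T}" using t by auto
          have "AE v in lborel. ennreal (f r v * reg_power p e (bracket2 v)) = ennreal (F (r, v) * reg_power p e (bracket2 v))"
            using elim rT by (auto elim!: eventually_mono)
          then have "(\<integral>\<^sup>+v. ennreal (f r v * reg_power p e (bracket2 v)) \<partial>lebesgue) = (\<integral>\<^sup>+v. ennreal (F (r, v) * reg_power p e (bracket2 v)) \<partial>lborel)"
            by (rule nn_integral_lebesgue_AE_borel)
          then show "(\<integral>\<^sup>+v. ennreal (F (r, v) * reg_power p e (bracket2 v)) \<partial>lborel) \<le> ennreal S"
            using fh(2)[OF rT] ennreal_leI[OF MS[OF r]] by (simp add: M_def)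
        qed
      qed
    qed (use t S hb reg_power1_mono[OF p e] p in auto)
    finally show "M t2 \<le> M t1 + S * integral {t1..t2} (\<lambda>t. ?c * rate t)" by (simp add: mult_ac)
  qed (use t T0 in auto)
  then have "ennreal (M t) \<le> ennreal (2 ^ n * M 0)" by (rule ennreal_leI)
  also have "\<dots> = 2 ^ n * ennreal (M 0)" by (simp add: ennreal_mult' ennreal_power[symmetric])
  finally show ?thesis using fh(2)[OF t] fh(2)[of 0] T0 by (simp add: M_def)
qed

text \<open>
  Fatou's lemma along \<open>\<epsilon> = 1 / (j + 1)\<close> on the left; on the right the regularised power is at most the power.
\<close>

lemma moment_growth:
  assumes p: "0 < p" and t: "t \<in> {0..T}"
    and n: "4 * K * (p * (p + 1)) * ((1 + C0) * (E * T + A)) \<le> real n / 2"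
  shows "moment (1 + p) (f t) \<le> 2 ^ n * moment (1 + p) (f 0)"
proof -
  have [measurable]: "f t \<in> borel_measurable lebesgue" using fm t .
  let ?u = "\<lambda>j v. ennreal (f t v * reg_power p (1 / real (Suc j)) (bracket2 v))"
  have lim: "(\<lambda>j. ?u j v) \<longlonglongrightarrow> ennreal (f t v * bracket2 v powr (1 + p))" for v
  proof -
    have "(\<lambda>j. 1 / real (Suc j)) \<longlonglongrightarrow> 0"
      using LIMSEQ_inverse_real_of_nat by (simp add: inverse_eq_divide)
    then have "(\<lambda>j. f t v * (bracket2 v * (bracket2 v / (1 + 1 / real (Suc j) * bracket2 v)) powr p)) \<longlonglongrightarrow>
       f t v * (bracket2 v * (bracket2 v / (1 + 0 * bracket2 v)) powr p)"
      by (intro tendsto_intros) auto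
    then show ?thesis unfolding reg_power_def saturated_def by (intro tendsto_ennrealI) (simp add: powr_add)
  qed
  have "moment (1 + p) (f t) = (\<integral>\<^sup>+v. liminf (\<lambda>j. ?u j v) \<partial>lebesgue)"
    unfolding moment_def bracket2_def[symmetric]
    by (intro nn_integral_cong) (use lim_imp_Liminf[OF _ lim] in simp)
  also have "\<dots> \<le> liminf (\<lambda>j. \<integral>\<^sup>+v. ?u j v \<partial>lebesgue)"
    by (rule nn_integral_liminf) measurable
  also have "\<dots> \<le> 2 ^ n * moment (1 + p) (f 0)"
  proof -
    have "(\<integral>\<^sup>+v. ?u j v \<partial>lebesgue) \<le> 2 ^ n * moment (1 + p) (f 0)" for j
    proof -
      have e: "0 < 1 / real (Suc j)" by simp
      have "(\<integral>\<^sup>+v. ?u j v \<partial>lebesgue) \<le> 2 ^ n * (\<integral>\<^sup>+v. ennreal (f 0 v * reg_power p (1 / real (Suc j)) (bracket2 v)) \<partial>lebesgue)"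
        by (rule reg_power_moment_growth[OF p e t n])
      also have "\<dots> \<le> 2 ^ n * moment (1 + p) (f 0)"
        unfolding moment_def bracket2_def[symmetric]
      proof (intro mult_left_mono nn_integral_mono_AE)
        have "AE v in lebesgue. 0 \<le> f 0 v" using T0 by (intro f0) auto
        then show "AE v in lebesgue. ennreal (f 0 v * reg_power p (1 / real (Suc j)) (bracket2 v)) \<le> ennreal (f 0 v * bracket2 v powr (1 + p))"
          by eventually_elim (intro ennreal_leI mult_left_mono reg_power_bounds[OF p e]; simp)
      qed auto
      finally show ?thesis .
    qed
    then have "liminf (\<lambda>j. \<integral>\<^sup>+v. ?u j v \<partial>lebesgue) \<le> liminf (\<lambda>j::nat. 2 ^ n * moment (1 + p) (f 0))"
      by (intro Liminf_mono always_eventually) auto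
    then show ?thesis by (simp add: Liminf_const)
  qed
  finally show ?thesis .
qed

end

end

section \<open>Application to weak solutions\<close>

text \<open>
  With \<open>r = (m + 1) s\<close> the last condition reads \<open>r < 4\<close> for \<open>N \<ge> 3\<close>, since then
  \<open>N (1 - 1 / q) = 2\<close>, and \<open>r < 4 (1 - 1 / q)\<close> for \<open>N = 2\<close>, where \<open>q\<close> may be taken as large as needed.
\<close>

lemma admissible_exponent:
  fixes \<gamma>1 \<gamma>2 :: real
  assumes N: "CARD('n::finite) \<ge> 2" and c: "(\<gamma>2 + 2) * (1 - min (\<gamma>1 / 2) (-1)) > -4"
  obtains q s m where "q \<in> Q_exponents TYPE('n)" "q > 1" "s > 0" "- (\<gamma>2 + 2) \<le> s" "m \<ge> 1" "min (\<gamma>1 / 2) (-1) = - m"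
    "(m + 1) * s < 2 * (real CARD('n) * (1 - 1 / q))"
proof -
  define m where "m = - min (\<gamma>1 / 2) (-1)"
  have m: "m \<ge> 1" "min (\<gamma>1 / 2) (-1) = - m" by (auto simp: m_def)
  \<comment> \<open>The second entry keeps \<open>s\<close> positive when \<open>\<gamma>2 \<ge> -2\<close>, where the kernel is bounded near the diagonal.\<close>
  define s where "s = max (- (\<gamma>2 + 2)) (1 / (m + 1))"
  have s: "s > 0" "- (\<gamma>2 + 2) \<le> s" using m by (auto simp: s_def less_max_iff_disj)
  define r where "r = (m + 1) * s"
  have "(m + 1) * (- (\<gamma>2 + 2)) < 4" using c unfolding m(2) by (simp add: algebra_simps)
  moreover have "(m + 1) * (1 / (m + 1)) < 4" using m by simp
  ultimately have r: "r < 4" unfolding r_def s_def by (simp only: max_def split: if_splits) auto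
  have r0: "r > 0" using s m by (simp add: r_def)
  show ?thesis
  proof (cases "CARD('n) = 2")
    case True
    \<comment> \<open>Chosen so that \<open>4 (1 - 1 / q) = 2 + r / 2\<close> is the mean of \<open>r\<close> and \<open>4\<close>.\<close>
    define q where "q = 8 / (4 - r)"
    have q: "q > 1" using r r0 by (simp add: q_def divide_simps)
    have "r < 2 * (real CARD('n) * (1 - 1 / q))" using True r by (simp add: q_def field_simps)
    then show ?thesis using True q s m by (intro that[of q s m]) (auto simp: Q_exponents_def r_def)
  next
    case False
    then have N3: "CARD('n) \<ge> 3" using N by simp
    define q where "q = real CARD('n) / (real CARD('n) - 2)"
    have q: "q > 1" using N3 by (simp add: q_def)
    have "2 * (real CARD('n) * (1 - 1 / q)) = 4" using N3 by (simp add: q_def field_simps)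
    then show ?thesis using False q s m r by (intro that[of q s m]) (auto simp: Q_exponents_def r_def q_def)
  qed
qed

text \<open>
  A Borel representative need not obey the bounds on a null set, so it is truncated to lie between \<open>0\<close>
  and the upper bound.
\<close>

lemma kernel_borel_version:
  assumes kb: "kernel_bounds K1 K2 K3 \<delta> \<gamma>1 \<gamma>2 \<psi>" and K: "K1 > 0" "K2 > 0"
  obtains \<psi>B where "\<psi>B \<in> borel_measurable borel" "\<And>r. 0 \<le> \<psi>B r" "\<psi>B 0 = 0"
    "\<And>r. 0 < r \<Longrightarrow> \<psi>B r \<le> K1 * r powr (2 - \<delta>) + K2 * r powr (\<gamma>2 + 2)"
    "AE z in (lborel :: (real^'n::finite) measure). \<psi> (norm z) = \<psi>B (norm z)"
proof -
  have \<psi>m: "\<psi> \<in> borel_measurable (lebesgue_on {0<..})" and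
    \<psi>b: "\<And>r. 0 < r \<Longrightarrow> 0 \<le> \<psi> r \<and> \<psi> r \<le> K1 * r powr (2 - \<delta>) + K2 * r powr (\<gamma>2 + 2)"
    using kb by (auto simp: kernel_bounds_def)
  have "(\<lambda>r. if r \<in> {0<..} then \<psi> r else 0) \<in> borel_measurable lebesgue"
    using \<psi>m by (rule borel_measurable_if_I) auto
  then obtain \<psi>2 where \<psi>2[measurable]: "\<psi>2 \<in> borel_measurable borel"
    and eq: "AE r in lborel. (if r \<in> {0<..} then \<psi> r else 0) = \<psi>2 r"
    by (rule lebesgue_ex_borel)
  define \<psi>B where "\<psi>B r = (if 0 < r then max 0 (min (\<psi>2 r) (K1 * r powr (2 - \<delta>) + K2 * r powr (\<gamma>2 + 2))) else 0)" for r
  have "AE r in lborel. 0 < r \<longrightarrow> \<psi> r = \<psi>B r"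
    using eq
  proof eventually_elim
    case (elim r)
    then show ?case using \<psi>b[of r] by (auto simp: \<psi>B_def)
  qed
  then have "AE z in (lborel :: (real^'n) measure). 0 < norm z \<longrightarrow> \<psi> (norm z) = \<psi>B (norm z)" by (rule AE_norm)
  moreover have "AE z in (lborel :: (real^'n) measure). z \<noteq> 0" by (rule AE_lborel_singleton)
  ultimately have "AE z in (lborel :: (real^'n) measure). \<psi> (norm z) = \<psi>B (norm z)" by eventually_elim auto
  moreover have "\<psi>B \<in> borel_measurable borel" unfolding \<psi>B_def[abs_def] by measurable
  ultimately show ?thesis using K by (intro that[of \<psi>B]) (auto simp: \<psi>B_def intro!: add_nonneg_nonneg)
qed

text \<open>
  Almost everywhere equality in time and velocity gives, by Fubini, equality of almost every time slice, which is
  all that the weak form sees.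
\<close>

lemma solution_borel_version:
  fixes f :: "real \<Rightarrow> real^'n::finite \<Rightarrow> real"
  assumes fm: "(\<lambda>(t, v). f t v) \<in> borel_measurable (lebesgue_on ({0..T} \<times> UNIV))"
    and f0: "\<And>t. t \<in> {0..T} \<Longrightarrow> AE v in lebesgue. 0 \<le> f t v"
  obtains F where "F \<in> borel_measurable borel" "\<And>x. 0 \<le> F x"
    "AE t in lborel. t \<in> {0..T} \<longrightarrow> (AE v in lborel. f t v = F (t, v))"
proof -
  have "(\<lambda>x. if x \<in> {0..T} \<times> UNIV then (case x of (t, v) \<Rightarrow> f t v) else 0) \<in> borel_measurable lebesgue"
  proof (rule borel_measurable_if_I[OF fm])
    have "{0..T} \<times> (UNIV :: (real^'n) set) \<in> sets borel" by (intro borel_closed closed_Times) auto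
    then show "{0..T} \<times> (UNIV :: (real^'n) set) \<in> sets lebesgue" by auto
  qed
  then obtain F0 where F0[measurable]: "F0 \<in> borel_measurable borel" and
    eq: "AE x in lborel. (if x \<in> {0..T} \<times> UNIV then (case x of (t, v) \<Rightarrow> f t v) else 0) = F0 x"
    by (rule lebesgue_ex_borel)
  have "AE x in lborel \<Otimes>\<^sub>M (lborel :: (real^'n) measure). (if x \<in> {0..T} \<times> UNIV then (case x of (t, v) \<Rightarrow> f t v) else 0) = F0 x"
    using eq by (simp only: lborel_prod)
  from lborel_pair.AE_pair[OF this]
  have eq2: "AE t in lborel. AE v in lborel. (if (t, v) \<in> {0..T} \<times> UNIV then f t v else 0) = F0 (t, v)"
    by (simp only: prod.case)
  show ?thesis
  proof (rule that[of "\<lambda>x. max 0 (F0 x)"])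
    show "AE t in lborel. t \<in> {0..T} \<longrightarrow> (AE v in lborel. f t v = max 0 (F0 (t, v)))"
      using eq2
    proof eventually_elim
      case (elim t)
      show ?case
      proof
        assume t: "t \<in> {0..T}"
        have "AE v in lborel. 0 \<le> f t v" using f0[OF t] by (simp add: AE_completion_iff)
        then show "AE v in lborel. f t v = max 0 (F0 (t, v))"
          using elim by eventually_elim (use t in auto)
      qed
    qed
  qed auto
qed

lemma weak_solution_mass_energy:
  fixes f :: "real \<Rightarrow> real^'n::finite \<Rightarrow> real"
  assumes sol: "landau_weak_solution T \<gamma>1 \<psi> fin f" and t: "t \<in> {0..T}"
  shows "(\<integral>\<^sup>+v. ennreal (f t v * bracket2 v) \<partial>lebesgue) = ennreal (mass fin + 2 * energy fin)"
    and "0 \<le> mass fin + 2 * energy fin"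
proof -
  have fL: "f t \<in> weighted_L1 2 \<inter> LlnL" using sol t by (auto simp: landau_weak_solution_def)
  have f0: "AE v in lebesgue. 0 \<le> f t v" and i1: "integrable lebesgue (f t)" using fL by (auto simp: LlnL_def)
  have iw: "integrable lebesgue (\<lambda>v. f t v * bracket2 v)"
    using fL by (simp add: weighted_L1_def bracket2_def[symmetric] mult.commute)
  have "\<forall>t\<in>{0..T}. \<forall>\<phi>\<in>{\<lambda>v. 1} \<union> range (\<lambda>i v. v $ i) \<union> {\<lambda>v. (norm v)\<^sup>2 / 2}.
        (\<integral>v. f t v * \<phi> v \<partial>lebesgue) = (\<integral>v. fin v * \<phi> v \<partial>lebesgue)"
    using sol unfolding landau_weak_solution_def by (elim conjE)
  note cons = this[rule_format, OF t]
  have m: "(\<integral>v. f t v \<partial>lebesgue) = mass fin" using cons[of "\<lambda>v. 1"] by (simp add: mass_def)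
  have e: "(\<integral>v. f t v * ((norm v)\<^sup>2 / 2) \<partial>lebesgue) = energy fin"
    using cons[of "\<lambda>v. (norm v)\<^sup>2 / 2"] by (simp add: energy_def)
  have eqw: "f t v * ((norm v)\<^sup>2 / 2) = (f t v * bracket2 v - f t v) / 2" for v by (simp add: bracket2_def algebra_simps)
  have "energy fin = ((\<integral>v. f t v * bracket2 v \<partial>lebesgue) - mass fin) / 2"
    unfolding e[symmetric] eqw m[symmetric] using iw i1 by simp
  then have E: "(\<integral>v. f t v * bracket2 v \<partial>lebesgue) = mass fin + 2 * energy fin" by simp
  have nn: "AE v in lebesgue. 0 \<le> f t v * bracket2 v" using f0 by eventually_elim simp
  show "(\<integral>\<^sup>+v. ennreal (f t v * bracket2 v) \<partial>lebesgue) = ennreal (mass fin + 2 * energy fin)"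
    using nn_integral_eq_integral[OF iw nn] E by simp
  show "0 \<le> mass fin + 2 * energy fin" using integral_nonneg_AE[OF nn] E by simp
qed

lemma ennpowr_measurable [measurable]: "(\<lambda>x. ennpowr x p) \<in> borel_measurable borel"
  unfolding ennpowr_def by measurable

text \<open>
  Verifies the assumptions of \<open>landau_data\<close> for Borel representatives and transfers \<open>moment_growth\<close> back. The
  exponent \<open>n\<close> depends on the solution only through mass, energy and the weighted \<open>L^q\<close> quantity.
\<close>

lemma weak_solution_moment_growth:
  fixes f :: "real \<Rightarrow> real^'n::finite \<Rightarrow> real"
  assumes T: "0 < T" and K: "K1 > 0" "K2 > 0" and \<delta>: "0 < \<delta>" "\<delta> \<le> 2" "\<gamma>2 \<le> - \<delta>"
    and kb: "kernel_bounds K1 K2 K3 \<delta> \<gamma>1 \<gamma>2 \<psi>" and sol: "landau_weak_solution T \<gamma>1 \<psi> fin f"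
    and q: "q \<in> Q_exponents TYPE('n)" "q > 1" and s: "s > 0" "- (\<gamma>2 + 2) \<le> s"
    and m: "m \<ge> 1" "min (\<gamma>1 / 2) (-1) = - m"
    and ms: "(m + 1) * s < 2 * (real CARD('n) * (1 - 1 / q))"
    and p: "0 < p" and t: "t \<in> {0..T}"
    and n: "4 * (K1 + K2) * (p * (p + 1)) * ((1 + singular_constant TYPE('n) q s m) *
      ((mass fin + 2 * energy fin) * T + enn2real (landau_Q T \<gamma>1 f q))) \<le> real n / 2"
  shows "moment (1 + p) (f t) \<le> 2 ^ n * moment (1 + p) fin"
proof -
  have fm: "(\<lambda>(t, v). f t v) \<in> borel_measurable (lebesgue_on ({0..T} \<times> UNIV))"
    and fL: "\<And>t. t \<in> {0..T} \<Longrightarrow> f t \<in> weighted_L1 2 \<inter> LlnL"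
    and init: "AE v in lebesgue. f 0 v = fin v"
    and wf: "landau_weak_form T \<psi> f" and Qfin: "landau_Q T \<gamma>1 f q < \<infinity>"
    using sol q(1) unfolding landau_weak_solution_def by blast+
  have f0: "AE v in lebesgue. 0 \<le> f t v" and ftm: "f t \<in> borel_measurable lebesgue" if "t \<in> {0..T}" for t
    using fL[OF that] by (auto simp: LlnL_def weighted_L1_def)
  obtain F where F: "F \<in> borel_measurable borel" "\<And>x. 0 \<le> F x"
    and fF: "AE t in lborel. t \<in> {0..T} \<longrightarrow> (AE v in lborel. f t v = F (t, v))"
    using solution_borel_version[OF fm f0] by blast
  obtain \<psi>B where \<psi>B: "\<psi>B \<in> borel_measurable borel" "\<And>r. 0 \<le> \<psi>B r" "\<psi>B 0 = 0"
    "\<And>r. 0 < r \<Longrightarrow> \<psi>B r \<le> K1 * r powr (2 - \<delta>) + K2 * r powr (\<gamma>2 + 2)"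
    and \<psi>eq: "AE z in (lborel :: (real^'n) measure). \<psi> (norm z) = \<psi>B (norm z)"
    using kernel_borel_version[OF kb K] by blast
  note [measurable] = F(1)
  have [measurable]: "F \<in> borel_measurable (borel \<Otimes>\<^sub>M borel)" using F(1) by (simp add: borel_prod)
  define I where "I t = (\<integral>\<^sup>+w. ennreal (F (t, w) powr q * bracket2 w powr (q * (-m))) \<partial>lborel)" for t
  have I_meas [measurable]: "I \<in> borel_measurable borel"
    unfolding I_def[abs_def] by measurable
  have IQ: "landau_Q T \<gamma>1 f q = (\<integral>\<^sup>+t\<in>{0..T}. ennpowr (I t) (1 / q) \<partial>lborel)"
    unfolding landau_Q_def
  proof (rule nn_integral_lebesgue_AE_borel)
    show "AE t in lborel. ennpowr (\<integral>\<^sup>+v. ennreal (\<bar>f t v\<bar> powr q * (1 + (norm v)\<^sup>2) powr (q * min (\<gamma>1 / 2) (-1))) \<partial>lebesgue) (1 / q) * indicator {0..T} t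
        = ennpowr (I t) (1 / q) * indicator {0..T} t"
      using fF
    proof eventually_elim
      case (elim t)
      show ?case
      proof (cases "t \<in> {0..T}")
        case True
        have "(\<integral>\<^sup>+v. ennreal (\<bar>f t v\<bar> powr q * (1 + (norm v)\<^sup>2) powr (q * min (\<gamma>1 / 2) (-1))) \<partial>lebesgue) = I t"
          unfolding I_def
        proof (rule nn_integral_lebesgue_AE_borel)
          show "AE v in lborel. ennreal (\<bar>f t v\<bar> powr q * (1 + (norm v)\<^sup>2) powr (q * min (\<gamma>1 / 2) (-1))) =
              ennreal (F (t, v) powr q * bracket2 v powr (q * (-m)))"
            using elim True by (auto elim!: eventually_mono simp: m(2) bracket2_def F(2))
        qed
        then show ?thesis by simp
      qed simp
    qed
  qed
  have Ifin: "AE t in lborel. t \<in> {0..T} \<longrightarrow> I t \<noteq> \<infinity>"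
  proof -
    have "AE t in lborel. ennpowr (I t) (1 / q) * indicator {0..T} t \<noteq> \<infinity>"
      using Qfin unfolding IQ by (intro nn_integral_PInf_AE) auto
    then show ?thesis by eventually_elim (auto simp: ennpowr_def)
  qed
  \<comment> \<open>The default value \<open>0\<close> of \<open>enn2real\<close> at infinity is taken only on a null set of times.\<close>
  define Qt where "Qt t = enn2real (I t)" for t
  have IQt: "AE t in lborel. t \<in> {0..T} \<longrightarrow> I t = ennreal (Qt t)"
    using Ifin by eventually_elim (auto simp: Qt_def less_top)
  interpret landau_data T "K1 + K2" q s m "singular_constant TYPE('n) q s m" "mass fin + 2 * energy fin"
      "enn2real (landau_Q T \<gamma>1 f q)" \<psi>B F Qt
  proof
    show "\<psi>B r \<le> (K1 + K2) * r\<^sup>2" if "1 \<le> r" for r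
      using that \<psi>B(4)[of r] s by (intro kernel_upper(1)[OF K \<delta>(2,1,3), of s]) auto
    show "\<psi>B r \<le> (K1 + K2) * r powr (-s)" if "0 < r" "r < 1" for r
      using that \<psi>B(4)[of r] s by (intro kernel_upper(2)[OF K \<delta>(2,1,3), of s]) auto
    show "0 \<le> mass fin + 2 * energy fin" using weak_solution_mass_energy(2)[OF sol, of 0] T by simp
    show "Qt \<in> borel_measurable borel" unfolding Qt_def[abs_def] by measurable
    show "AE t in lborel. t \<in> {0..T} \<longrightarrow>
        (\<integral>\<^sup>+w. ennreal (F (t, w) * bracket2 w) \<partial>lborel) = ennreal (mass fin + 2 * energy fin) \<and>
        (\<integral>\<^sup>+w. ennreal (F (t, w) powr q * bracket2 w powr (q * (-m))) \<partial>lborel) = ennreal (Qt t)"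
      using fF IQt
    proof eventually_elim
      case (elim t)
      have "(\<integral>\<^sup>+w. ennreal (F (t, w) * bracket2 w) \<partial>lborel) = ennreal (mass fin + 2 * energy fin)" if t: "t \<in> {0..T}"
      proof -
        have "AE v in lborel. ennreal (f t v * bracket2 v) = ennreal (F (t, v) * bracket2 v)"
          using elim(1) t by (auto elim!: eventually_mono)
        from nn_integral_lebesgue_AE_borel[OF this] show ?thesis
          using weak_solution_mass_energy(1)[OF sol t] by simp
      qed
      then show ?case using elim(2) by (auto simp: I_def)
    qed
    have "(\<integral>\<^sup>+t\<in>{0..T}. ennreal (Qt t powr (1 / q)) \<partial>lborel) = landau_Q T \<gamma>1 f q"
      unfolding IQ
    proof (rule nn_integral_cong_AE)
      show "AE t in lborel. ennreal (Qt t powr (1 / q)) * indicator {0..T} t = ennpowr (I t) (1 / q) * indicator {0..T} t"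
        using Ifin by eventually_elim (auto simp: ennpowr_def Qt_def indicator_def)
    qed
    then show "(\<integral>\<^sup>+t\<in>{0..T}. ennreal (Qt t powr (1 / q)) \<partial>lborel) = ennreal (enn2real (landau_Q T \<gamma>1 f q))"
      using Qfin by (simp add: less_top)
  qed (use F \<psi>B K q s m ms T in \<open>auto simp: singular_constant_def Qt_def\<close>)
  have "moment (1 + p) (f t) \<le> 2 ^ n * moment (1 + p) (f 0)"
    by (rule moment_growth[OF fF \<psi>eq wf ftm f0 weak_solution_mass_energy(1)[OF sol] p t n])
  also have "moment (1 + p) (f 0) = moment (1 + p) fin"
    unfolding moment_def by (rule nn_integral_cong_AE) (use init in \<open>auto elim!: eventually_mono\<close>)
  finally show ?thesis .
qed

lemma weak_solution_low_moment:
  fixes f :: "real \<Rightarrow> real^'n::finite \<Rightarrow> real"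
  assumes sol: "landau_weak_solution T \<gamma>1 \<psi> fin f" and t: "t \<in> {0..T}" and k: "k \<le> 1"
  shows "moment k (f t) \<le> ennreal (mass fin + 2 * energy fin)"
proof -
  have "AE v in lebesgue. 0 \<le> f t v" using sol t by (auto simp: landau_weak_solution_def LlnL_def)
  moreover have "bracket2 v powr k \<le> bracket2 v" for v :: "real^'n"
    using powr_mono[OF k bracket2_ge_1, of v] by simp
  ultimately have "moment k (f t) \<le> (\<integral>\<^sup>+v. ennreal (f t v * bracket2 v) \<partial>lebesgue)"
    unfolding moment_def bracket2_def[symmetric]
    by (intro nn_integral_mono_AE) (auto elim!: eventually_mono intro!: ennreal_leI mult_left_mono)
  then show ?thesis using weak_solution_mass_energy(1)[OF sol t] by simp
qed

theorem proposition4: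
  fixes T K1 K2 K3 \<delta> \<gamma>1 \<gamma>2 :: real
  assumes "CARD('n::finite) \<ge> 2" and "T > 0"
    and "K1 > 0" and "K2 > 0" and "K3 > 0"
    and "0 < \<delta>" and "\<delta> \<le> 2" and "\<gamma>1 \<le> 0" and "-4 < \<gamma>2" and "\<gamma>2 \<le> -\<delta>"
    and "(\<gamma>2 + 2) * (1 - min (\<gamma>1 / 2) (-1)) > -4"
  shows
    "(\<forall>\<psi> (fin :: real^'n \<Rightarrow> real) f.
        kernel_bounds K1 K2 K3 \<delta> \<gamma>1 \<gamma>2 \<psi> \<and> landau_weak_solution T \<gamma>1 \<psi> fin f \<longrightarrow>
        (\<forall>k. moment k fin < \<infinity> \<longrightarrow> (SUP t\<in>{0..T}. moment k (f t)) < \<infinity>))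
     \<and>
     (\<forall>k. \<exists>C :: real \<Rightarrow> real^'n \<Rightarrow> real \<Rightarrow> real \<Rightarrow> (real \<Rightarrow> ennreal) \<Rightarrow> ennreal \<Rightarrow> real.
        \<forall>\<psi> (fin :: real^'n \<Rightarrow> real) f H.
          kernel_bounds K1 K2 K3 \<delta> \<gamma>1 \<gamma>2 \<psi> \<and> landau_weak_solution T \<gamma>1 \<psi> fin f \<and>
          moment k fin < \<infinity> \<and> entropy fin \<le> H \<longrightarrow>
          (SUP t\<in>{0..T}. moment k (f t))
            \<le> ennreal (C (mass fin) (momentum fin) (energy fin) H
                (restrict (landau_Q T \<gamma>1 f) (Q_exponents TYPE('n))) (moment k fin)))"
    (is "?qualitative \<and> ?quantitative")
proof -
  obtain q s m where q: "q \<in> Q_exponents TYPE('n)" "q > 1" and s: "s > 0" "- (\<gamma>2 + 2) \<le> s"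
    and m: "m \<ge> 1" "min (\<gamma>1 / 2) (-1) = - m" and ms: "(m + 1) * s < 2 * (real CARD('n) * (1 - 1 / q))"
    using admissible_exponent[OF assms(1,11)] by blast
  have quant: ?quantitative
  proof
    fix k :: real
    define n where "n = (\<lambda>M E (Qf :: real \<Rightarrow> ennreal). nat \<lceil>2 * (4 * (K1 + K2) * ((k - 1) * (k - 1 + 1)) *
      ((1 + singular_constant TYPE('n) q s m) * ((M + 2 * E) * T + enn2real (Qf q))))\<rceil>)"
    define C :: "real \<Rightarrow> real^'n \<Rightarrow> real \<Rightarrow> real \<Rightarrow> (real \<Rightarrow> ennreal) \<Rightarrow> ennreal \<Rightarrow> real"
      where "C = (\<lambda>M P E H Qf mk. if k \<le> 1 then M + 2 * E else 2 ^ n M E Qf * enn2real mk)"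
    show "\<exists>C :: real \<Rightarrow> real^'n \<Rightarrow> real \<Rightarrow> real \<Rightarrow> (real \<Rightarrow> ennreal) \<Rightarrow> ennreal \<Rightarrow> real.
        \<forall>\<psi> (fin :: real^'n \<Rightarrow> real) f H.
          kernel_bounds K1 K2 K3 \<delta> \<gamma>1 \<gamma>2 \<psi> \<and> landau_weak_solution T \<gamma>1 \<psi> fin f \<and>
          moment k fin < \<infinity> \<and> entropy fin \<le> H \<longrightarrow>
          (SUP t\<in>{0..T}. moment k (f t))
            \<le> ennreal (C (mass fin) (momentum fin) (energy fin) H
                (restrict (landau_Q T \<gamma>1 f) (Q_exponents TYPE('n))) (moment k fin))"
    proof (intro exI[of _ C] allI impI SUP_least)
      fix \<psi> and fin :: "real^'n \<Rightarrow> real" and f H t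
      assume A: "kernel_bounds K1 K2 K3 \<delta> \<gamma>1 \<gamma>2 \<psi> \<and> landau_weak_solution T \<gamma>1 \<psi> fin f \<and>
          moment k fin < \<infinity> \<and> entropy fin \<le> H" and t: "t \<in> {0..T}"
      let ?Q = "restrict (landau_Q T \<gamma>1 f) (Q_exponents TYPE('n))"
      show "moment k (f t) \<le> ennreal (C (mass fin) (momentum fin) (energy fin) H ?Q (moment k fin))"
      proof (cases "k \<le> 1")
        case True
        then show ?thesis using weak_solution_low_moment[OF A[THEN conjunct2, THEN conjunct1] t True] by (simp add: C_def)
      next
        case False
        have "moment (1 + (k - 1)) (f t) \<le> 2 ^ n (mass fin) (energy fin) ?Q * moment (1 + (k - 1)) fin"
        proof (rule weak_solution_moment_growth[OF assms(2,3,4,6,7,10) _ _ q s m ms _ t])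
          show "4 * (K1 + K2) * ((k - 1) * (k - 1 + 1)) * ((1 + singular_constant TYPE('n) q s m) *
            ((mass fin + 2 * energy fin) * T + enn2real (landau_Q T \<gamma>1 f q)))
              \<le> real (n (mass fin) (energy fin) ?Q) / 2"
            unfolding n_def using q(1) by simp linarith
        qed (use A False in auto)
        also have "\<dots> = ennreal (2 ^ n (mass fin) (energy fin) ?Q * enn2real (moment k fin))"
          using A by (simp add: ennreal_mult' ennreal_power[symmetric] less_top)
        finally show ?thesis using False by (simp add: C_def)
      qed
    qed
  qed
  moreover have ?qualitative
  proof (intro allI impI)
    fix \<psi> and fin :: "real^'n \<Rightarrow> real" and f k
    assume A: "kernel_bounds K1 K2 K3 \<delta> \<gamma>1 \<gamma>2 \<psi> \<and> landau_weak_solution T \<gamma>1 \<psi> fin f" "moment k fin < \<infinity>"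
    obtain C :: "real \<Rightarrow> real^'n \<Rightarrow> real \<Rightarrow> real \<Rightarrow> (real \<Rightarrow> ennreal) \<Rightarrow> ennreal \<Rightarrow> real"
      where "\<And>\<psi> (fin :: real^'n \<Rightarrow> real) f H.
          kernel_bounds K1 K2 K3 \<delta> \<gamma>1 \<gamma>2 \<psi> \<and> landau_weak_solution T \<gamma>1 \<psi> fin f \<and>
          moment k fin < \<infinity> \<and> entropy fin \<le> H \<Longrightarrow>
          (SUP t\<in>{0..T}. moment k (f t))
            \<le> ennreal (C (mass fin) (momentum fin) (energy fin) H
                (restrict (landau_Q T \<gamma>1 f) (Q_exponents TYPE('n))) (moment k fin))"
      using quant by blast
    from this[of \<psi> fin f "entropy fin"] A show "(SUP t\<in>{0..T}. moment k (f t)) < \<infinity>"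
      by (auto intro: le_less_trans)
  qed
  ultimately show ?thesis by blast
qed

end
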